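(* Let $A=(a_{ij})\in \mathbf{RM}_n$ and $m=\lfloor n/2\rfloor$. Then for $C(A)$ to consist of concentric ellipses it is necessary and sufficient that $\xi_j:=(|a_{j,j+1}|-|a_{j+1,j}|)^2/4$ ($j=1,\dots,n-1$) satisfy the system of $m(m-1)/2$ homogeneous polynomial equations obtained as follows. Let $X_k=2\cos\frac{k\pi}{n+1}$, $k=1,\dots,m$, and for $j=1,\dots,m$ consider the identities in $\rho$ $$\sum_{1\le i_1<\cdots<i_j\le m}\ \prod_{k=1}^j\left(C_{i_k}+\rho X_{i_k}^2\right)=\sum_{1\le i_1\prec i_2\prec\cdots\prec i_j<n}\ \prod_{k=1}^j(\xi_{i_k}+\rho).\qquad ( *_j)$$ Equating the coefficients of $\rho^{j-1}$ in $( *_j)$, $j=1,\dots,m$, gives a system of $m$ linear equations in $C_1,\dots,C_m$ with an invertible coefficient matrix, which represents $C_1,\dots,C_m$ uniquely as linear functions of $\xi_1,\dots,\xi_{n-1}$. Substituting these expressions into the remaining $m(m-1)/2$ equations, obtained by equating the coefficients of $\rho^i$ in $( *_j)$ for $0\le i\le j-2$, $2\le j\le m$, yields the system in question; it is comprised of $k$ equations of degree $m-k+1$, with $k$ running from $1$ through $m-1$.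
   Context: $\mathbf{RM}_n$ is the set of complex $n\times n$ tridiagonal matrices $A=(a_{ij})$ with zero main diagonal and $a_{i,i+1}a_{i+1,i}=1$ for $i=1,\dots,n-1$ (reciprocal matrices). For a square matrix $A$, $\operatorname{Re}A=(A+A^* )/2$; the Kippenhahn polynomial of $A$ is $P_A(\lambda,\theta)=\det(\operatorname{Re}(e^{i\theta}A)-\lambda I)$, and the Kippenhahn curve $C(A)$ is the envelope of the family of lines $\{e^{-i\theta}(\lambda_j(\theta)+i\mathbb R):\theta\in(-\pi,\pi],\ j=1,\dots,n\}$, where $\lambda_j(\theta)$ are the roots of $P_A(\cdot,\theta)$. Write $i\prec j$ if $i,j\in\mathbb N$ and $j-i>1$. "Consists of concentric ellipses" refers to $m$ ellipses, all centered at the origin; for odd $n$ the curve $C(A)$ also contains the origin itself, which is disregarded here. *)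

theory Defs
  imports
    Complex_Main
    "HOL-Library.FuncSet"
    "HOL-Computational_Algebra.Polynomial"
    "Jordan_Normal_Form.Determinant"
    "Jordan_Normal_Form.Schur_Decomposition"
begin

(* Matrix indices of the type mat start at 0, so the entry a_{i,j} of an n x n matrix
   (i, j = 1, ..., n) is A $$ (i - 1, j - 1). *)

definition reciprocal_matrices :: "nat \<Rightarrow> complex mat set" where
  "reciprocal_matrices n = {A \<in> carrier_mat n n.
     (\<forall>i<n. \<forall>j<n. i + 1 < j \<or> j + 1 < i \<longrightarrow> A $$ (i, j) = 0) \<and>
     (\<forall>i<n. A $$ (i, i) = 0) \<and>
     (\<forall>i. i + 1 < n \<longrightarrow> A $$ (i, i + 1) * A $$ (i + 1, i) = 1)}"

definition mat_Re :: "complex mat \<Rightarrow> complex mat" where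
  "mat_Re A = (1 / 2) \<cdot>\<^sub>m (A + mat_adjoint A)"

definition kippenhahn_poly :: "complex mat \<Rightarrow> complex \<Rightarrow> real \<Rightarrow> complex" where
  "kippenhahn_poly A l \<theta> = det (mat_Re (cis \<theta> \<cdot>\<^sub>m A) - l \<cdot>\<^sub>m 1\<^sub>m (dim_row A))"

definition vertical_line_rotated :: "real \<Rightarrow> real \<Rightarrow> complex set" where
  "vertical_line_rotated \<theta> p = {cis (- \<theta>) * (of_real p + \<i> * of_real t) | t. True}"

(* The envelope of the lines vertical_line_rotated \<theta> p, where p runs through the roots of the
   Kippenhahn polynomial. That line has the equation Re (cis \<theta> * z) - p = 0. A point z belongs
   to the envelope iff for some \<theta> and some differentiable branch p = r(t) of the roots, defined
   near \<theta>, both this equation and its derivative with respect to the parameter hold at z.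
   For t outside (-pi, pi] the lines are those of the same family again, by periodicity.
   A branch all of whose lines pass through one point contributes that point. *)
definition kippenhahn_curve :: "complex mat \<Rightarrow> complex set" where
  "kippenhahn_curve A = {z. \<exists>\<theta>\<in>{-pi<..pi}. \<exists>r :: real \<Rightarrow> real.
     (\<forall>\<^sub>F t in nhds \<theta>. r differentiable (at t) \<and> kippenhahn_poly A (of_real (r t)) t = 0) \<and>
     z \<in> vertical_line_rotated \<theta> (r \<theta>) \<and>
     ((\<lambda>t. Re (cis t * z) - r t) has_real_derivative 0) (at \<theta>)}"

(* The ellipse centered at the origin with foci f, -f and major half-axis a. As an envelope of
   its tangent lines, the degenerate one (zero minor half-axis) is the pair of its foci. *)
definition central_ellipse :: "complex \<Rightarrow> real \<Rightarrow> complex set" where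
  "central_ellipse f a =
     (if a = cmod f then {f, - f} else {z. cmod (z - f) + cmod (z + f) = 2 * a})"

definition is_central_ellipse :: "complex set \<Rightarrow> bool" where
  "is_central_ellipse E \<longleftrightarrow> (\<exists>f a. 0 < a \<and> cmod f \<le> a \<and> E = central_ellipse f a)"

(* For odd n the origin is a further, disregarded, component of the curve. *)
definition consists_of_concentric_ellipses :: "complex mat \<Rightarrow> bool" where
  "consists_of_concentric_ellipses A \<longleftrightarrow>
     (\<exists>\<E>. finite \<E> \<and> card \<E> = dim_row A div 2 \<and> (\<forall>E\<in>\<E>. is_central_ellipse E) \<and>
          kippenhahn_curve A = \<Union>\<E> \<union> (if odd (dim_row A) then {0} else {}))"

definition xi :: "complex mat \<Rightarrow> nat \<Rightarrow> real" where
  "xi A j = (cmod (A $$ (j - 1, j)) - cmod (A $$ (j, j - 1)))\<^sup>2 / 4"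

definition X_node :: "nat \<Rightarrow> nat \<Rightarrow> real" where
  "X_node n k = 2 * cos (real k * pi / real (n + 1))"

definition prec :: "nat \<Rightarrow> nat \<Rightarrow> bool" (infix "\<prec>" 50) where
  "i \<prec> j \<longleftrightarrow> int j - int i > 1"

(* The two sides of the j-th identity, as polynomials in \<rho>; a chain of indices is represented
   by the set of its members. *)
definition identity_lhs :: "nat \<Rightarrow> (nat \<Rightarrow> real) \<Rightarrow> nat \<Rightarrow> real poly" where
  "identity_lhs n C j =
     (\<Sum>S | S \<subseteq> {1..n div 2} \<and> card S = j. \<Prod>i\<in>S. [:C i, (X_node n i)\<^sup>2:])"

definition identity_rhs :: "nat \<Rightarrow> (nat \<Rightarrow> real) \<Rightarrow> nat \<Rightarrow> real poly" where
  "identity_rhs n x j =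
     (\<Sum>S | S \<subseteq> {1..<n} \<and> card S = j \<and> (\<forall>a\<in>S. \<forall>b\<in>S. a < b \<longrightarrow> a \<prec> b).
        \<Prod>i\<in>S. [:x i, 1:])"

definition linear_equations :: "nat \<Rightarrow> (nat \<Rightarrow> real) \<Rightarrow> (nat \<Rightarrow> real) \<Rightarrow> bool" where
  "linear_equations n C x \<longleftrightarrow>
     (\<forall>j\<in>{1..n div 2}. coeff (identity_lhs n C j) (j - 1) = coeff (identity_rhs n x j) (j - 1))"

(* M is the matrix of the linear equations in the unknowns C 1, ..., C (n div 2). *)
definition is_coefficient_matrix :: "nat \<Rightarrow> real mat \<Rightarrow> bool" where
  "is_coefficient_matrix n M \<longleftrightarrow> M \<in> carrier_mat (n div 2) (n div 2) \<and>
     (\<forall>C. \<forall>j\<in>{1..n div 2}. coeff (identity_lhs n C j) (j - 1) =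
        (\<Sum>k\<in>{1..n div 2}. M $$ (j - 1, k - 1) * C k))"

definition linear_functions :: "nat \<Rightarrow> (nat \<Rightarrow> nat \<Rightarrow> real) \<Rightarrow> (nat \<Rightarrow> real) \<Rightarrow> nat \<Rightarrow> real" where
  "linear_functions n L x k = (\<Sum>i\<in>{1..<n}. L k i * x i)"

definition system_index :: "nat \<Rightarrow> (nat \<times> nat) set" where
  "system_index n = {(j, i). 2 \<le> j \<and> j \<le> n div 2 \<and> i + 2 \<le> j}"

(* The equation for the coefficient of \<rho>^i in the j-th identity, after the substitution of the
   linear functions with coefficients L for C, is system_poly n L (j, i) x = 0. *)
definition system_poly ::
    "nat \<Rightarrow> (nat \<Rightarrow> nat \<Rightarrow> real) \<Rightarrow> nat \<times> nat \<Rightarrow> (nat \<Rightarrow> real) \<Rightarrow> real" where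
  "system_poly n L = (\<lambda>(j, i) x.
     coeff (identity_lhs n (linear_functions n L x) j) i - coeff (identity_rhs n x j) i)"

(* f is (the function of) a nonzero homogeneous polynomial of degree d in the variables x i,
   i \<in> I. *)
definition homogeneous_of_degree :: "nat set \<Rightarrow> nat \<Rightarrow> ((nat \<Rightarrow> real) \<Rightarrow> real) \<Rightarrow> bool" where
  "homogeneous_of_degree I d f \<longleftrightarrow>
     (\<exists>c. \<forall>x. f x = (\<Sum>\<alpha> | \<alpha> \<in> I \<rightarrow>\<^sub>E UNIV \<and> (\<Sum>i\<in>I. \<alpha> i) = d.
                          c \<alpha> * (\<Prod>i\<in>I. x i ^ \<alpha> i))) \<and>
     (\<exists>x. f x \<noteq> 0)"

end

theory Submission
  imports Defs
begin

text \<open>The matrix \<open>Re (e\<^sup>i\<^sup>\<theta> A)\<close> is tridiagonal with zero diagonal, and the products of its opposite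
  off-diagonal entries are \<open>\<xi>\<^sub>j + \<rho>\<close> with \<open>\<rho> = cos\<^sup>2 \<theta>\<close>. Hence its characteristic polynomial is, up to sign
  and a factor \<open>\<lambda>\<close> for odd \<open>n\<close>, the polynomial in \<open>\<mu> = \<lambda>\<^sup>2\<close> whose coefficients are the right-hand sides of
  the identities, and the identities say that it equals the product of the \<open>\<mu> - (C\<^sub>k + \<rho> X\<^sub>k\<^sup>2)\<close>. For \<open>\<xi> = 0\<close>,
  \<open>\<rho> = 1\<close> and all \<open>C\<^sub>k = 0\<close> this is the Chebyshev factorization.

  If the factorization holds, the branches of roots are the support functions
  \<open>\<lambda> = \<plusminus> sqrt (C\<^sub>k + X\<^sub>k\<^sup>2 cos\<^sup>2 \<theta>)\<close> of ellipses with foci \<open>\<plusminus> X\<^sub>k\<close>. Conversely, near \<open>\<theta> = 0\<close> all roots are real and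
  simple, so there are \<open>m\<close> smooth positive branches, whose envelopes lie in a finite union of ellipses. On a
  common subinterval each branch is therefore the support function of an ellipse or of a single point;
  either way its square is \<open>c + Re (\<phi> e\<^sup>2\<^sup>i\<^sup>\<theta>) / 2\<close>. The leading coefficients in \<open>e\<^sup>2\<^sup>i\<^sup>\<theta>\<close> of the resulting
  factorization identify the numbers \<open>\<phi>\<close> with the \<open>X\<^sub>k\<^sup>2\<close>.

  The polynomials of the system do not vanish identically because for \<open>\<xi> = (0, \<dots>, 0, 1)\<close> the linear
  equations have a positive solution, by the interlacing of the roots of consecutive Chebyshev polynomials.\<close>

section \<open>Sparse index sets and tridiagonal polynomials\<close>


text \<open>The obstacle in the converse is that the ellipses are given only as point sets: nothing
  tells which branch of roots touches which ellipse, and a branch could pass from one to another or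
  rest at one point. As the ellipses are closed and finitely many, each branch stays on one of them
  over some subinterval, and there the equation of the ellipse becomes a differential equation for
  the branch. A small interval suffices because the claims are polynomial identities in cis (2
  \<theta>) or in the square of cos \<theta>, which hold everywhere once they hold at infinitely
  many points. The position near \<theta> = 0 matters: at \<rho> = 1 all products \<xi> + \<rho> are
  positive and the roots are simple, while near \<theta> = pi / 2 products may vanish and branches
  may cross. The numbers \<phi> are squares of foci and complex a priori. Comparing leading
  coefficients removes \<xi>, so that these numbers are the same as in the Chebyshev case \<xi> = 0.
  Only then is a pairing of branches with nodes available, and it exists because the squares of the
  nodes are distinct.\<close>

text \<open>Reading \<open>i\<close> as the edge {i, i + 1} of the path on \<open>n\<close>
  vertices, these are the matchings with \<open>j\<close> edges, since \<open>\<prec>\<close>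
  forbids neighbouring edges.\<close>

definition sparse_sets :: "nat \<Rightarrow> nat \<Rightarrow> nat set set" where
  "sparse_sets n j = {S. S \<subseteq> {1..<n} \<and> card S = j \<and> (\<forall>a\<in>S. \<forall>b\<in>S. a < b \<longrightarrow> a \<prec> b)}"

definition matching_sum :: "nat \<Rightarrow> (nat \<Rightarrow> 'a::comm_ring_1) \<Rightarrow> nat \<Rightarrow> 'a" where
  "matching_sum n b j = (\<Sum>S\<in>sparse_sets n j. \<Prod>i\<in>S. b i)"

lemma finite_sparse_sets [simp]: "finite (sparse_sets n j)"
  by (rule finite_subset[of _ "Pow {1..<n}"]) (auto simp: sparse_sets_def)

lemma sparse_setsD:
  assumes "S \<in> sparse_sets n j"
  shows "S \<subseteq> {1..<n}" "card S = j" "finite S"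
  using assms by (auto simp: sparse_sets_def intro: finite_subset)

lemma sparse_sets_0 [simp]: "sparse_sets n 0 = {{}}"
  by (auto simp: sparse_sets_def dest: finite_subset)

lemma sparse_sets_Suc_le_1: "n \<le> 1 \<Longrightarrow> sparse_sets n (Suc j) = {}"
  by (auto simp: sparse_sets_def)

text \<open>A matching on n + 2 vertices either avoids the last edge n + 1 or contains it; in the
  second case the edge n is excluded and the rest lives on n vertices.\<close>

lemma sparse_sets_Suc_Suc:
  "sparse_sets (n + 2) (Suc j) = sparse_sets (n + 1) (Suc j) \<union> insert (n + 1) ` sparse_sets n j"
  (is "?L = ?A \<union> ?B")
proof (intro equalityI subsetI)
  fix S assume S: "S \<in> ?L"
  show "S \<in> ?A \<union> ?B"
  proof (cases "n + 1 \<in> S")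
    case True
    have "a < n" "1 \<le> a" if "a \<in> S - {n + 1}" for a
    proof -
      have "a < n + 2" "a \<noteq> n + 1" "a \<in> S" "1 \<le> a" using that S by (auto simp: sparse_sets_def)
      moreover from this have "a \<prec> n + 1" using S True by (auto simp: sparse_sets_def)
      ultimately show "a < n" "1 \<le> a" by (auto simp: prec_def)
    qed
    then have "S - {n + 1} \<subseteq> {1..<n}" by fastforce
    moreover have "card (S - {n + 1}) = j" using True sparse_setsD[OF S] by simp
    moreover have "\<forall>a\<in>S - {n + 1}. \<forall>b\<in>S - {n + 1}. a < b \<longrightarrow> a \<prec> b"
      using S by (simp add: sparse_sets_def)
    ultimately have "S - {n + 1} \<in> sparse_sets n j" unfolding sparse_sets_def by blast
    then show ?thesis using True by (metis UnI2 imageI insert_Diff)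
  next
    case False
    have "a < n + 1" if "a \<in> S" for a
      using that S False by (cases "a = n + 1") (auto simp: sparse_sets_def)
    then show ?thesis using S by (auto simp: sparse_sets_def)
  qed
next
  fix S assume "S \<in> ?A \<union> ?B"
  then show "S \<in> ?L"
  proof
    assume "S \<in> ?A"
    then show ?thesis by (fastforce simp: sparse_sets_def)
  next
    assume "S \<in> ?B"
    then obtain T where T: "T \<in> sparse_sets n j" "S = insert (n + 1) T" by blast
    then have "n + 1 \<notin> T" "finite T" using sparse_setsD[OF T(1)] by auto
    then show ?thesis using T by (fastforce simp: sparse_sets_def prec_def)
  qed
qed

lemma sum_sparse_sets_Suc_Suc:
  fixes F :: "nat set \<Rightarrow> 'a::comm_monoid_add"
  shows "(\<Sum>S\<in>sparse_sets (n + 2) (Suc j). F S) =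
    (\<Sum>S\<in>sparse_sets (n + 1) (Suc j). F S) + (\<Sum>S\<in>sparse_sets n j. F (insert (n + 1) S))"
proof -
  have notin: "n + 1 \<notin> S" if "S \<in> sparse_sets n j \<or> S \<in> sparse_sets (n + 1) (Suc j)" for S
    using that by (auto simp: sparse_sets_def)
  have "inj_on (insert (n + 1)) (sparse_sets n j)"
    using notin by (auto simp: inj_on_def insert_ident)
  moreover have "sparse_sets (n + 1) (Suc j) \<inter> insert (n + 1) ` sparse_sets n j = {}"
    using notin by auto
  ultimately show ?thesis
    by (simp only: sparse_sets_Suc_Suc) (subst sum.union_disjoint, auto simp: sum.reindex)
qed

lemma matching_sum_0 [simp]: "matching_sum n b 0 = 1"
  by (simp add: matching_sum_def)

lemma matching_sum_Suc_Suc: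
  "matching_sum (n + 2) b (Suc j) =
     matching_sum (n + 1) b (Suc j) + b (n + 1) * matching_sum n b j"
proof -
  have "(\<Prod>i\<in>insert (n + 1) S. b i) = b (n + 1) * (\<Prod>i\<in>S. b i)" if "S \<in> sparse_sets n j" for S
    using sparse_setsD[OF that] by (subst prod.insert) auto
  then show ?thesis
    by (simp only: matching_sum_def sum_sparse_sets_Suc_Suc sum_distrib_left) simp
qed

text \<open>A matching with j edges covers 2 j vertices. This makes the truncated exponents
  \<open>n - 2 * j\<close> below harmless.\<close>

lemma matching_sum_eq_0: "n < 2 * j \<Longrightarrow> matching_sum n b j = 0"
proof (induction n arbitrary: j rule: less_induct)
  case (less n)
  consider "n \<le> 1" | k where "n = k + 2" by (metis add.commute le_Suc_ex not_less_eq_eq one_add_one plus_1_eq_Suc)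
  then show ?case
  proof cases
    case 1
    then show ?thesis using less.prems by (cases j) (auto simp: matching_sum_def sparse_sets_Suc_le_1)
  next
    case 2
    then obtain i where "j = Suc i" using less.prems by (cases j) auto
    then show ?thesis using 2 less.prems less.IH[of "k + 1" "Suc i"] less.IH[of k i]
      by (simp only: matching_sum_Suc_Suc) simp
  qed
qed

lemma matching_sum_scale: "matching_sum n (\<lambda>i. v * b i) j = v ^ j * matching_sum n b j"
  by (simp add: matching_sum_def sum_distrib_left prod.distrib sparse_setsD(2))

lemma matching_sum_of_real:
  "matching_sum n (\<lambda>i. of_real (b i)) j = (of_real (matching_sum n b j) :: 'a::{real_algebra_1,comm_ring_1})"
  by (simp add: matching_sum_def)

lemma poly_matching_sum: "poly (matching_sum n b j) x = matching_sum n (\<lambda>i. poly (b i) x) j"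
  by (simp add: matching_sum_def poly_sum poly_prod)

lemma identity_rhs_eq: "identity_rhs n x j = matching_sum n (\<lambda>i. [:x i, 1:]) j"
  by (simp add: identity_rhs_def matching_sum_def sparse_sets_def)

lemma poly_identity_rhs: "poly (identity_rhs n x j) \<rho> = matching_sum n (\<lambda>i. x i + \<rho>) j"
  by (simp add: identity_rhs_eq poly_matching_sum)

text \<open>The characteristic polynomial of a tridiagonal matrix with zero diagonal whose opposite
  off-diagonal entries have the products \<open>b i\<close> (a continuant). For \<open>b\<close>
  constantly 1 it is the Chebyshev polynomial of the second kind, taken at x / 2.\<close>

fun tri_poly :: "nat \<Rightarrow> (nat \<Rightarrow> 'a::comm_ring_1) \<Rightarrow> 'a poly" where
  "tri_poly 0 b = 1"
| "tri_poly (Suc 0) b = [:0, 1:]"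
| "tri_poly (Suc (Suc n)) b = pCons 0 (tri_poly (Suc n) b) - smult (b (Suc n)) (tri_poly n b)"

lemma poly_tri_poly_Suc_Suc:
  "poly (tri_poly (Suc (Suc n)) b) x =
     x * poly (tri_poly (Suc n) b) x - b (Suc n) * poly (tri_poly n b) x"
  by simp

text \<open>The same polynomial in \<mu> = x^2, after removal of the factor x that odd
  \<open>n\<close> forces.\<close>

definition matching_poly :: "nat \<Rightarrow> (nat \<Rightarrow> 'a::comm_ring_1) \<Rightarrow> 'a \<Rightarrow> 'a" where
  "matching_poly n b \<mu> = (\<Sum>j\<le>n div 2. (- 1) ^ j * matching_sum n b j * \<mu> ^ (n div 2 - j))"

text \<open>Summing up to \<open>n\<close> instead of \<open>n div 2\<close> gives both terms of the
  recursion the same shape; the additional terms are zero.\<close>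

lemma poly_tri_poly_sum:
  "poly (tri_poly n b) x = (\<Sum>j\<le>n. (- 1) ^ j * matching_sum n b j * x ^ (n - 2 * j))"
proof (induction n b rule: tri_poly.induct)
  case (1 b)
  then show ?case by simp
next
  case (2 b)
  then show ?case by (simp add: matching_sum_eq_0)
next
  case (3 n b)
  \<comment> \<open>Where truncation keeps the exponents from differing by one, the matching sum is
    0.\<close>
  have a: "(- 1) ^ Suc j * matching_sum (Suc n) b (Suc j) * x ^ (Suc (Suc n) - 2 * Suc j) =
      x * ((- 1) ^ Suc j * matching_sum (Suc n) b (Suc j) * x ^ (Suc n - 2 * Suc j))" for j
  proof (cases "Suc n < 2 * Suc j")
    case True
    then show ?thesis by (simp only: matching_sum_eq_0) simp
  next
    case False
    then have "Suc (Suc n) - 2 * Suc j = Suc (Suc n - 2 * Suc j)" by simp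
    then show ?thesis by (simp only: power_Suc) (simp add: algebra_simps)
  qed
  have "(\<Sum>j\<le>Suc (Suc n). (- 1) ^ j * matching_sum (Suc (Suc n)) b j * x ^ (Suc (Suc n) - 2 * j)) =
    x ^ Suc (Suc n) + (\<Sum>j\<le>Suc n. (- 1) ^ Suc j * matching_sum (Suc n) b (Suc j) * x ^ (Suc (Suc n) - 2 * Suc j)
       + (- 1) ^ Suc j * (b (Suc n) * matching_sum n b j) * x ^ (n - 2 * j))"
    using matching_sum_Suc_Suc[of n b]
    by (subst sum.atMost_Suc_shift) (simp add: algebra_simps)
  also have "\<dots> = x ^ Suc (Suc n) + (\<Sum>j\<le>Suc n. x * ((- 1) ^ Suc j * matching_sum (Suc n) b (Suc j) * x ^ (Suc n - 2 * Suc j)))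
       + (\<Sum>j\<le>Suc n. (- 1) ^ Suc j * (b (Suc n) * matching_sum n b j) * x ^ (n - 2 * j))"
    by (simp only: a sum.distrib add.assoc)
  also have "(\<Sum>j\<le>Suc n. x * ((- 1) ^ Suc j * matching_sum (Suc n) b (Suc j) * x ^ (Suc n - 2 * Suc j)))
      = x * (\<Sum>j\<le>n. (- 1) ^ Suc j * matching_sum (Suc n) b (Suc j) * x ^ (Suc n - 2 * Suc j))"
    by (simp only: sum.atMost_Suc sum_distrib_left) (simp add: matching_sum_eq_0)
  also have "x ^ Suc (Suc n) + \<dots> = x * (\<Sum>j\<le>Suc n. (- 1) ^ j * matching_sum (Suc n) b j * x ^ (Suc n - 2 * j))"
    by (simp only: sum.atMost_Suc_shift distrib_left) simp
  also have "(\<Sum>j\<le>Suc n. (- 1) ^ Suc j * (b (Suc n) * matching_sum n b j) * x ^ (n - 2 * j))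
     = - (b (Suc n) * (\<Sum>j\<le>n. (- 1) ^ j * matching_sum n b j * x ^ (n - 2 * j)))"
    by (simp only: sum.atMost_Suc sum_distrib_left sum_negf[symmetric]) (simp add: matching_sum_eq_0 mult_ac)
  finally show ?case unfolding poly_tri_poly_Suc_Suc 3 by simp
qed

lemma poly_tri_poly: "poly (tri_poly n b) x = x ^ (n mod 2) * matching_poly n b (x\<^sup>2)"
proof -
  have "(\<Sum>j\<le>n. (- 1) ^ j * matching_sum n b j * x ^ (n - 2 * j)) =
        (\<Sum>j\<le>n div 2. (- 1) ^ j * matching_sum n b j * x ^ (n - 2 * j))"
  proof (intro sum.mono_neutral_right ballI)
    fix j assume "j \<in> {..n} - {..n div 2}"
    then have "n < 2 * j" by auto
    then show "(- 1) ^ j * matching_sum n b j * x ^ (n - 2 * j) = 0" by (simp only: matching_sum_eq_0) simp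
  qed auto
  also have "\<dots> = (\<Sum>j\<le>n div 2. x ^ (n mod 2) * ((- 1) ^ j * matching_sum n b j * (x\<^sup>2) ^ (n div 2 - j)))"
  proof (intro sum.cong refl)
    fix j assume "j \<in> {..n div 2}"
    then have "n - 2 * j = n mod 2 + 2 * (n div 2 - j)" by simp presburger
    then have "x ^ (n - 2 * j) = x ^ (n mod 2) * (x\<^sup>2) ^ (n div 2 - j)"
      by (simp add: power_add power_mult)
    then show "(- 1) ^ j * matching_sum n b j * x ^ (n - 2 * j) =
        x ^ (n mod 2) * ((- 1) ^ j * matching_sum n b j * (x\<^sup>2) ^ (n div 2 - j))" by (simp add: algebra_simps)
  qed
  finally show ?thesis by (simp only: poly_tri_poly_sum matching_poly_def sum_distrib_left)
qed

lemma tri_poly_monic: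
  "degree (tri_poly n b) = n \<and> coeff (tri_poly n b) n = (1 :: 'a::idom)"
proof (induction n b rule: tri_poly.induct)
  case (3 n b)
  have ne: "tri_poly (Suc n) b \<noteq> 0" using 3 by auto
  have "degree (smult (b (Suc n)) (tri_poly n b)) \<le> n"
    using 3 degree_smult_le[of "b (Suc n)" "tri_poly n b"] by simp
  moreover have "degree (pCons 0 (tri_poly (Suc n) b)) = Suc (Suc n)"
    using ne 3 by simp
  ultimately have "degree (tri_poly (Suc (Suc n)) b) = Suc (Suc n)"
    by (simp only: tri_poly.simps diff_conv_add_uminus) (subst degree_add_eq_left, auto)
  moreover have "coeff (smult (b (Suc n)) (tri_poly n b)) (Suc (Suc n)) = 0"
    using 3 by (simp add: coeff_eq_0)
  ultimately show ?case using 3 by simp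
qed auto

section \<open>Symmetry, reality and simplicity of the roots of the continuant\<close>

lemma poly_tri_poly_minus: "poly (tri_poly n b) (- x) = (- 1) ^ n * poly (tri_poly n b) x"
  by (induction n b rule: tri_poly.induct) (auto simp: algebra_simps)

lemma poly_tri_poly_of_real:
  "poly (tri_poly n (\<lambda>i. of_real (b i))) (of_real x) =
     (of_real (poly (tri_poly n b) x) :: 'a::{real_algebra_1,comm_ring_1})"
  by (induction n b rule: tri_poly.induct) auto

lemma poly_pderiv_tri_poly_of_real:
  "poly (pderiv (tri_poly n (\<lambda>i. of_real (b i)))) (of_real x) =
     (of_real (poly (pderiv (tri_poly n b)) x) :: 'a::real_field)"
  by (induction n b rule: tri_poly.induct)
    (auto simp: pderiv_pCons pderiv_diff pderiv_smult poly_tri_poly_of_real)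

text \<open>A Christoffel-Darboux argument: the Wronskians satisfy W_(n+1) = p_(n+1)^2 + b_(n+1)
  W_n. At a root of p_(n+1) positivity says that its derivative and p_n have the same sign, which
  yields both the simplicity of the roots and the interlacing used later.\<close>

lemma tri_poly_wronskian_pos:
  fixes b :: "nat \<Rightarrow> real"
  assumes "\<And>i. i \<in> {1..<Suc n} \<Longrightarrow> 0 < b i"
  shows "0 < poly (pderiv (tri_poly (Suc n) b)) x * poly (tri_poly n b) x -
             poly (tri_poly (Suc n) b) x * poly (pderiv (tri_poly n b)) x"
  using assms
proof (induction n)
  case 0
  then show ?case by (simp add: pderiv_pCons)
next
  case (Suc n)
  let ?p = "poly (tri_poly (Suc n) b) x" and ?q = "poly (tri_poly n b) x"
  let ?p' = "poly (pderiv (tri_poly (Suc n) b)) x" and ?q' = "poly (pderiv (tri_poly n b)) x"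
  have "0 < ?p' * ?q - ?p * ?q'" using Suc by simp
  moreover have "0 < b (Suc n)" using Suc.prems by simp
  ultimately have "0 < ?p\<^sup>2 + b (Suc n) * (?p' * ?q - ?p * ?q')"
    by (intro add_nonneg_pos mult_pos_pos) auto
  then show ?case
    by (simp add: pderiv_pCons pderiv_diff pderiv_smult algebra_simps power2_eq_square)
qed

lemma poly_tri_poly_ratio_Im_pos:
  fixes b :: "nat \<Rightarrow> real"
  assumes "0 < Im z" "\<And>i. i \<in> {1..<Suc n} \<Longrightarrow> 0 \<le> b i"
  defines "p \<equiv> \<lambda>k. poly (tri_poly k (\<lambda>i. complex_of_real (b i))) z"
  shows "p n \<noteq> 0 \<and> p (Suc n) \<noteq> 0 \<and> 0 < Im (p (Suc n) / p n)"
  using assms(2)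
proof (induction n)
  case 0
  then show ?case using assms(1) by (auto simp: p_def)
next
  case (Suc n)
  define f where "f = p (Suc n) / p n"
  have IH: "p n \<noteq> 0" "p (Suc n) \<noteq> 0" "0 < Im f" using Suc by (auto simp: f_def)
  have "p (Suc (Suc n)) = z * p (Suc n) - b (Suc n) * p n" by (simp add: p_def)
  then have eq: "p (Suc (Suc n)) / p (Suc n) = z - b (Suc n) / f"
    using IH by (simp add: f_def field_simps)
  have "Im (of_real (b (Suc n)) / f) = - (b (Suc n) * Im f) / ((Re f)\<^sup>2 + (Im f)\<^sup>2)"
    by (simp add: Im_divide)
  also have "\<dots> \<le> 0" using IH Suc.prems[of "Suc n"] by (intro divide_nonpos_nonneg) auto
  finally have "0 < Im (p (Suc (Suc n)) / p (Suc n))" using assms(1) unfolding eq by simp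
  then show ?case using IH by auto
qed

text \<open>The ratios exclude roots in the upper half-plane; the lower one is reached through the
  parity of the polynomial.\<close>

lemma tri_poly_root_real:
  fixes b :: "nat \<Rightarrow> real"
  assumes b: "\<And>i. i \<in> {1..<n} \<Longrightarrow> 0 \<le> b i"
    and z: "poly (tri_poly n (\<lambda>i. complex_of_real (b i))) z = 0"
  shows "z \<in> \<real>"
proof (rule ccontr)
  assume "z \<notin> \<real>"
  then have im: "Im z \<noteq> 0" by (simp add: complex_is_Real_iff)
  obtain k where k: "n = Suc k" using z by (cases n) auto
  have 1: "False" if "0 < Im w" "poly (tri_poly n (\<lambda>i. complex_of_real (b i))) w = 0" for w
    using poly_tri_poly_ratio_Im_pos[of w k b] that b k by auto
  have "poly (tri_poly n (\<lambda>i. complex_of_real (b i))) (- z) = 0"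
    using z by (simp add: poly_tri_poly_minus)
  then show False using 1[of z] 1[of "- z"] z im by (cases "Im z > 0") auto
qed

lemma tri_poly_simple_root:
  fixes b :: "nat \<Rightarrow> real"
  assumes "\<And>i. i \<in> {1..<n} \<Longrightarrow> 0 < b i" and "poly (tri_poly n b) x = 0"
  shows "poly (pderiv (tri_poly n b)) x \<noteq> 0"
proof (cases n)
  case 0
  then show ?thesis using assms by simp
next
  case (Suc k)
  then show ?thesis using tri_poly_wronskian_pos[of k b x] assms by auto
qed

text \<open>Real and simple roots make the complex polynomial squarefree, so it has as many distinct
  roots as its degree; these are then carried back to the reals.\<close>

lemma card_tri_poly_roots:
  fixes b :: "nat \<Rightarrow> real"
  assumes b: "\<And>i. i \<in> {1..<n} \<Longrightarrow> 0 < b i"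
  shows "card {x. poly (tri_poly n b) x = 0} = n"
proof -
  let ?c = "\<lambda>i. complex_of_real (b i)"
  let ?p = "tri_poly n ?c"
  let ?Z = "{z. poly ?p z = 0}"
  have real: "z \<in> \<real>" if "poly ?p z = 0" for z
    using tri_poly_root_real[of n b] that b by (simp add: less_imp_le)
  have Z: "?Z = complex_of_real ` {x. poly (tri_poly n b) x = 0}"
  proof (intro equalityI subsetI)
    fix z assume "z \<in> ?Z"
    then obtain x where "z = of_real x" "poly ?p (of_real x) = 0" using real by (auto elim!: Reals_cases)
    then show "z \<in> complex_of_real ` {x. poly (tri_poly n b) x = 0}"
      by (simp add: poly_tri_poly_of_real)
  qed (auto simp: poly_tri_poly_of_real)
  have "rsquarefree ?p"
    unfolding rsquarefree_roots
  proof (intro allI notI)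
    fix z assume z: "poly ?p z = 0 \<and> poly (pderiv ?p) z = 0"
    then obtain x where "z = of_real x" using real by (auto elim!: Reals_cases)
    then show False using z tri_poly_simple_root[of n b x] b
      by (simp add: poly_tri_poly_of_real poly_pderiv_tri_poly_of_real)
  qed
  then have "smult (lead_coeff ?p) (\<Prod>z\<in>?Z. [:-z, 1:]) = ?p"
    by (rule complex_poly_decompose_rsquarefree)
  then have "degree (smult (lead_coeff ?p) (\<Prod>z\<in>?Z. [:-z, 1:])) = n"
    using tri_poly_monic[of n ?c] by simp
  moreover have "lead_coeff ?p = 1" using tri_poly_monic[of n ?c] by simp
  ultimately have "card ?Z = n" by (simp add: degree_prod_sum_eq)
  then show ?thesis unfolding Z by (simp add: card_image inj_on_def)
qed

section \<open>Monic polynomials with a full set of distinct roots\<close>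

lemma matching_poly_as_poly:
  "\<exists>p :: 'a::idom poly. degree p \<le> n div 2 \<and> coeff p (n div 2) = 1 \<and> (\<forall>\<mu>. poly p \<mu> = matching_poly n b \<mu>)"
proof -
  define p where "p = (\<Sum>j\<le>n div 2. monom ((- 1) ^ j * matching_sum n b j) (n div 2 - j))"
  have "degree p \<le> n div 2"
    unfolding p_def by (intro degree_sum_le) (auto intro: order_trans[OF degree_monom_le])
  moreover have "coeff p (n div 2) = (\<Sum>j\<le>n div 2. if j = 0 then 1 else 0)"
    unfolding p_def coeff_sum by (intro sum.cong) (auto simp: coeff_monom)
  then have "coeff p (n div 2) = 1" by simp
  moreover have "poly p \<mu> = matching_poly n b \<mu>" for \<mu>
    by (simp add: p_def poly_sum poly_monom matching_poly_def)
  ultimately show ?thesis by blast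
qed

lemma monic_poly_eq_prod_roots:
  fixes p :: "'a::idom poly"
  assumes "degree p \<le> card R" "coeff p (card R) = 1" "finite R" "\<And>x. x \<in> R \<Longrightarrow> poly p x = 0"
  shows "p = (\<Prod>x\<in>R. [:-x, 1:])"
proof (rule ccontr)
  let ?q = "\<Prod>x\<in>R. [:-x, 1:]"
  assume ne: "p \<noteq> ?q"
  have dq: "degree ?q = card R" by (simp add: degree_prod_sum_eq)
  have "lead_coeff ?q = 1" by (simp add: lead_coeff_prod)
  then have "coeff (p - ?q) (card R) = 0" using assms(2) dq by simp
  moreover have "degree (p - ?q) \<le> card R" using assms(1) dq by (intro degree_diff_le) auto
  ultimately have lt: "degree (p - ?q) < card R"
    using ne by (metis eq_zero_or_degree_less right_minus_eq)
  have "R \<subseteq> {x. poly (p - ?q) x = 0}"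
    using assms(3,4) by (auto simp: poly_prod)
  then have "card R \<le> card {x. poly (p - ?q) x = 0}"
    using ne by (intro card_mono poly_roots_finite) auto
  also have "\<dots> \<le> degree (p - ?q)" using ne by (intro card_poly_roots_bound) auto
  finally show False using lt by simp
qed

text \<open>Monic of degree \<open>n div 2\<close> with that many distinct zeros. This gives the
  Chebyshev factorization and, at each angle, the factorization through the branches of
  roots.\<close>

lemma matching_poly_eq_prod:
  fixes b :: "nat \<Rightarrow> 'a::idom" and g :: "'i \<Rightarrow> 'a"
  assumes "finite K" "card K = n div 2" "inj_on g K" "\<And>k. k \<in> K \<Longrightarrow> matching_poly n b (g k) = 0"
  shows "matching_poly n b \<mu> = (\<Prod>k\<in>K. \<mu> - g k)"
proof -
  obtain p where p: "degree p \<le> n div 2" "coeff p (n div 2) = 1" "\<And>\<mu>. poly p \<mu> = matching_poly n b \<mu>"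
    using matching_poly_as_poly[of n b] by blast
  have "card (g ` K) = n div 2" using assms by (simp add: card_image)
  then have "p = (\<Prod>x\<in>g ` K. [:-x, 1:])"
    using p assms by (intro monic_poly_eq_prod_roots) auto
  also have "\<dots> = (\<Prod>k\<in>K. [:- g k, 1:])" using assms by (simp add: prod.reindex)
  finally show ?thesis by (simp add: p(3)[symmetric] poly_prod)
qed

section \<open>Chebyshev polynomials of the second kind and the nodes \<open>X_node\<close>\<close>

lemma tri_poly_1_cos:
  "poly (tri_poly n (\<lambda>_. 1)) (2 * cos \<theta>) * sin \<theta> = sin (real (n + 1) * \<theta>)"
proof (induction n "\<lambda>_::nat. 1::real" rule: tri_poly.induct)
  case 2
  then show ?case using sin_double[of \<theta>] by (simp add: algebra_simps)
next
  case (3 n)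
  have "sin (real (n + 3) * \<theta>) + sin (real (n + 1) * \<theta>) = 2 * cos \<theta> * sin (real (n + 2) * \<theta>)"
  proof -
    have "real (n + 3) * \<theta> = real (n + 2) * \<theta> + \<theta>" "real (n + 1) * \<theta> = real (n + 2) * \<theta> - \<theta>"
      by (simp_all add: algebra_simps)
    then show ?thesis by (simp only: sin_add sin_diff) simp
  qed
  moreover have "poly (tri_poly (Suc (Suc n)) (\<lambda>_. 1)) (2 * cos \<theta>) * sin \<theta> =
     2 * cos \<theta> * (poly (tri_poly (Suc n) (\<lambda>_. 1)) (2 * cos \<theta>) * sin \<theta>) -
       poly (tri_poly n (\<lambda>_. 1)) (2 * cos \<theta>) * sin \<theta>"
    by (simp only: poly_tri_poly_Suc_Suc) (simp add: algebra_simps)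
  ultimately show ?case using 3 by (simp add: algebra_simps)
qed auto

text \<open>Below pi / 2 the cosine is positive and injective, so that even the squares of the nodes
  are distinct.\<close>

lemma X_node_angle:
  assumes "k \<in> {1..n div 2}"
  shows "0 < real k * pi / real (n + 1)" "real k * pi / real (n + 1) < pi / 2"
proof -
  show "0 < real k * pi / real (n + 1)" using assms by auto
  have "2 * real k < real (n + 1)" using assms by auto
  then have "2 * real k * pi < real (n + 1) * pi" by simp
  then show "real k * pi / real (n + 1) < pi / 2" by (simp add: divide_simps)
qed

lemma X_node_pos: "k \<in> {1..n div 2} \<Longrightarrow> 0 < X_node n k"
  unfolding X_node_def by (intro mult_pos_pos cos_gt_zero X_node_angle) simp_all

lemma inj_on_X_node: "inj_on (X_node n) {1..n div 2}"
proof (rule inj_onI)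
  fix k l assume k: "k \<in> {1..n div 2}" and l: "l \<in> {1..n div 2}" and eq: "X_node n k = X_node n l"
  define s where "s = real k * pi / real (n + 1)"
  define t where "t = real l * pi / real (n + 1)"
  have cos: "cos s = cos t" using eq by (simp only: X_node_def s_def t_def)
  have "0 < s" "s < pi / 2" "0 < t" "t < pi / 2"
    unfolding s_def t_def using X_node_angle[OF k] X_node_angle[OF l] by blast+
  then have "s = t" using pi_gt_zero by (intro cos_inj_pi[OF _ _ _ _ cos]) linarith+
  then have "real k * pi = real l * pi" unfolding s_def t_def by (subst (asm) divide_cancel_right) auto
  then show "k = l" by (subst (asm) mult_cancel_right) auto
qed

lemma inj_on_X_node_sq: "inj_on (\<lambda>k. (X_node n k)\<^sup>2) {1..n div 2}"
proof (rule inj_onI)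
  fix k l assume kl: "k \<in> {1..n div 2}" "l \<in> {1..n div 2}" "(X_node n k)\<^sup>2 = (X_node n l)\<^sup>2"
  then have "X_node n k = X_node n l" using X_node_pos[of k n] X_node_pos[of l n] by simp
  then show "k = l" using inj_on_X_node[of n] kl by (auto dest: inj_onD)
qed

lemma tri_poly_X_node:
  assumes "k \<in> {1..n div 2}"
  shows "poly (tri_poly n (\<lambda>_. 1)) (X_node n k) = 0"
proof -
  let ?t = "real k * pi / real (n + 1)"
  have "sin ?t \<noteq> 0" using X_node_angle[OF assms] sin_gt_zero2[of ?t] by fastforce
  moreover have "sin (real (n + 1) * ?t) = 0" by (simp add: sin_npi)
  ultimately show ?thesis using tri_poly_1_cos[of n ?t] by (simp add: X_node_def)
qed

lemma matching_poly_1: "matching_poly n (\<lambda>_. 1) \<mu> = (\<Prod>k\<in>{1..n div 2}. \<mu> - (X_node n k)\<^sup>2)"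
proof (rule matching_poly_eq_prod)
  fix k assume k: "k \<in> {1..n div 2}"
  then show "matching_poly n (\<lambda>_. 1) ((X_node n k)\<^sup>2) = 0"
    using tri_poly_X_node[OF k] X_node_pos[OF k] by (simp add: poly_tri_poly)
qed (use inj_on_X_node_sq in auto)

section \<open>The linear equations\<close>


definition esym :: "'i set \<Rightarrow> ('i \<Rightarrow> 'a::comm_ring_1) \<Rightarrow> nat \<Rightarrow> 'a" where
  "esym K a j = (\<Sum>S | S \<subseteq> K \<and> card S = j. \<Prod>i\<in>S. a i)"

lemma prod_diff_eq_sum_esym:
  assumes "finite K"
  shows "(\<Prod>k\<in>K. \<mu> - a k) = (\<Sum>j\<le>card K. (- 1) ^ j * esym K a j * \<mu> ^ (card K - j))"
proof -
  have "(\<Prod>k\<in>K. \<mu> - a k) = (\<Prod>k\<in>K. - a k + \<mu>)" by simp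
  also have "\<dots> = (\<Sum>X\<in>Pow K. (\<Prod>k\<in>X. - a k) * (\<Prod>k\<in>K - X. \<mu>))"
    by (rule prod_add[OF assms])
  also have "\<dots> = (\<Sum>X\<in>Pow K. (- 1) ^ card X * (\<Prod>k\<in>X. a k) * \<mu> ^ (card K - card X))"
    using assms by (intro sum.cong refl) (auto simp: prod_uminus card_Diff_subset finite_subset)
  also have "\<dots> = (\<Sum>j\<le>card K. \<Sum>X\<in>{X \<in> Pow K. card X = j}.
      (- 1) ^ card X * (\<Prod>k\<in>X. a k) * \<mu> ^ (card K - card X))"
    using assms by (intro sum.group[symmetric]) (auto intro: card_mono)
  also have "\<dots> = (\<Sum>j\<le>card K. (- 1) ^ j * esym K a j * \<mu> ^ (card K - j))"
    by (simp add: esym_def sum_distrib_left sum_distrib_right)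
  finally show ?thesis .
qed

lemma alternating_sum_unique:
  fixes u v :: "nat \<Rightarrow> 'a::{idom,ring_char_0}"
  assumes "\<And>\<mu>. (\<Sum>j\<le>m. (- 1) ^ j * u j * \<mu> ^ (m - j)) = (\<Sum>j\<le>m. (- 1) ^ j * v j * \<mu> ^ (m - j))"
    and "j \<le> m"
  shows "u j = v j"
proof -
  define p where "p = (\<lambda>u :: nat \<Rightarrow> 'a. \<Sum>j\<le>m. monom ((- 1) ^ j * u j) (m - j))"
  have "poly (p u) = poly (p v)"
    using assms(1) by (auto simp: p_def poly_sum poly_monom)
  then have "coeff (p u) (m - j) = coeff (p v) (m - j)" by (simp add: poly_eq_poly_eq_iff)
  moreover have "coeff (p w) (m - j) = (- 1) ^ j * w j" for w
  proof -
    have "coeff (p w) (m - j) = (\<Sum>i\<le>m. if i = j then (- 1) ^ i * w i else 0)"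
      unfolding p_def coeff_sum using assms(2) by (intro sum.cong) (auto simp: coeff_monom)
    then show ?thesis using assms(2) by simp
  qed
  ultimately show ?thesis by simp
qed

text \<open>Comparison of coefficients in \<mu> by Vieta. The index set is left general because it
  will be both \<open>{1..n div 2}\<close> and the set of positive roots at \<theta> = 0.\<close>

lemma matching_poly_eq_prod_iff:
  fixes b :: "nat \<Rightarrow> 'a::{idom,ring_char_0}"
  assumes "finite K" "card K = n div 2"
  shows "(\<forall>\<mu>. matching_poly n b \<mu> = (\<Prod>k\<in>K. \<mu> - a k)) \<longleftrightarrow>
         (\<forall>j\<le>n div 2. matching_sum n b j = esym K a j)"
proof
  assume *: "\<forall>\<mu>. matching_poly n b \<mu> = (\<Prod>k\<in>K. \<mu> - a k)"
  show "\<forall>j\<le>n div 2. matching_sum n b j = esym K a j"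
  proof (intro allI impI)
    fix j assume "j \<le> n div 2"
    moreover have "(\<Sum>j\<le>n div 2. (- 1) ^ j * matching_sum n b j * \<mu> ^ (n div 2 - j)) =
        (\<Sum>j\<le>n div 2. (- 1) ^ j * esym K a j * \<mu> ^ (n div 2 - j))" for \<mu>
      using trans[OF *[rule_format, unfolded matching_poly_def] prod_diff_eq_sum_esym[OF assms(1)]]
      unfolding assms(2) .
    ultimately show "matching_sum n b j = esym K a j" 
      by (intro alternating_sum_unique[where m = "n div 2" and u = "matching_sum n b" and v = "esym K a"])
  qed
qed (simp add: matching_poly_def prod_diff_eq_sum_esym[OF assms(1)] assms(2))

lemma matching_sum_1_eq_esym:
  assumes "j \<le> n div 2"
  shows "matching_sum n (\<lambda>_. 1) j = esym {1..n div 2} (\<lambda>k. (X_node n k)\<^sup>2) j"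
  using matching_poly_eq_prod_iff[of "{1..n div 2}" n "\<lambda>_. 1::real" "\<lambda>k. (X_node n k)\<^sup>2"]
    matching_poly_1[of n] assms by simp

section \<open>Coefficients in \<rho> of products of linear factors\<close>

lemma prod_monom: "(\<Prod>i\<in>S. monom (b i) (k i)) = monom (\<Prod>i\<in>S. b i) (\<Sum>i\<in>S. k i)"
  by (induction S rule: infinite_finite_induct) (auto simp: mult_monom monom_0)

text \<open>\<open>T\<close> collects the factors that contribute their constant term. The condition
  is written as a sum because \<open>card T = card S - d\<close> would wrongly admit the empty set
  for d > card S.\<close>

lemma coeff_prod_linear:
  assumes "finite S"
  shows "coeff (\<Prod>i\<in>S. [:a i, b i:]) d =
    (\<Sum>T | T \<subseteq> S \<and> card T + d = card S. (\<Prod>i\<in>T. a i) * (\<Prod>i\<in>S - T. b i))"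
proof -
  have "(\<Prod>i\<in>S. [:a i, b i:]) = (\<Prod>i\<in>S. monom (a i) 0 + monom (b i) 1)"
    by (simp add: monom_0 monom_Suc)
  also have "\<dots> = (\<Sum>T\<in>Pow S. monom ((\<Prod>i\<in>T. a i) * (\<Prod>i\<in>S - T. b i)) (card (S - T)))"
    by (simp add: prod_add[OF assms] prod_monom mult_monom)
  finally have "coeff (\<Prod>i\<in>S. [:a i, b i:]) d =
      (\<Sum>T\<in>Pow S. if card (S - T) = d then (\<Prod>i\<in>T. a i) * (\<Prod>i\<in>S - T. b i) else 0)"
    by (simp add: coeff_sum coeff_monom)
  also have "\<dots> = (\<Sum>T\<in>{T \<in> Pow S. card (S - T) = d}. (\<Prod>i\<in>T. a i) * (\<Prod>i\<in>S - T. b i))"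
    using assms by (intro sum.inter_filter[symmetric]) auto
  also have "{T \<in> Pow S. card (S - T) = d} = {T. T \<subseteq> S \<and> card T + d = card S}"
  proof (rule Set.set_eqI)
    fix T
    have "card (S - T) = d \<longleftrightarrow> card T + d = card S" if "T \<subseteq> S"
      using that assms card_mono[OF assms that] by (subst card_Diff_subset) (auto intro: finite_subset)
    then show "T \<in> {T \<in> Pow S. card (S - T) = d} \<longleftrightarrow> T \<in> {T. T \<subseteq> S \<and> card T + d = card S}"
      by auto
  qed
  finally show ?thesis .
qed

lemma coeff_prod_linear_pred:
  assumes "finite S" "S \<noteq> {}"
  shows "coeff (\<Prod>i\<in>S. [:a i, b i:]) (card S - 1) = (\<Sum>k\<in>S. a k * (\<Prod>i\<in>S - {k}. b i))"
proof -
  have "card S \<noteq> 0" using assms by simp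
  then have "card T + (card S - 1) = card S \<longleftrightarrow> card T = 1" for T :: "'a set" by linarith
  then have "{T. T \<subseteq> S \<and> card T + (card S - 1) = card S} = (\<lambda>k. {k}) ` S"
    by (auto simp: card_1_singleton_iff)
  then show ?thesis
    using assms by (simp only: coeff_prod_linear) (simp add: sum.reindex)
qed

lemma identity_lhs_eq: "identity_lhs n C j = esym {1..n div 2} (\<lambda>i. [:C i, (X_node n i)\<^sup>2:]) j"
  by (simp add: identity_lhs_def esym_def)

lemma poly_esym: "poly (esym K a j) x = esym K (\<lambda>i. poly (a i) x) j"
  by (simp add: esym_def poly_sum poly_prod)

lemma coeff_esym_linear:
  assumes "finite K"
  shows "coeff (esym K (\<lambda>i. [:a i, b i:]) j) d =
    (\<Sum>S | S \<subseteq> K \<and> card S = j. \<Sum>T | T \<subseteq> S \<and> card T + d = j. (\<Prod>i\<in>T. a i) * (\<Prod>i\<in>S - T. b i))"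
  unfolding esym_def coeff_sum
  by (intro sum.cong refl) (auto simp: coeff_prod_linear finite_subset[OF _ assms])

text \<open>Exactly one factor \<open>k\<close> contributes its constant term. Exchanging the sums
  over \<open>k\<close> and over the index sets leaves, as the coefficient of \<open>a k\<close>, an
  elementary symmetric function of the remaining \<open>b i\<close>.\<close>

lemma coeff_esym_linear_pred:
  assumes "finite K" "1 \<le> j"
  shows "coeff (esym K (\<lambda>i. [:a i, b i:]) j) (j - 1) = (\<Sum>k\<in>K. a k * esym (K - {k}) b (j - 1))"
proof -
  have "coeff (esym K (\<lambda>i. [:a i, b i:]) j) (j - 1) =
      (\<Sum>S | S \<subseteq> K \<and> card S = j. \<Sum>k\<in>S. a k * (\<Prod>i\<in>S - {k}. b i))"
    unfolding esym_def coeff_sum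
  proof (intro sum.cong refl)
    fix S assume "S \<in> {S. S \<subseteq> K \<and> card S = j}"
    then have S: "finite S" "card S = j" using assms by (auto intro: finite_subset)
    then have "S \<noteq> {}" using assms by auto
    then show "coeff (\<Prod>i\<in>S. [:a i, b i:]) (j - 1) = (\<Sum>k\<in>S. a k * (\<Prod>i\<in>S - {k}. b i))"
      using coeff_prod_linear_pred[OF S(1)] unfolding S(2) by blast
  qed
  also have "\<dots> = (\<Sum>S | S \<subseteq> K \<and> card S = j. \<Sum>k | k \<in> K \<and> k \<in> S. a k * (\<Prod>i\<in>S - {k}. b i))"
    by (intro sum.cong) auto
  also have "\<dots> = (\<Sum>k\<in>K. \<Sum>S | S \<in> {S. S \<subseteq> K \<and> card S = j} \<and> k \<in> S. a k * (\<Prod>i\<in>S - {k}. b i))"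
    using assms by (intro sum.swap_restrict) auto
  also have "\<dots> = (\<Sum>k\<in>K. a k * esym (K - {k}) b (j - 1))"
  proof (intro sum.cong refl)
    fix k assume k: "k \<in> K"
    have "(\<Sum>S | S \<in> {S. S \<subseteq> K \<and> card S = j} \<and> k \<in> S. a k * (\<Prod>i\<in>S - {k}. b i)) =
      (\<Sum>T | T \<subseteq> K - {k} \<and> card T = j - 1. a k * (\<Prod>i\<in>T. b i))"
      using assms k
      by (intro sum.reindex_bij_witness[of _ "insert k" "\<lambda>S. S - {k}"])
        (auto simp: insert_absorb finite_subset card_insert_if dest: finite_subset)
    then show "(\<Sum>S | S \<in> {S. S \<subseteq> K \<and> card S = j} \<and> k \<in> S. a k * (\<Prod>i\<in>S - {k}. b i)) =
        a k * esym (K - {k}) b (j - 1)"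
      by (simp add: esym_def sum_distrib_left)
  qed
  finally show ?thesis .
qed

text \<open>The left-hand side below is a combination of the linear equations; at \<open>\<mu> = y k\<close> the
  right-hand side isolates the unknown \<open>v k\<close>.\<close>

lemma alternating_sum_esym_Diff:
  fixes v y :: "nat \<Rightarrow> 'a::comm_ring_1"
  shows "(\<Sum>j\<in>{1..m}. (- 1) ^ (j - 1) * \<mu> ^ (m - j) * (\<Sum>k\<in>{1..m}. v k * esym ({1..m} - {k}) y (j - 1))) =
    (\<Sum>k\<in>{1..m}. v k * (\<Prod>i\<in>{1..m} - {k}. \<mu> - y i))"
proof -
  have "(\<Sum>j\<in>{1..m}. (- 1) ^ (j - 1) * \<mu> ^ (m - j) * (\<Sum>k\<in>{1..m}. v k * esym ({1..m} - {k}) y (j - 1))) =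
     (\<Sum>k\<in>{1..m}. v k * (\<Sum>j\<in>{1..m}. (- 1) ^ (j - 1) * esym ({1..m} - {k}) y (j - 1) * \<mu> ^ (m - j)))"
    by (simp only: sum_distrib_left) (subst sum.swap, simp add: mult_ac)
  also have "\<dots> = (\<Sum>k\<in>{1..m}. v k * (\<Prod>i\<in>{1..m} - {k}. \<mu> - y i))"
  proof (intro sum.cong refl)
    fix k assume k: "k \<in> {1..m}"
    have "(\<Sum>j\<in>{1..m}. (- 1) ^ (j - 1) * esym ({1..m} - {k}) y (j - 1) * \<mu> ^ (m - j)) =
      (\<Sum>j\<le>m - 1. (- 1) ^ j * esym ({1..m} - {k}) y j * \<mu> ^ (m - 1 - j))"
      using k by (intro sum.reindex_bij_witness[of _ Suc "\<lambda>j. j - 1"]) auto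
    then show "v k * (\<Sum>j\<in>{1..m}. (- 1) ^ (j - 1) * esym ({1..m} - {k}) y (j - 1) * \<mu> ^ (m - j)) =
        v k * (\<Prod>i\<in>{1..m} - {k}. \<mu> - y i)"
      using k by (simp add: prod_diff_eq_sum_esym)
  qed
  finally show ?thesis .
qed

lemma alternating_sum_esym_Diff_at:
  fixes v y :: "nat \<Rightarrow> 'a::comm_ring_1"
  assumes "l \<in> {1..m}"
  shows "(\<Sum>j\<in>{1..m}. (- 1) ^ (j - 1) * y l ^ (m - j) * (\<Sum>k\<in>{1..m}. v k * esym ({1..m} - {k}) y (j - 1))) =
    v l * (\<Prod>i\<in>{1..m} - {l}. y l - y i)"
proof -
  have "v k * (\<Prod>i\<in>{1..m} - {k}. y l - y i) = 0" if "k \<in> {1..m} - {l}" for k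
  proof -
    have "(\<Prod>i\<in>{1..m} - {k}. y l - y i) = 0" using that assms by (intro prod_zero) auto
    then show ?thesis by simp
  qed
  then show ?thesis
    using assms by (subst alternating_sum_esym_Diff, subst sum.remove[of _ l]) auto
qed

section \<open>Invertibility of the linear equations\<close>

lemma coeff_identity_lhs_pred:
  assumes "1 \<le> j"
  shows "coeff (identity_lhs n C j) (j - 1) =
    (\<Sum>k\<in>{1..n div 2}. C k * esym ({1..n div 2} - {k}) (\<lambda>i. (X_node n i)\<^sup>2) (j - 1))"
  unfolding identity_lhs_eq using assms by (intro coeff_esym_linear_pred) auto

lemma prod_X_node_sq_diff_nonzero:
  assumes "k \<in> {1..n div 2}"
  shows "(\<Prod>i\<in>{1..n div 2} - {k}. (X_node n k)\<^sup>2 - (X_node n i)\<^sup>2) \<noteq> 0"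
proof -
  have "(X_node n k)\<^sup>2 \<noteq> (X_node n i)\<^sup>2" if "i \<in> {1..n div 2} - {k}" for i
    using inj_onD[OF inj_on_X_node_sq, of n k i] assms that by blast
  then show ?thesis by (subst prod_zero_iff) (simp, metis right_minus_eq)
qed

text \<open>Weighting equation \<open>j\<close> by (-1)^(j-1) (y l)^(m-j) and adding, as in Lagrange
  interpolation, leaves \<open>v l\<close> times a product of differences of the distinct values
  \<open>y\<close>.\<close>

lemma linear_system_injective:
  fixes n :: nat and v :: "nat \<Rightarrow> real"
  defines "m \<equiv> n div 2" and "y \<equiv> \<lambda>k. (X_node n k)\<^sup>2"
  assumes "\<And>j. j \<in> {1..m} \<Longrightarrow> (\<Sum>k\<in>{1..m}. v k * esym ({1..m} - {k}) y (j - 1)) = 0"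
    and "l \<in> {1..m}"
  shows "v l = 0"
proof -
  have "v l * (\<Prod>i\<in>{1..m} - {l}. y l - y i) = 0"
    using assms(3) by (subst alternating_sum_esym_Diff_at[OF assms(4), symmetric]) simp
  then show ?thesis
    using prod_X_node_sq_diff_nonzero[of l n] assms(4) by (simp add: m_def y_def)
qed

text \<open>A kernel vector would be a nontrivial solution of the homogeneous equations. The entries
  are kept in the conclusion because the inverse of this very matrix will solve the inhomogeneous
  equations; column \<open>k\<close> belongs to the unknown k + 1.\<close>

lemma coefficient_matrix_det_nonzero:
  "\<exists>M. is_coefficient_matrix n M \<and> det M \<noteq> 0 \<and>
     (\<forall>j<n div 2. \<forall>k<n div 2. M $$ (j, k) = esym ({1..n div 2} - {k + 1}) (\<lambda>i. (X_node n i)\<^sup>2) j)"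
proof -
  define m where "m = n div 2"
  define y where "y = (\<lambda>k. (X_node n k)\<^sup>2)"
  define M where "M = mat m m (\<lambda>(j, k). esym ({1..m} - {k + 1}) y j)"
  have "is_coefficient_matrix n M"
    unfolding is_coefficient_matrix_def
  proof (intro conjI allI ballI)
    fix C j assume j: "j \<in> {1..n div 2}"
    then show "coeff (identity_lhs n C j) (j - 1) = (\<Sum>k\<in>{1..n div 2}. M $$ (j - 1, k - 1) * C k)"
      using coeff_identity_lhs_pred[of j n C]
      by (auto simp: M_def m_def y_def mult.commute intro!: sum.cong)
  qed (simp add: M_def m_def)
  moreover have "det M \<noteq> 0"
  proof
    assume "det M = 0"
    moreover have M: "M \<in> carrier_mat m m" by (simp add: M_def)
    ultimately obtain v where v: "v \<in> carrier_vec m" "v \<noteq> 0\<^sub>v m" "M *\<^sub>v v = 0\<^sub>v m"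
      using det_0_iff_vec_prod_zero_field by blast
    have "v $ (l - 1) = 0" if l: "l \<in> {1..m}" for l
    proof (rule linear_system_injective[where v = "\<lambda>k. v $ (k - 1)" and n = n])
      fix j assume "j \<in> {1..n div 2}"
      then have j: "j - 1 < m" by (auto simp: m_def)
      then have "(M *\<^sub>v v) $ (j - 1) = 0" using v by simp
      also have "(M *\<^sub>v v) $ (j - 1) = (\<Sum>k = 0..<m. esym ({1..m} - {k + 1}) y (j - 1) * v $ k)"
        using j v(1) M by (simp add: scalar_prod_def M_def)
      also have "\<dots> = (\<Sum>k\<in>{1..m}. v $ (k - 1) * esym ({1..m} - {k}) y (j - 1))"
        by (intro sum.reindex_bij_witness[of _ "\<lambda>k. k - 1" Suc]) auto
      finally show "(\<Sum>k\<in>{1..n div 2}. v $ (k - 1) * esym ({1..n div 2} - {k}) (\<lambda>k. (X_node n k)\<^sup>2) (j - 1)) = 0"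
        by (simp add: m_def y_def)
    qed (use l m_def in auto)
    from this[of "Suc _"] have "v = 0\<^sub>v m" using v(1) by (intro eq_vecI) auto
    then show False using v(2) by simp
  qed
  ultimately show ?thesis by (intro exI[of _ M]) (auto simp: M_def m_def y_def)
qed

lemma coeff_identity_rhs:
  "coeff (identity_rhs n x j) d =
    (\<Sum>S\<in>sparse_sets n j. \<Sum>T | T \<subseteq> S \<and> card T + d = j. \<Prod>i\<in>T. x i)"
  unfolding identity_rhs_eq matching_sum_def coeff_sum
  by (intro sum.cong refl) (simp add: coeff_prod_linear sparse_setsD)

lemma coeff_identity_rhs_pred:
  assumes "1 \<le> j"
  shows "coeff (identity_rhs n x j) (j - 1) =
    (\<Sum>i\<in>{1..<n}. real (card {S \<in> sparse_sets n j. i \<in> S}) * x i)"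
proof -
  have "coeff (identity_rhs n x j) (j - 1) = (\<Sum>S\<in>sparse_sets n j. \<Sum>i\<in>S. x i)"
    unfolding identity_rhs_eq matching_sum_def coeff_sum
  proof (intro sum.cong refl)
    fix S assume S: "S \<in> sparse_sets n j"
    then have "S \<noteq> {}" using assms sparse_setsD[OF S] by auto
    then show "coeff (\<Prod>i\<in>S. [:x i, 1:]) (j - 1) = (\<Sum>i\<in>S. x i)"
      using coeff_prod_linear_pred[of S x "\<lambda>_. 1"] sparse_setsD[OF S] by simp
  qed
  also have "\<dots> = (\<Sum>S\<in>sparse_sets n j. \<Sum>i | i \<in> {1..<n} \<and> i \<in> S. x i)"
  proof (intro sum.cong refl)
    fix S assume "S \<in> sparse_sets n j"
    then show "S = {i. i \<in> {1..<n} \<and> i \<in> S}" using sparse_setsD(1) by blast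
  qed
  also have "\<dots> = (\<Sum>i\<in>{1..<n}. \<Sum>S | S \<in> sparse_sets n j \<and> i \<in> S. x i)"
    by (intro sum.swap_restrict) auto
  finally show ?thesis by simp
qed

lemma linear_equations_solvable:
  "\<exists>L. \<forall>x C. linear_equations n C x \<longleftrightarrow> (\<forall>k\<in>{1..n div 2}. C k = linear_functions n L x k)"
proof -
  define m where "m = n div 2"
  define y where "y = (\<lambda>k. (X_node n k)\<^sup>2)"
  define N where "N = (\<lambda>j i. real (card {S \<in> sparse_sets n j. i \<in> S}))"
  obtain M where M: "M \<in> carrier_mat m m" "det M \<noteq> 0"
    "\<And>j k. j < m \<Longrightarrow> k < m \<Longrightarrow> M $$ (j, k) = esym ({1..m} - {k + 1}) y j"
    using coefficient_matrix_det_nonzero[of n] by (auto simp: is_coefficient_matrix_def m_def y_def)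
  obtain B where B: "B \<in> carrier_mat m m" "M * B = 1\<^sub>m m"
    using det_non_zero_imp_unit[OF M(1,2)] M(1) by (auto simp: Units_def ring_mat_def)
  \<comment> \<open>\<open>L _ i\<close> solves the equations whose right-hand sides come from the
    i-th unit vector; by linearity these solutions combine for every x. Unknown and equation numbers
    exceed the vector indices by one.\<close>
  define L where "L = (\<lambda>k i. (B *\<^sub>v vec m (\<lambda>j. N (j + 1) i)) $ (k - 1))"
  have L: "(\<Sum>k\<in>{1..m}. L k i * esym ({1..m} - {k}) y (j - 1)) = N j i" if j: "j \<in> {1..m}" for i j
  proof -
    let ?r = "vec m (\<lambda>j. N (j + 1) i)"
    have j': "j - 1 < m" "Suc (j - 1) = j" using j by auto
    have "(\<Sum>k\<in>{1..m}. L k i * esym ({1..m} - {k}) y (j - 1)) =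
        (\<Sum>k = 0..<m. esym ({1..m} - {k + 1}) y (j - 1) * (B *\<^sub>v ?r) $ k)"
      unfolding L_def by (intro sum.reindex_bij_witness[of _ Suc "\<lambda>k. k - 1"]) auto
    also have "\<dots> = (M *\<^sub>v (B *\<^sub>v ?r)) $ (j - 1)"
      using j' M(1) B(1) by (simp add: scalar_prod_def M(3))
    also have "M *\<^sub>v (B *\<^sub>v ?r) = (M * B) *\<^sub>v ?r"
      using M(1) B(1) by (intro assoc_mult_mat_vec[symmetric]) auto
    also have "\<dots> = ?r" using B(2) by simp
    finally show ?thesis using j' j by simp
  qed
  have sol: "(\<Sum>k\<in>{1..m}. linear_functions n L x k * esym ({1..m} - {k}) y (j - 1)) =
      (\<Sum>i\<in>{1..<n}. N j i * x i)" if j: "j \<in> {1..m}" for x j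
  proof -
    have "(\<Sum>k\<in>{1..m}. linear_functions n L x k * esym ({1..m} - {k}) y (j - 1)) =
      (\<Sum>i\<in>{1..<n}. (\<Sum>k\<in>{1..m}. L k i * esym ({1..m} - {k}) y (j - 1)) * x i)"
      unfolding linear_functions_def sum_distrib_right
      by (subst sum.swap) (simp add: mult_ac)
    then show ?thesis using L[OF j] by simp
  qed
  have eq: "linear_equations n C x \<longleftrightarrow>
      (\<forall>j\<in>{1..m}. (\<Sum>k\<in>{1..m}. C k * esym ({1..m} - {k}) y (j - 1)) = (\<Sum>i\<in>{1..<n}. N j i * x i))" for C x
    unfolding linear_equations_def m_def y_def N_def
    by (intro ball_cong refl) (simp only: coeff_identity_lhs_pred coeff_identity_rhs_pred atLeastAtMost_iff)
  show ?thesis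
  proof (intro exI[of _ L] allI iffI)
    fix x C assume "linear_equations n C x"
    then have 1: "(\<Sum>k\<in>{1..m}. (C k - linear_functions n L x k) * esym ({1..m} - {k}) y (j - 1)) = 0"
      if "j \<in> {1..m}" for j
      using that sol[OF that] by (simp only: eq left_diff_distrib sum_subtractf)
    show "\<forall>k\<in>{1..n div 2}. C k = linear_functions n L x k"
    proof
      fix l assume "l \<in> {1..n div 2}"
      then show "C l = linear_functions n L x l"
        using linear_system_injective[of n "\<lambda>k. C k - linear_functions n L x k" l] 1
        by (simp add: m_def y_def)
    qed
  next
    fix x C assume C: "\<forall>k\<in>{1..n div 2}. C k = linear_functions n L x k"
    have "(\<Sum>k\<in>{1..m}. C k * esym ({1..m} - {k}) y (j - 1)) =
        (\<Sum>k\<in>{1..m}. linear_functions n L x k * esym ({1..m} - {k}) y (j - 1))" for j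
      using C by (intro sum.cong) (auto simp: m_def)
    then show "linear_equations n C x" using sol by (simp only: eq) blast
  qed
qed

section \<open>The equations of the system do not vanish identically\<close>

lemma card_sparse_sets_last:
  assumes "1 \<le> j"
  shows "real (card {S \<in> sparse_sets (n + 2) j. n + 1 \<in> S}) = matching_sum n (\<lambda>_. 1) (j - 1)"
proof -
  obtain i where i: "j = Suc i" using assms by (cases j) auto
  have "real (card {S \<in> sparse_sets (n + 2) j. n + 1 \<in> S}) =
      (\<Sum>S\<in>sparse_sets (n + 2) (Suc i). if n + 1 \<in> S then 1 else 0)"
    unfolding i by (subst sum.inter_filter[symmetric]) auto
  also have "\<dots> = (\<Sum>S\<in>sparse_sets (n + 1) (Suc i). if n + 1 \<in> S then 1 else 0) + real (card (sparse_sets n i))"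
    by (simp only: sum_sparse_sets_Suc_Suc) simp
  \<comment> \<open>Without the last edge nothing is counted, so that only the matchings through it
    remain; these correspond to matchings on n vertices with one edge fewer.\<close>
  also have "(\<Sum>S\<in>sparse_sets (n + 1) (Suc i). if n + 1 \<in> S then 1 else 0) = (0::real)"
    by (intro sum.neutral) (auto simp: sparse_sets_def)
  finally show ?thesis by (simp add: matching_sum_def i)
qed

text \<open>At a positive root X of p_(n+2) the Wronskian shows that the derivative and p_(n+1) have
  the same sign, and the recursion gives X p_(n+1)(X) = p_n(X). Up to the positive factor 2 X X^(n
  mod 2) the derivative is the product over the other nodes.\<close>

lemma matching_poly_interlacing:
  assumes k: "k \<in> {1..(n + 2) div 2}"
  shows "0 < (\<Prod>i\<in>{1..(n + 2) div 2} - {k}. (X_node (n + 2) k)\<^sup>2 - (X_node (n + 2) i)\<^sup>2) *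
    matching_poly n (\<lambda>_. 1) ((X_node (n + 2) k)\<^sup>2)"
proof -
  define X where "X = X_node (n + 2) k"
  define y where "y = (\<lambda>i. (X_node (n + 2) i)\<^sup>2)"
  define K where "K = {1..(n + 2) div 2}"
  define P where "P = (\<Prod>i\<in>K - {k}. X\<^sup>2 - y i)"
  let ?one = "\<lambda>_::nat. 1::real"
  let ?p = "tri_poly (n + 2) ?one"
  have X: "0 < X" using X_node_pos[OF k] by (simp add: X_def)
  have k': "k \<in> K" using k by (simp add: K_def)
  \<comment> \<open>The cofactor of the two roots X and -X, so that the derivative at X is 2 X
    R(X).\<close>
  define R where "R = monom 1 (n mod 2) * (\<Prod>i\<in>K - {k}. [:- y i, 0, 1:])"
  have "poly ?p = poly ([:- y k, 0, 1:] * R)"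
  proof
    fix z
    have "poly ?p z = z ^ (n mod 2) * (\<Prod>i\<in>K. z\<^sup>2 - y i)"
      using matching_poly_1[of "n + 2"] poly_tri_poly[of "n + 2" ?one z] by (simp add: K_def y_def)
    also have "(\<Prod>i\<in>K. z\<^sup>2 - y i) = (z\<^sup>2 - y k) * (\<Prod>i\<in>K - {k}. z\<^sup>2 - y i)"
      using k' by (intro prod.remove) (auto simp: K_def)
    finally show "poly ?p z = poly ([:- y k, 0, 1:] * R) z"
      by (simp add: R_def poly_monom poly_prod power2_eq_square algebra_simps)
  qed
  then have p: "?p = [:- y k, 0, 1:] * R" by (simp only: poly_eq_poly_eq_iff)
  have yk: "y k = X\<^sup>2" by (simp add: y_def X_def)
  have R: "poly R X = X ^ (n mod 2) * P"
    by (simp add: R_def P_def poly_monom poly_prod power2_eq_square algebra_simps)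
  have p': "poly (pderiv ?p) X = 2 * X * poly R X"
    unfolding p by (simp only: pderiv_mult poly_add poly_mult) (simp add: pderiv_pCons yk power2_eq_square)
  have root: "poly ?p X = 0" unfolding p by (simp add: yk power2_eq_square)
  have "0 < poly (pderiv ?p) X * poly (tri_poly (n + 1) ?one) X"
    using tri_poly_wronskian_pos[of "n + 1" ?one X] root by simp
  moreover have "X * poly (tri_poly (n + 1) ?one) X = X ^ (n mod 2) * matching_poly n ?one (X\<^sup>2)"
    using root poly_tri_poly_Suc_Suc[of n ?one X] poly_tri_poly[of n ?one X] by simp
  moreover have "poly (pderiv ?p) X * poly (tri_poly (n + 1) ?one) X =
      2 * poly R X * (X * poly (tri_poly (n + 1) ?one) X)"
    unfolding p' by (simp only: mult_ac)
  ultimately have "0 < (2 * poly R X) * (X ^ (n mod 2) * matching_poly n ?one (X\<^sup>2))"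
    by metis
  then have "0 < 2 * (X ^ (n mod 2))\<^sup>2 * (P * matching_poly n ?one (X\<^sup>2))"
    unfolding R by (simp add: mult_ac power2_eq_square)
  moreover have "0 < 2 * (X ^ (n mod 2))\<^sup>2" using X by simp
  ultimately have "0 < P * matching_poly n ?one (X\<^sup>2)" by (rule zero_less_mult_pos)
  then show ?thesis by (simp only: P_def X_def y_def K_def)
qed

text \<open>For the unit vector at the last edge the right-hand sides are the matching sums on n
  vertices. The combination that isolates \<open>C k\<close> therefore says that
  \<open>C k * P\<close> is \<open>matching_poly n\<close> at \<open>y k\<close>, which has the sign
  of \<open>P\<close> by interlacing.\<close>

lemma linear_equations_last_unit_pos:
  assumes "linear_equations (n + 2) C (\<lambda>i. if i = n + 1 then 1 else 0)" and k: "k \<in> {1..(n + 2) div 2}"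
  shows "0 < C k"
proof -
  define m where "m = (n + 2) div 2"
  define y where "y = (\<lambda>k. (X_node (n + 2) k)\<^sup>2)"
  define P where "P = (\<Prod>i\<in>{1..m} - {k}. y k - y i)"
  have m: "m - 1 = n div 2" by (simp add: m_def)
  have 1: "(\<Sum>l\<in>{1..m}. C l * esym ({1..m} - {l}) y (j - 1)) = matching_sum n (\<lambda>_. 1) (j - 1)"
    if "j \<in> {1..m}" for j
  proof -
    have "(\<Sum>l\<in>{1..m}. C l * esym ({1..m} - {l}) y (j - 1)) =
      (\<Sum>i\<in>{1..<n + 2}. real (card {S \<in> sparse_sets (n + 2) j. i \<in> S}) * (if i = n + 1 then 1 else 0))"
    proof -
      have j: "1 \<le> j" "j \<in> {1..(n + 2) div 2}" using that by (auto simp: m_def)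
      show ?thesis
        unfolding m_def y_def coeff_identity_lhs_pred[OF j(1), symmetric] coeff_identity_rhs_pred[OF j(1), symmetric]
        using assms(1) j(2) unfolding linear_equations_def by blast
    qed
    also have "\<dots> = real (card {S \<in> sparse_sets (n + 2) j. n + 1 \<in> S})"
      by (subst sum.remove[of _ "n + 1"]) (auto intro!: sum.neutral)
    also have "\<dots> = matching_sum n (\<lambda>_. 1) (j - 1)"
      using that by (intro card_sparse_sets_last) auto
    finally show ?thesis .
  qed
  have "C k * P = (\<Sum>j\<in>{1..m}. (- 1) ^ (j - 1) * y k ^ (m - j) * matching_sum n (\<lambda>_. 1) (j - 1))"
  proof -
    have "k \<in> {1..m}" using k by (simp only: m_def)
    then have "C k * P = (\<Sum>j\<in>{1..m}. (- 1) ^ (j - 1) * y k ^ (m - j) *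
        (\<Sum>l\<in>{1..m}. C l * esym ({1..m} - {l}) y (j - 1)))"
      unfolding P_def by (rule alternating_sum_esym_Diff_at[symmetric])
    also have "\<dots> = (\<Sum>j\<in>{1..m}. (- 1) ^ (j - 1) * y k ^ (m - j) * matching_sum n (\<lambda>_. 1) (j - 1))"
      by (intro sum.cong refl arg_cong2[where f = "(*)"] 1)
    finally show ?thesis .
  qed
  also have "\<dots> = (\<Sum>j\<le>n div 2. (- 1) ^ j * matching_sum n (\<lambda>_. 1) j * y k ^ (n div 2 - j))"
    by (intro sum.reindex_bij_witness[of _ Suc "\<lambda>j. j - 1"]) (auto simp: m_def)
  finally have "C k * P = matching_poly n (\<lambda>_. 1) (y k)" by (simp add: matching_poly_def)
  moreover have "0 < P * matching_poly n (\<lambda>_. 1) (y k)"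
    using matching_poly_interlacing[OF k] by (simp add: P_def m_def y_def)
  ultimately have "0 < C k * P\<^sup>2" by (metis mult.commute mult.left_commute power2_eq_square)
  then show ?thesis by (simp add: zero_less_mult_iff)
qed

text \<open>Since i + 2 \<le> j, the right-hand coefficient consists of products of at least two
  distinct variables and vanishes at a unit vector, while the left-hand one is a sum of positive
  terms when the unit vector belongs to the last edge.\<close>

lemma system_poly_nonzero:
  assumes L: "\<forall>x C. linear_equations n C x \<longleftrightarrow> (\<forall>k\<in>{1..n div 2}. C k = linear_functions n L x k)"
    and e: "e \<in> system_index n"
  shows "\<exists>x. system_poly n L e x \<noteq> 0"
proof -
  obtain j i where ji: "e = (j, i)" "2 \<le> j" "j \<le> n div 2" "i + 2 \<le> j"
    using e by (auto simp: system_index_def)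
  then obtain n' where n: "n = n' + 2" by (metis add.commute div_less le_add_diff_inverse less_2_cases_iff not_less not_numeral_le_zero order.trans)
  define x :: "nat \<Rightarrow> real" where "x = (\<lambda>i. if i = n' + 1 then 1 else 0)"
  define C where "C = linear_functions n L x"
  have "linear_equations n C x" using L by (simp add: C_def)
  then have C: "0 < C k" if "k \<in> {1..n div 2}" for k
    using linear_equations_last_unit_pos[of n' C k] that by (simp add: n x_def)
  have "(\<Prod>k\<in>T. x k) = 0" if "card T + i = j" for T
  proof -
    have "\<not> card T \<le> card {n' + 1}" using that ji by simp
    then have "\<not> T \<subseteq> {n' + 1}" by (meson card_mono finite.intros)
    moreover have "finite T" using that ji by (intro card_ge_0_finite) simp
    ultimately show ?thesis by (intro prod_zero) (auto simp: x_def)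
  qed
  then have rhs: "coeff (identity_rhs n x j) i = 0"
    unfolding coeff_identity_rhs by (intro sum.neutral) auto
  have "0 < (\<Sum>S | S \<subseteq> {1..n div 2} \<and> card S = j.
      \<Sum>T | T \<subseteq> S \<and> card T + i = j. (\<Prod>i\<in>T. C i) * (\<Prod>i\<in>S - T. (X_node n i)\<^sup>2))"
  proof (intro sum_pos)
    show "{S. S \<subseteq> {1..n div 2} \<and> card S = j} \<noteq> {}" using ji by (auto intro!: exI[of _ "{1..j}"])
    fix S assume S: "S \<in> {S. S \<subseteq> {1..n div 2} \<and> card S = j}"
    then have fin: "finite S" by (auto intro: finite_subset)
    then show "finite {T. T \<subseteq> S \<and> card T + i = j}" by simp
    have "j - i \<le> card S" using S by simp
    then obtain T where "T \<subseteq> S" "card T = j - i" by (rule obtain_subset_with_card_n)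
    then have "T \<in> {T. T \<subseteq> S \<and> card T + i = j}" using ji by simp
    then show "{T. T \<subseteq> S \<and> card T + i = j} \<noteq> {}" by blast
    fix T assume T: "T \<in> {T. T \<subseteq> S \<and> card T + i = j}"
    then show "0 < (\<Prod>i\<in>T. C i) * (\<Prod>i\<in>S - T. (X_node n i)\<^sup>2)"
    proof (intro mult_pos_pos prod_pos)
      fix k assume "k \<in> S - T"
      then have "k \<in> {1..n div 2}" using S by blast
      then show "0 < (X_node n k)\<^sup>2" by (intro zero_less_power X_node_pos)
    qed (use T S C in blast)
  qed simp
  then have "0 < coeff (identity_lhs n C j) i"
    unfolding identity_lhs_eq by (subst coeff_esym_linear) auto
  then show ?thesis using rhs by (intro exI[of _ x]) (simp add: system_poly_def ji(1) C_def)
qed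

section \<open>Homogeneity of the system\<close>


definition exponents :: "nat set \<Rightarrow> nat \<Rightarrow> (nat \<Rightarrow> nat) set" where
  "exponents I d = {\<alpha>. \<alpha> \<in> I \<rightarrow>\<^sub>E UNIV \<and> (\<Sum>i\<in>I. \<alpha> i) = d}"

text \<open>The nonvanishing required by \<open>homogeneous_of_degree\<close> is split off, since
  sums need not preserve it.\<close>

definition hom_poly :: "nat set \<Rightarrow> nat \<Rightarrow> ((nat \<Rightarrow> real) \<Rightarrow> real) \<Rightarrow> bool" where
  "hom_poly I d f \<longleftrightarrow> (\<exists>c. \<forall>x. f x = (\<Sum>\<alpha>\<in>exponents I d. c \<alpha> * (\<Prod>i\<in>I. x i ^ \<alpha> i)))"

lemma homogeneous_of_degree_iff: "homogeneous_of_degree I d f \<longleftrightarrow> hom_poly I d f \<and> (\<exists>x. f x \<noteq> 0)"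
  by (simp add: homogeneous_of_degree_def hom_poly_def exponents_def)

lemma finite_exponents:
  assumes "finite I"
  shows "finite (exponents I d)"
proof (rule finite_subset)
  show "exponents I d \<subseteq> I \<rightarrow>\<^sub>E {..d}"
  proof
    fix \<alpha> assume \<alpha>: "\<alpha> \<in> exponents I d"
    have "\<alpha> i \<le> d" if "i \<in> I" for i
      using member_le_sum[of i I \<alpha>] that assms \<alpha> by (simp add: exponents_def)
    then show "\<alpha> \<in> I \<rightarrow>\<^sub>E {..d}" using \<alpha> by (auto simp: exponents_def PiE_iff)
  qed
  show "finite (I \<rightarrow>\<^sub>E {..d})" using assms by (intro finite_PiE) auto
qed

lemma hom_poly_zero: "hom_poly I d (\<lambda>_. 0)"
  by (auto simp: hom_poly_def intro!: exI[of _ "\<lambda>_. 0"])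

lemma hom_poly_add:
  assumes "hom_poly I d f" "hom_poly I d g"
  shows "hom_poly I d (\<lambda>x. f x + g x)"
proof -
  obtain a b where "\<And>x. f x = (\<Sum>\<alpha>\<in>exponents I d. a \<alpha> * (\<Prod>i\<in>I. x i ^ \<alpha> i))"
    "\<And>x. g x = (\<Sum>\<alpha>\<in>exponents I d. b \<alpha> * (\<Prod>i\<in>I. x i ^ \<alpha> i))"
    using assms unfolding hom_poly_def by blast
  then show ?thesis unfolding hom_poly_def
    by (intro exI[of _ "\<lambda>\<alpha>. a \<alpha> + b \<alpha>"]) (simp add: distrib_right sum.distrib)
qed

lemma hom_poly_cmult:
  assumes "hom_poly I d f"
  shows "hom_poly I d (\<lambda>x. r * f x)"
proof -
  obtain a where "\<And>x. f x = (\<Sum>\<alpha>\<in>exponents I d. a \<alpha> * (\<Prod>i\<in>I. x i ^ \<alpha> i))"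
    using assms unfolding hom_poly_def by blast
  then show ?thesis unfolding hom_poly_def
    by (intro exI[of _ "\<lambda>\<alpha>. r * a \<alpha>"]) (simp add: sum_distrib_left mult.assoc)
qed

lemma hom_poly_diff: "hom_poly I d f \<Longrightarrow> hom_poly I d g \<Longrightarrow> hom_poly I d (\<lambda>x. f x - g x)"
  using hom_poly_add[of I d f "\<lambda>x. - 1 * g x"] hom_poly_cmult[of I d g "- 1"] by simp

lemma hom_poly_sum:
  "(\<And>k. k \<in> K \<Longrightarrow> hom_poly I d (f k)) \<Longrightarrow> hom_poly I d (\<lambda>x. \<Sum>k\<in>K. f k x)"
  by (induction K rule: infinite_finite_induct) (auto intro: hom_poly_zero hom_poly_add)

lemma hom_poly_1:
  assumes "finite I"
  shows "hom_poly I 0 (\<lambda>_. 1)"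
proof -
  have "exponents I 0 = {\<lambda>i. if i \<in> I then 0 else undefined}"
    using assms by (auto simp: exponents_def PiE_iff extensional_def fun_eq_iff)
  then show ?thesis unfolding hom_poly_def by (intro exI[of _ "\<lambda>_. 1"]) simp
qed

text \<open>Raising the exponent at \<open>j\<close> by one is a bijection onto the exponents of
  degree d + 1 that are positive at \<open>j\<close>; all other monomials receive the coefficient
  0.\<close>

lemma hom_poly_mult_var:
  assumes I: "finite I" and j: "j \<in> I" and f: "hom_poly I d f"
  shows "hom_poly I (Suc d) (\<lambda>x. x j * f x)"
proof -
  obtain c where c: "\<And>x. f x = (\<Sum>\<alpha>\<in>exponents I d. c \<alpha> * (\<Prod>i\<in>I. x i ^ \<alpha> i))"
    using f unfolding hom_poly_def by blast
  define up where "up = (\<lambda>\<alpha> :: nat \<Rightarrow> nat. \<alpha>(j := Suc (\<alpha> j)))"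
  define down where "down = (\<lambda>\<alpha> :: nat \<Rightarrow> nat. \<alpha>(j := \<alpha> j - 1))"
  have sum_upd: "(\<Sum>i\<in>I. (\<alpha>(j := k)) i) + \<alpha> j = (\<Sum>i\<in>I. \<alpha> i) + k" for \<alpha> :: "nat \<Rightarrow> nat" and k
    using I j by (simp add: sum.remove[of I j])
  have up: "up \<alpha> \<in> exponents I (Suc d)" if "\<alpha> \<in> exponents I d" for \<alpha>
    using that sum_upd[of \<alpha> "Suc (\<alpha> j)"] j by (auto simp: exponents_def up_def PiE_iff extensional_def)
  have down: "down \<alpha> \<in> exponents I d" if "\<alpha> \<in> exponents I (Suc d)" "\<alpha> j \<noteq> 0" for \<alpha>
    using that sum_upd[of \<alpha> "\<alpha> j - 1"] j by (auto simp: exponents_def down_def PiE_iff extensional_def)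
  have "x j * f x = (\<Sum>\<beta>\<in>exponents I (Suc d). (if \<beta> j = 0 then 0 else c (down \<beta>)) * (\<Prod>i\<in>I. x i ^ \<beta> i))" for x
  proof -
    have m: "x j * (\<Prod>i\<in>I. x i ^ \<alpha> i) = (\<Prod>i\<in>I. x i ^ up \<alpha> i)" for \<alpha>
    proof -
      have "(\<Prod>i\<in>I - {j}. x i ^ up \<alpha> i) = (\<Prod>i\<in>I - {j}. x i ^ \<alpha> i)"
        by (intro prod.cong) (auto simp: up_def)
      then show ?thesis using I j by (simp add: prod.remove[of I j] up_def)
    qed
    have "x j * f x = (\<Sum>\<alpha>\<in>exponents I d. c \<alpha> * (\<Prod>i\<in>I. x i ^ up \<alpha> i))"
      unfolding c sum_distrib_left m[symmetric] by (simp add: mult_ac)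
    also have "\<dots> = (\<Sum>\<beta>\<in>{\<beta> \<in> exponents I (Suc d). \<beta> j \<noteq> 0}. c (down \<beta>) * (\<Prod>i\<in>I. x i ^ \<beta> i))"
      by (intro sum.reindex_bij_witness[of _ down up]) (use up down in \<open>auto simp: up_def down_def\<close>)
    also have "\<dots> = (\<Sum>\<beta>\<in>exponents I (Suc d). (if \<beta> j = 0 then 0 else c (down \<beta>)) * (\<Prod>i\<in>I. x i ^ \<beta> i))"
      using finite_exponents[OF I] by (intro sum.mono_neutral_cong_left) auto
    finally show ?thesis .
  qed
  then show ?thesis unfolding hom_poly_def
    by (intro exI[of _ "\<lambda>\<beta>. if \<beta> j = 0 then 0 else c (down \<beta>)"]) blast
qed

lemma hom_poly_mult_linear:
  assumes "finite I" "hom_poly I d f"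
  shows "hom_poly I (Suc d) (\<lambda>x. (\<Sum>i\<in>I. l i * x i) * f x)"
proof -
  have "hom_poly I (Suc d) (\<lambda>x. \<Sum>i\<in>I. l i * (x i * f x))"
    using assms by (intro hom_poly_sum hom_poly_cmult hom_poly_mult_var)
  then show ?thesis by (simp add: sum_distrib_right mult.assoc)
qed

lemma hom_poly_prod_linear:
  assumes "finite I" "finite T"
  shows "hom_poly I (card T) (\<lambda>x. \<Prod>k\<in>T. \<Sum>i\<in>I. l k i * x i)"
  using assms(2)
proof (induction T rule: finite_induct)
  case empty
  then show ?case using hom_poly_1[OF assms(1)] by simp
next
  case (insert k T)
  then show ?case using hom_poly_mult_linear[OF assms(1) insert.IH] by simp
qed

lemma hom_poly_scale:
  assumes "hom_poly I d f"
  shows "f (\<lambda>i. r * x i) = r ^ d * f x"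
proof -
  obtain c where c: "\<And>x. f x = (\<Sum>\<alpha>\<in>exponents I d. c \<alpha> * (\<Prod>i\<in>I. x i ^ \<alpha> i))"
    using assms unfolding hom_poly_def by blast
  have "(\<Prod>i\<in>I. (r * x i) ^ \<alpha> i) = r ^ d * (\<Prod>i\<in>I. x i ^ \<alpha> i)" if "\<alpha> \<in> exponents I d" for \<alpha>
    using that by (simp add: exponents_def power_mult_distrib prod.distrib flip: power_sum)
  then show ?thesis by (simp add: c sum_distrib_left mult_ac)
qed

text \<open>Doubling a point with f x \<noteq> 0 multiplies the value by both 2^d and 2^e.\<close>

lemma homogeneous_of_degree_unique:
  assumes "homogeneous_of_degree I d f" "homogeneous_of_degree I e f"
  shows "d = e"
proof -
  obtain x where x: "f x \<noteq> 0" using assms by (auto simp: homogeneous_of_degree_iff)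
  have "hom_poly I d f" "hom_poly I e f" using assms by (simp_all add: homogeneous_of_degree_iff)
  from hom_poly_scale[OF this(1), of 2 x] hom_poly_scale[OF this(2), of 2 x]
  have "2 ^ d * f x = 2 ^ e * f x" by (rule trans[OF sym])
  then have "(2::real) ^ d = 2 ^ e" using x by simp
  then show ?thesis by (subst (asm) power_inject_exp) auto
qed

lemma system_poly_hom_poly:
  assumes "i \<le> j"
  shows "hom_poly {1..<n} (j - i) (system_poly n L (j, i))"
proof -
  have T: "hom_poly {1..<n} (j - i) (\<lambda>x. \<Prod>k\<in>T. \<Sum>l\<in>{1..<n}. M k l * x l)"
    if "card T + i = j" "finite T" for T M
  proof -
    have "card T = j - i" using that by simp
    then show ?thesis using hom_poly_prod_linear[of "{1..<n}" T M] that by simp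
  qed
  have "hom_poly {1..<n} (j - i) (\<lambda>x. coeff (identity_lhs n (linear_functions n L x) j) i)"
    unfolding identity_lhs_eq coeff_esym_linear[OF finite_atLeastAtMost] linear_functions_def
    by (intro hom_poly_sum, subst mult.commute, intro hom_poly_cmult T) (auto intro: finite_subset)
  moreover have "hom_poly {1..<n} (j - i) (\<lambda>x. coeff (identity_rhs n x j) i)"
    unfolding coeff_identity_rhs
  proof (intro hom_poly_sum)
    fix S T assume S: "S \<in> sparse_sets n j" and TS: "T \<in> {T. T \<subseteq> S \<and> card T + i = j}"
    have T': "T \<subseteq> {1..<n}" "finite T" using sparse_setsD[OF S] TS by (auto intro: finite_subset)
    \<comment> \<open>Each variable is written as a linear form with Kronecker coefficients, so that
      \<open>T\<close>, the statement on products of linear forms, covers the right-hand side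
      too.\<close>
    have "(\<Prod>k\<in>T. x k) = (\<Prod>k\<in>T. \<Sum>l\<in>{1..<n}. (if l = k then 1 else 0) * x l)" for x :: "nat \<Rightarrow> real"
    proof (intro prod.cong refl)
      fix k assume "k \<in> T"
      then have "k \<in> {1..<n}" using T' by blast
      then have "(\<Sum>l\<in>{1..<n}. if l = k then x l else 0) = x k" by (subst sum.delta) auto
      then show "x k = (\<Sum>l\<in>{1..<n}. (if l = k then 1 else 0) * x l)"
        by (simp only: if_distrib[of "\<lambda>z. z * _"] mult_1 mult_zero_left cong: if_cong)
    qed
    then show "hom_poly {1..<n} (j - i) (\<lambda>x. \<Prod>k\<in>T. x k)"
      using T[of T "\<lambda>k l. if l = k then 1 else 0"] TS T' by simp
  qed
  ultimately show ?thesis unfolding system_poly_def case_prod_conv by (rule hom_poly_diff)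
qed

section \<open>Number and degrees of the equations\<close>

lemma card_system_index: "card (system_index n) = (n div 2) * (n div 2 - 1) div 2"
proof -
  define m where "m = n div 2"
  have "system_index n = (SIGMA j:{2..m}. {..j - 2})"
    by (auto simp: system_index_def m_def)
  then have "card (system_index n) = (\<Sum>j\<in>{2..m}. Suc (j - 2))" by simp
  also have "\<dots> = (\<Sum>j\<in>{2..m}. j - 1)" by (intro sum.cong) auto
  also have "\<dots> = (\<Sum>j<m. j)"
    by (intro sum.reindex_bij_witness_not_neutral[of "{}" "{0}" _ Suc "\<lambda>j. j - 1"]) auto
  also have "\<dots> = m * (m - 1) div 2"
    using Sum_Ico_nat[of 0 m] by (simp add: lessThan_atLeast0)
  finally show ?thesis by (simp add: m_def)
qed

text \<open>With d = n div 2 - k + 1 the pairs are (i + d, i), and i + d \<le> n div 2 means i < k.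
  The bound on k ensures d \<ge> 2, as the index set demands.\<close>

lemma card_system_index_degree:
  assumes k: "k \<in> {1..n div 2 - 1}"
  shows "card {e \<in> system_index n. fst e - snd e = n div 2 - k + 1} = k"
proof -
  have "{e \<in> system_index n. fst e - snd e = n div 2 - k + 1} = (\<lambda>i. (i + (n div 2 - k + 1), i)) ` {..<k}"
    using k by (auto simp: system_index_def image_iff)
  then show ?thesis by (simp add: card_image inj_on_def)
qed

lemma homogeneous_system_poly:
  assumes "\<forall>x C. linear_equations n C x \<longleftrightarrow> (\<forall>k\<in>{1..n div 2}. C k = linear_functions n L x k)"
    and "e \<in> system_index n"
  shows "homogeneous_of_degree {1..<n} d (system_poly n L e) \<longleftrightarrow> d = fst e - snd e"
proof -
  have "snd e \<le> fst e" using assms(2) by (auto simp: system_index_def)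
  then have "homogeneous_of_degree {1..<n} (fst e - snd e) (system_poly n L e)"
    using system_poly_hom_poly[of "snd e" "fst e" n L] system_poly_nonzero[OF assms]
    by (simp add: homogeneous_of_degree_iff)
  then show ?thesis by (auto intro: homogeneous_of_degree_unique)
qed

section \<open>The Kippenhahn polynomial\<close>


text \<open>Expansion along the last row leaves two cofactors; the off-diagonal one is expanded
  again along its last column, where only \<open>f n (Suc n)\<close> survives. One function
  \<open>f\<close> for all sizes makes \<open>D\<close> run through leading principal
  minors.\<close>

lemma det_tridiagonal_Suc_Suc:
  fixes f :: "nat \<Rightarrow> nat \<Rightarrow> 'a::comm_ring_1"
  assumes f: "\<And>i j. i + 1 < j \<or> j + 1 < i \<Longrightarrow> f i j = 0"
  defines "D \<equiv> \<lambda>n. det (mat n n (\<lambda>(i, j). f i j))"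
  shows "D (Suc (Suc n)) = f (Suc n) (Suc n) * D (Suc n) - f n (Suc n) * f (Suc n) n * D n"
proof -
  define A where "A = mat (Suc (Suc n)) (Suc (Suc n)) (\<lambda>(i, j). f i j)"
  define B where "B = mat_delete A (Suc n) n"
  have A: "A \<in> carrier_mat (Suc (Suc n)) (Suc (Suc n))" by (simp add: A_def)
  have Bij: "B $$ (i, j) = f i (if j < n then j else Suc j)" if "i < Suc n" "j < Suc n" for i j
    using that by (simp add: B_def A_def mat_delete_def)
  have B: "B \<in> carrier_mat (Suc n) (Suc n)" by (simp add: B_def A_def mat_delete_def)
  have D1: "mat_delete A (Suc n) (Suc n) = mat (Suc n) (Suc n) (\<lambda>(i, j). f i j)"
    by (intro eq_matI) (auto simp: A_def mat_delete_def)
  have D2: "mat_delete B n n = mat n n (\<lambda>(i, j). f i j)"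
    by (intro eq_matI) (auto simp: mat_delete_def Bij carrier_matD[OF B])
  have "det B = (\<Sum>i<Suc n. B $$ (i, n) * cofactor B i n)"
    by (rule laplace_expansion_column[OF B]) simp
  also have "\<dots> = B $$ (n, n) * cofactor B n n"
    by (simp add: Bij f)
  also have "\<dots> = f n (Suc n) * D n"
    using Bij[of n n] by (simp add: cofactor_def D2 D_def)
  finally have detB: "det B = f n (Suc n) * D n" .
  have "det A = (\<Sum>j<Suc (Suc n). A $$ (Suc n, j) * cofactor A (Suc n) j)"
    by (rule laplace_expansion_row[OF A]) simp
  also have "\<dots> = f (Suc n) n * cofactor A (Suc n) n + f (Suc n) (Suc n) * cofactor A (Suc n) (Suc n)"
    by (simp add: A_def f)
  also have "cofactor A (Suc n) n = - det B"
    by (simp add: cofactor_def B_def)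
  also have "cofactor A (Suc n) (Suc n) = D (Suc n)"
    by (simp add: cofactor_def D1 D_def)
  finally show ?thesis by (simp add: detB D_def A_def algebra_simps)
qed

text \<open>Reciprocity enters here: a * b = 1 turns the mixed terms into 2 cos (2 \<theta>) = 4
  (cos \<theta>)^2 - 2, and |a| |b| = 1 gives |a|^2 + |b|^2 = (|a| - |b|)^2 + 2, so that the
  constants cancel.\<close>

lemma reciprocal_offdiagonal_product:
  assumes "a * b = (1::complex)"
  shows "(cis \<theta> * a + cnj (cis \<theta> * b)) / 2 * ((cis \<theta> * b + cnj (cis \<theta> * a)) / 2) =
    of_real ((cmod a - cmod b)\<^sup>2 / 4 + (cos \<theta>)\<^sup>2)"
proof -
  have ab: "cmod a * cmod b = 1" using assms by (simp flip: norm_mult)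
  have "(cis \<theta> * a + cnj (cis \<theta> * b)) * (cis \<theta> * b + cnj (cis \<theta> * a)) =
      cis \<theta> * cis \<theta> * (a * b) + cnj (cis \<theta> * cis \<theta> * (a * b)) + (cis \<theta> * cnj (cis \<theta>)) * (a * cnj a + b * cnj b)"
    by (simp add: algebra_simps)
  also have "\<dots> = cis (2 * \<theta>) + cnj (cis (2 * \<theta>)) + (a * cnj a + b * cnj b)"
    by (simp add: assms cis_mult cis_cnj)
  also have "\<dots> = of_real (2 * cos (2 * \<theta>) + (cmod a)\<^sup>2 + (cmod b)\<^sup>2)"
    by (simp only: complex_add_cnj complex_norm_square[symmetric]) simp
  also have "2 * cos (2 * \<theta>) + (cmod a)\<^sup>2 + (cmod b)\<^sup>2 = 4 * ((cmod a - cmod b)\<^sup>2 / 4 + (cos \<theta>)\<^sup>2)"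
    using ab by (simp add: cos_double_cos power2_diff)
  finally have "(cis \<theta> * a + cnj (cis \<theta> * b)) * (cis \<theta> * b + cnj (cis \<theta> * a)) =
    of_real (4 * ((cmod a - cmod b)\<^sup>2 / 4 + (cos \<theta>)\<^sup>2))" .
  moreover have "p / 2 * (q / 2) = of_real r" if "p * q = of_real (4 * r)" for p q :: complex and r :: real
    using that by simp
  ultimately show ?thesis by blast
qed

lemma kippenhahn_poly_tri_poly:
  assumes "A \<in> reciprocal_matrices n"
  shows "kippenhahn_poly A l \<theta> =
    (- 1) ^ n * poly (tri_poly n (\<lambda>i. complex_of_real (xi A i + (cos \<theta>)\<^sup>2))) l"
proof -
  have A: "A \<in> carrier_mat n n" and off: "\<And>i j. i < n \<Longrightarrow> j < n \<Longrightarrow> i + 1 < j \<or> j + 1 < i \<Longrightarrow> A $$ (i, j) = 0"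
    and diag: "\<And>i. i < n \<Longrightarrow> A $$ (i, i) = 0"
    and rec: "\<And>i. i + 1 < n \<Longrightarrow> A $$ (i, i + 1) * A $$ (i + 1, i) = 1"
    using assms by (auto simp: reciprocal_matrices_def)
  \<comment> \<open>The value 0 outside the matrix makes \<open>f\<close> tridiagonal on all
    indices, as the recursion for determinants requires.\<close>
  define f where "f = (\<lambda>i j. if i < n \<and> j < n then
    (cis \<theta> * A $$ (i, j) + cnj (cis \<theta> * A $$ (j, i))) / 2 - (if i = j then l else 0) else 0)"
  define D where "D = (\<lambda>k. det (mat k k (\<lambda>(i, j). f i j)))"
  define b where "b = (\<lambda>i. complex_of_real (xi A i + (cos \<theta>)\<^sup>2))"
  have f0: "f i j = 0" if "i + 1 < j \<or> j + 1 < i" for i j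
    using that off[of i j] off[of j i] by (auto simp: f_def)
  have fd: "f i i = - l" if "i < n" for i
    using that diag[of i] by (simp add: f_def)
  have fprod: "f i (Suc i) * f (Suc i) i = b (Suc i)" if "Suc i < n" for i
    using that reciprocal_offdiagonal_product[OF rec[of i]] by (simp add: f_def b_def xi_def)
  have adj: "mat_adjoint M $$ (i, j) = cnj (M $$ (j, i))" if "M \<in> carrier_mat n n" "i < n" "j < n" for M :: "complex mat" and i j
    using that by (simp add: mat_adjoint_def mat_of_rows_def)
  have "mat_Re (cis \<theta> \<cdot>\<^sub>m A) - l \<cdot>\<^sub>m 1\<^sub>m (dim_row A) = mat n n (\<lambda>(i, j). f i j)"
    using A adj[of "cis \<theta> \<cdot>\<^sub>m A"]
    by (intro eq_matI) (auto simp: mat_Re_def f_def mat_adjoint_def)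
  then have "kippenhahn_poly A l \<theta> = D n" by (simp add: kippenhahn_poly_def D_def)
  also have "D k = (- 1) ^ k * poly (tri_poly k b) l" if "k \<le> n" for k
    using that
  proof (induction k rule: less_induct)
    case (less k)
    consider "k = 0" | "k = 1" | i where "k = Suc (Suc i)" by (metis One_nat_def not0_implies_Suc)
    then show ?case
    proof cases
      case 3
      have "D k = f (Suc i) (Suc i) * D (Suc i) - f i (Suc i) * f (Suc i) i * D i"
        unfolding D_def 3 by (rule det_tridiagonal_Suc_Suc) (rule f0)
      also have "\<dots> = - l * ((- 1) ^ Suc i * poly (tri_poly (Suc i) b) l) - b (Suc i) * ((- 1) ^ i * poly (tri_poly i b) l)"
        using less.IH[of i] less.IH[of "Suc i"] less.prems fd[of "Suc i"] fprod[of i] 3 by simp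
      also have "\<dots> = (- 1) ^ k * poly (tri_poly k b) l"
        by (simp only: 3 poly_tri_poly_Suc_Suc) (simp add: algebra_simps)
      finally show ?thesis .
    qed (use less.prems fd in \<open>auto simp: D_def det_single\<close>)
  qed
  finally show ?thesis by (simp add: b_def)
qed

lemma kippenhahn_poly_real_root:
  assumes "A \<in> reciprocal_matrices n"
  shows "kippenhahn_poly A (of_real x) \<theta> = 0 \<longleftrightarrow> poly (tri_poly n (\<lambda>i. xi A i + (cos \<theta>)\<^sup>2)) x = 0"
  unfolding kippenhahn_poly_tri_poly[OF assms] poly_tri_poly_of_real by simp

section \<open>From the identities to ellipses\<close>


text \<open>The sum of the two focal distances is rationalized by squaring twice. In the backward
  direction the sign of 2 a^2 - N has to be recovered: the quadratic equation and Cauchy-Schwarz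
  force |z| \<le> a, which makes it nonnegative.\<close>

lemma central_ellipse_equation:
  assumes "cmod f < a"
  shows "cmod (z - f) + cmod (z + f) = 2 * a \<longleftrightarrow>
    a\<^sup>2 * (cmod z)\<^sup>2 - (Re (z * cnj f))\<^sup>2 = a\<^sup>2 * (a\<^sup>2 - (cmod f)\<^sup>2)"
proof -
  define p where "p = cmod (z - f)"
  define q where "q = cmod (z + f)"
  define N where "N = (cmod z)\<^sup>2 + (cmod f)\<^sup>2"
  define M where "M = Re (z * cnj f)"
  have pq: "0 \<le> p" "0 \<le> q" by (simp_all add: p_def q_def)
  have a: "0 < a" using assms by (meson le_less_trans norm_ge_zero)
  have p2: "p\<^sup>2 = N - 2 * M" and q2: "q\<^sup>2 = N + 2 * M"
    unfolding p_def q_def N_def M_def cmod_power2 by (simp_all add: power2_eq_square algebra_simps)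
  have *: "(a\<^sup>2 * (cmod z)\<^sup>2 - M\<^sup>2 = a\<^sup>2 * (a\<^sup>2 - (cmod f)\<^sup>2)) \<longleftrightarrow> (p * q)\<^sup>2 = (2 * a\<^sup>2 - N)\<^sup>2"
  proof -
    have "(p * q)\<^sup>2 = N\<^sup>2 - 4 * M\<^sup>2"
      unfolding power_mult_distrib p2 q2 by (simp add: power2_eq_square algebra_simps)
    moreover have "(2 * a\<^sup>2 - N)\<^sup>2 = N\<^sup>2 - 4 * (a\<^sup>2 * (cmod z)\<^sup>2 - a\<^sup>2 * (a\<^sup>2 - (cmod f)\<^sup>2))"
      unfolding N_def by (simp add: power2_eq_square algebra_simps)
    ultimately show ?thesis by auto
  qed
  have "p + q = 2 * a \<longleftrightarrow> (p * q)\<^sup>2 = (2 * a\<^sup>2 - N)\<^sup>2"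
  proof
    assume "p + q = 2 * a"
    then have "(p + q)\<^sup>2 = 4 * a\<^sup>2" by simp
    then have "p * q = 2 * a\<^sup>2 - N" using p2 q2 by (simp add: power2_sum)
    then show "(p * q)\<^sup>2 = (2 * a\<^sup>2 - N)\<^sup>2" by simp
  next
    assume eq: "(p * q)\<^sup>2 = (2 * a\<^sup>2 - N)\<^sup>2"
    have fa: "(cmod f)\<^sup>2 < a\<^sup>2" using assms a by (intro power_strict_mono) auto
    have "\<bar>M\<bar> \<le> cmod z * cmod f"
      unfolding M_def by (metis abs_Re_le_cmod complex_mod_cnj norm_mult)
    then have "M\<^sup>2 \<le> (cmod z)\<^sup>2 * (cmod f)\<^sup>2"
      by (metis abs_ge_zero power2_abs power_mono power_mult_distrib)
    then have "(a\<^sup>2 - (cmod f)\<^sup>2) * ((cmod z)\<^sup>2 - a\<^sup>2) \<le> 0"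
      using eq * by (simp add: algebra_simps)
    then have "(cmod z)\<^sup>2 \<le> a\<^sup>2" using fa by (simp add: mult_le_0_iff)
    then have "0 \<le> 2 * a\<^sup>2 - N" using fa by (simp add: N_def)
    then have "p * q = 2 * a\<^sup>2 - N" using eq pq by (simp add: power2_eq_iff_nonneg)
    then have "(p + q)\<^sup>2 = (2 * a)\<^sup>2" using p2 q2 by (simp add: power2_sum power_mult_distrib)
    then show "p + q = 2 * a" by (rule power2_eq_imp_eq) (use pq a in linarith)+
  qed
  then show ?thesis using * by (simp add: p_def q_def M_def)
qed

lemma mem_central_ellipse_of_real:
  assumes "0 < C"
  shows "z \<in> central_ellipse (of_real X) (sqrt (C + X\<^sup>2)) \<longleftrightarrow>
    C * (Re z)\<^sup>2 + (C + X\<^sup>2) * (Im z)\<^sup>2 = C * (C + X\<^sup>2)"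
proof -
  have lt: "cmod (of_real X) < sqrt (C + X\<^sup>2)"
    using assms by (simp add: real_less_rsqrt)
  moreover have "(sqrt (C + X\<^sup>2))\<^sup>2 = C + X\<^sup>2" using assms by (simp add: add_nonneg_nonneg)
  ultimately show ?thesis
    using central_ellipse_equation[OF lt, of z]
    by (auto simp: central_ellipse_def cmod_power2 algebra_simps power_mult_distrib)
qed

lemma central_ellipse_degenerate:
  "0 \<le> X \<Longrightarrow> central_ellipse (of_real X) (sqrt (0 + X\<^sup>2)) = {of_real X, - of_real X}"
  by (simp add: central_ellipse_def)

text \<open>For \<open>C = 0\<close> the square root is \<open>X \<bar>cos t\<bar>\<close>, which is not differentiable at the zeros of \<open>cos\<close>.\<close>

definition branch :: "real \<Rightarrow> real \<Rightarrow> real \<Rightarrow> real" where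
  "branch C X t = (if C = 0 then X * cos t else sqrt (C + X\<^sup>2 * (cos t)\<^sup>2))"

definition branch_deriv :: "real \<Rightarrow> real \<Rightarrow> real \<Rightarrow> real" where
  "branch_deriv C X t = (if C = 0 then - X * sin t else - (X\<^sup>2 * cos t * sin t) / branch C X t)"

lemma branch_square:
  assumes "0 \<le> C"
  shows "(branch C X t)\<^sup>2 = C + X\<^sup>2 * (cos t)\<^sup>2"
  using assms by (simp add: branch_def power_mult_distrib)

lemma branch_pos: "0 < C \<Longrightarrow> 0 < branch C X t"
  by (simp add: branch_def add_pos_nonneg)

lemma branch_has_derivative:
  assumes "0 \<le> C"
  shows "(branch C X has_real_derivative branch_deriv C X t) (at t)"
proof (cases "C = 0")
  case True
  then show ?thesis
    unfolding branch_def[abs_def] branch_deriv_def by (auto intro!: derivative_eq_intros)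
next
  case False
  then have "0 < C + X\<^sup>2 * (cos t)\<^sup>2" using assms by (intro add_pos_nonneg) auto
  then have "((\<lambda>t. sqrt (C + X\<^sup>2 * (cos t)\<^sup>2)) has_real_derivative
      - (X\<^sup>2 * cos t * sin t) / sqrt (C + X\<^sup>2 * (cos t)\<^sup>2)) (at t)"
    by (auto intro!: derivative_eq_intros simp: field_simps)
  then show ?thesis using False by (simp add: branch_def[abs_def] branch_deriv_def)
qed

text \<open>The two conditions are linear in z. With h the value of the branch, their solution is h
  Re z = (C + X^2) cos \<theta>, h Im z = - C sin \<theta>, the parametrization of the ellipse by
  the direction of its normal.\<close>

lemma branch_envelope_imp_ellipse:
  assumes C: "0 < C" and re: "Re (cis \<theta> * z) = branch C X \<theta>" and im: "- Im (cis \<theta> * z) = branch_deriv C X \<theta>"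
  shows "z \<in> central_ellipse (of_real X) (sqrt (C + X\<^sup>2))"
proof -
  define h where "h = branch C X \<theta>"
  define c where "c = cos \<theta>"
  define s where "s = sin \<theta>"
  have h: "0 < h" using branch_pos[OF C] by (simp add: h_def)
  have cs: "s\<^sup>2 = 1 - c\<^sup>2" by (simp add: c_def s_def sin_squared_eq)
  have h2: "h\<^sup>2 = C + X\<^sup>2 * c\<^sup>2" using branch_square[of C X \<theta>] C by (simp add: h_def c_def)
  have 1: "c * Re z - s * Im z = h" using re by (simp add: h_def c_def s_def)
  have 2: "s * Re z + c * Im z = X\<^sup>2 * c * s / h"
    using im C by (simp add: branch_deriv_def h_def c_def s_def)
  have "c * (c * Re z - s * Im z) + s * (s * Re z + c * Im z) = (c\<^sup>2 + s\<^sup>2) * Re z"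
    by (simp add: algebra_simps power2_eq_square)
  then have "h * Re z = h * (c * (c * Re z - s * Im z) + s * (s * Re z + c * Im z))"
    by (simp add: cs)
  also have "\<dots> = c * h\<^sup>2 + X\<^sup>2 * c * s\<^sup>2" unfolding 1 2 using h by (simp add: field_simps power2_eq_square)
  also have "\<dots> = (C + X\<^sup>2) * c" unfolding h2 cs by (simp add: algebra_simps power2_eq_square)
  finally have x: "h * Re z = (C + X\<^sup>2) * c" .
  have "c * (s * Re z + c * Im z) - s * (c * Re z - s * Im z) = (c\<^sup>2 + s\<^sup>2) * Im z"
    by (simp add: algebra_simps power2_eq_square)
  then have "h * Im z = h * (c * (s * Re z + c * Im z) - s * (c * Re z - s * Im z))"
    by (simp add: cs)
  also have "\<dots> = X\<^sup>2 * c\<^sup>2 * s - s * h\<^sup>2" unfolding 1 2 using h by (simp add: field_simps power2_eq_square)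
  also have "\<dots> = - (C * s)" unfolding h2 by (simp add: algebra_simps)
  finally have y: "h * Im z = - (C * s)" .
  have "h\<^sup>2 * (C * (Re z)\<^sup>2 + (C + X\<^sup>2) * (Im z)\<^sup>2) = C * (h * Re z)\<^sup>2 + (C + X\<^sup>2) * (h * Im z)\<^sup>2"
    by (simp add: algebra_simps power2_eq_square)
  also have "\<dots> = C * (C + X\<^sup>2) * ((C + X\<^sup>2) * c\<^sup>2 + C * s\<^sup>2)"
    unfolding x y by (simp add: algebra_simps power2_eq_square)
  also have "(C + X\<^sup>2) * c\<^sup>2 + C * s\<^sup>2 = h\<^sup>2" unfolding h2 cs by (simp add: algebra_simps)
  finally have "C * (Re z)\<^sup>2 + (C + X\<^sup>2) * (Im z)\<^sup>2 = C * (C + X\<^sup>2)"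
    using h by (simp add: mult.commute)
  then show ?thesis using mem_central_ellipse_of_real[OF C] by blast
qed

text \<open>The normal direction of the ellipse at \<open>z\<close> gives the angle of the tangent line.\<close>

lemma ellipse_imp_branch_envelope:
  assumes C: "0 < C" and z: "z \<in> central_ellipse (of_real X) (sqrt (C + X\<^sup>2))"
  shows "\<exists>\<theta>\<in>{-pi<..pi}. Re (cis \<theta> * z) = branch C X \<theta> \<and> - Im (cis \<theta> * z) = branch_deriv C X \<theta>"
proof -
  define a where "a = C + X\<^sup>2"
  have a: "0 < a" using C by (simp add: a_def add_pos_nonneg)
  have eq: "C * (Re z)\<^sup>2 + a * (Im z)\<^sup>2 = C * a"
    using z mem_central_ellipse_of_real[OF C] by (simp add: a_def)
  \<comment> \<open>Half the gradient of (Re z)^2 / a + (Im z)^2 / C, conjugated because the line Re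
    (cis \<theta> * z) = p has the normal cis (- \<theta>). Its modulus will be the reciprocal of
    the distance from the origin to the tangent.\<close>
  define u where "u = Complex (Re z / a) (- Im z / C)"
  define m where "m = cmod u"
  define \<theta> where "\<theta> = Arg u"
  have "u \<noteq> 0" using eq C a by (auto simp: u_def complex_eq_iff)
  then have m: "0 < m" by (simp add: m_def)
  have "u = of_real m * cis \<theta>" using rcis_cmod_Arg[of u] by (simp add: rcis_def m_def \<theta>_def)
  then have c: "Re z = a * m * cos \<theta>" and s: "Im z = - (C * m * sin \<theta>)"
    using a C by (auto simp: u_def complex_eq_iff field_simps)
  have "C * a * (m\<^sup>2 * (a * (cos \<theta>)\<^sup>2 + C * (sin \<theta>)\<^sup>2)) = C * a"
    using eq unfolding c s by (simp add: algebra_simps power2_eq_square)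
  then have "m\<^sup>2 * (a * (cos \<theta>)\<^sup>2 + C * (sin \<theta>)\<^sup>2) = 1" using a C by simp
  moreover have h2: "a * (cos \<theta>)\<^sup>2 + C * (sin \<theta>)\<^sup>2 = C + X\<^sup>2 * (cos \<theta>)\<^sup>2"
    unfolding a_def sin_squared_eq by (simp add: algebra_simps)
  ultimately have "(m * branch C X \<theta>)\<^sup>2 = 1\<^sup>2"
    using branch_square[of C X \<theta>] C by (simp add: power_mult_distrib)
  then have mh: "m * branch C X \<theta> = 1"
    using m branch_pos[OF C, of X \<theta>] by (subst (asm) power2_eq_iff_nonneg) auto
  then have h: "branch C X \<theta> = 1 / m" using m by (simp add: field_simps)
  have "Re (cis \<theta> * z) = m * (a * (cos \<theta>)\<^sup>2 + C * (sin \<theta>)\<^sup>2)"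
    using c s by (simp add: algebra_simps power2_eq_square)
  also have "\<dots> = m * (branch C X \<theta>)\<^sup>2" unfolding h2 using branch_square[of C X \<theta>] C by simp
  also have "\<dots> = branch C X \<theta>" using mh by (simp add: power2_eq_square flip: mult.assoc)
  finally have re: "Re (cis \<theta> * z) = branch C X \<theta>" .
  have "- Im (cis \<theta> * z) = - (m * (a - C) * cos \<theta> * sin \<theta>)"
    using c s by (simp add: algebra_simps)
  also have "\<dots> = branch_deriv C X \<theta>"
    using C m by (simp add: branch_deriv_def h a_def)
  finally have "- Im (cis \<theta> * z) = branch_deriv C X \<theta>" .
  moreover have "\<theta> \<in> {-pi<..pi}" using Arg_bounded[of u] by (simp add: \<theta>_def)
  ultimately show ?thesis using re by blast
qed

lemma minus_mem_central_ellipse: "- z \<in> central_ellipse f a \<longleftrightarrow> z \<in> central_ellipse f a"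
proof -
  have "cmod (- z - f) = cmod (z + f)" "cmod (- z + f) = cmod (z - f)"
    using norm_minus_cancel[of "z + f"] norm_minus_commute[of f z] by simp_all
  then show ?thesis by (auto simp: central_ellipse_def minus_equation_iff[of z f] add.commute)
qed

text \<open>For C > 0 either sign traces the whole ellipse, by central symmetry. For C = 0 all lines
  of one sign pass through one focus, so the two signs together give the pair of foci.\<close>

lemma mem_central_ellipse_iff_envelope:
  assumes "0 \<le> C" "0 \<le> X"
  shows "z \<in> central_ellipse (of_real X) (sqrt (C + X\<^sup>2)) \<longleftrightarrow>
    (\<exists>\<theta>\<in>{-pi<..pi}. \<exists>\<sigma>\<in>{1, - 1}. Re (cis \<theta> * z) = \<sigma> * branch C X \<theta> \<and> - Im (cis \<theta> * z) = \<sigma> * branch_deriv C X \<theta>)"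
  (is "?L \<longleftrightarrow> ?R")
proof (cases "C = 0")
  case True
  have "z = of_real (\<sigma> * X)" if "Re (cis \<theta> * z) = \<sigma> * branch C X \<theta>" "- Im (cis \<theta> * z) = \<sigma> * branch_deriv C X \<theta>" for \<theta> \<sigma>
  proof -
    have "cis \<theta> * z = cis \<theta> * of_real (\<sigma> * X)"
      using that True by (simp add: complex_eq_iff branch_def branch_deriv_def algebra_simps)
    then show ?thesis by simp
  qed
  moreover have "Re (cis 0 * of_real (\<sigma> * X)) = \<sigma> * branch C X 0 \<and> - Im (cis 0 * of_real (\<sigma> * X)) = \<sigma> * branch_deriv C X 0" for \<sigma>
    using True by (simp add: branch_def branch_deriv_def)
  moreover have "0 \<in> {-pi<..pi}" by simp
  moreover have "?L \<longleftrightarrow> z = of_real (1 * X) \<or> z = of_real (- 1 * X)"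
    using central_ellipse_degenerate[OF assms(2)] True by simp
  ultimately show ?thesis by blast
next
  case False
  then have C: "0 < C" using assms by simp
  show ?thesis
  proof
    assume ?L
    then show ?R using ellipse_imp_branch_envelope[OF C] by fastforce
  next
    assume ?R
    then obtain \<theta> \<sigma> where \<sigma>: "\<sigma> = 1 \<or> \<sigma> = - 1" and
      z: "Re (cis \<theta> * z) = \<sigma> * branch C X \<theta>" "- Im (cis \<theta> * z) = \<sigma> * branch_deriv C X \<theta>" by blast
    from \<sigma> show ?L
    proof
      assume "\<sigma> = 1"
      then show ?thesis using z by (intro branch_envelope_imp_ellipse[OF C]) (simp_all only: mult_1)
    next
      assume "\<sigma> = - 1"
      then have "Re (cis \<theta> * - z) = branch C X \<theta>" "- Im (cis \<theta> * - z) = branch_deriv C X \<theta>"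
        using z by (simp_all only: mult_minus_right uminus_complex.sel mult_minus1)
      then have "- z \<in> central_ellipse (of_real X) (sqrt (C + X\<^sup>2))"
        by (rule branch_envelope_imp_ellipse[OF C])
      then show ?thesis by (simp add: minus_mem_central_ellipse)
    qed
  qed
qed

section \<open>The curve in terms of finitely many smooth branches\<close>

lemma vertical_line_rotated_iff: "z \<in> vertical_line_rotated \<theta> p \<longleftrightarrow> Re (cis \<theta> * z) = p"
proof
  assume "z \<in> vertical_line_rotated \<theta> p"
  then obtain t where "z = cis (- \<theta>) * (of_real p + \<i> * of_real t)"
    by (auto simp: vertical_line_rotated_def)
  then have "cis \<theta> * z = of_real p + \<i> * of_real t" by (simp add: cis_mult flip: mult.assoc)
  then show "Re (cis \<theta> * z) = p" by simp
next
  assume "Re (cis \<theta> * z) = p"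
  then have "cis \<theta> * z = of_real p + \<i> * of_real (Im (cis \<theta> * z))" by (simp add: complex_eq_iff)
  then have "cis (- \<theta>) * (cis \<theta> * z) = cis (- \<theta>) * (of_real p + \<i> * of_real (Im (cis \<theta> * z)))" by simp
  moreover have "cis (- \<theta>) * (cis \<theta> * z) = z" by (simp add: cis_mult flip: mult.assoc)
  ultimately have "z = cis (- \<theta>) * (of_real p + \<i> * of_real (Im (cis \<theta> * z)))" by metis
  then show "z \<in> vertical_line_rotated \<theta> p" unfolding vertical_line_rotated_def by blast
qed

lemma Re_cis_mult_has_derivative:
  "((\<lambda>t. Re (cis t * z)) has_real_derivative - Im (cis \<theta> * z)) (at \<theta>)"
  by (auto intro!: derivative_eq_intros)

lemma Re_cis_mult_minus_has_derivative_iff: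
  "((\<lambda>t. Re (cis t * z) - r t) has_real_derivative 0) (at \<theta>) \<longleftrightarrow>
    (r has_real_derivative - Im (cis \<theta> * z)) (at \<theta>)"
proof
  assume "((\<lambda>t. Re (cis t * z) - r t) has_real_derivative 0) (at \<theta>)"
  from DERIV_diff[OF Re_cis_mult_has_derivative[of z \<theta>] this]
  show "(r has_real_derivative - Im (cis \<theta> * z)) (at \<theta>)" by simp
next
  assume "(r has_real_derivative - Im (cis \<theta> * z)) (at \<theta>)"
  from DERIV_diff[OF Re_cis_mult_has_derivative[of z \<theta>] this]
  show "((\<lambda>t. Re (cis t * z) - r t) has_real_derivative 0) (at \<theta>)" by simp
qed

text \<open>Which member of \<open>H\<close> agrees with \<open>r\<close> may change from point to
  point, but by finiteness one of them does so at points accumulating at \<theta>. Limits of the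
  difference and of its difference quotient, which exist, can be taken along these points and are
  0.\<close>

lemma differentiable_selection:
  fixes r :: "real \<Rightarrow> real"
  assumes "finite H" and H: "\<And>h. h \<in> H \<Longrightarrow> (fst h has_real_derivative snd h \<theta>) (at \<theta>)"
    and r: "(r has_real_derivative D) (at \<theta>)" and ev: "\<forall>\<^sub>F t in nhds \<theta>. \<exists>h\<in>H. r t = fst h t"
  shows "\<exists>h\<in>H. r \<theta> = fst h \<theta> \<and> D = snd h \<theta>"
proof -
  have "\<forall>\<^sub>F t in at \<theta>. \<exists>h\<in>H. r t = fst h t"
    using ev by (auto simp: eventually_at_filter elim: eventually_mono)
  then have "\<exists>\<^sub>F t in at \<theta>. \<exists>h\<in>H. r t = fst h t" by (intro eventually_frequently) auto
  then obtain h where h: "h \<in> H" "\<exists>\<^sub>F t in at \<theta>. r t = fst h t"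
    by (auto dest!: frequently_bex_finite[OF assms(1)])
  have d: "((\<lambda>t. r t - fst h t) has_real_derivative D - snd h \<theta>) (at \<theta>)"
    by (intro DERIV_diff r H h)
  have freq_lim: "l = 0" if "(g \<longlongrightarrow> l) (at \<theta>)" "\<exists>\<^sub>F t in at \<theta>. g t = 0" for g :: "real \<Rightarrow> real" and l
  proof (rule ccontr)
    assume "l \<noteq> 0"
    then have "\<forall>\<^sub>F t in at \<theta>. g t \<noteq> 0" using that(1) by (rule tendsto_imp_eventually_ne[rotated])
    then show False using that(2) by (simp add: frequently_def)
  qed
  have "((\<lambda>t. r t - fst h t) \<longlongrightarrow> r \<theta> - fst h \<theta>) (at \<theta>)"
    using DERIV_isCont[OF d] by (simp add: isCont_def)
  then have 0: "r \<theta> - fst h \<theta> = 0"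
    by (rule freq_lim) (use h(2) in \<open>auto elim: frequently_elim1\<close>)
  have "((\<lambda>t. (r t - fst h t - (r \<theta> - fst h \<theta>)) / (t - \<theta>)) \<longlongrightarrow> D - snd h \<theta>) (at \<theta>)"
    using d by (simp add: has_field_derivative_iff)
  then have "D - snd h \<theta> = 0"
    by (rule freq_lim) (use h(2) 0 in \<open>auto elim: frequently_elim1\<close>)
  then show ?thesis using 0 h(1) by (intro bexI[of _ h]) auto
qed

text \<open>The curve is defined through arbitrary differentiable selections of roots; if smooth
  functions exhaust the roots, a selection contributes no point that those functions miss.\<close>

lemma kippenhahn_curve_branches:
  assumes "finite H" and H: "\<And>h \<theta>. h \<in> H \<Longrightarrow> (fst h has_real_derivative snd h \<theta>) (at \<theta>)"
    and roots: "\<And>x t. kippenhahn_poly A (of_real x) t = 0 \<longleftrightarrow> (\<exists>h\<in>H. x = fst h t)"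
  shows "kippenhahn_curve A =
    {z. \<exists>\<theta>\<in>{-pi<..pi}. \<exists>h\<in>H. Re (cis \<theta> * z) = fst h \<theta> \<and> - Im (cis \<theta> * z) = snd h \<theta>}"
proof (intro equalityI subsetI)
  fix z assume "z \<in> kippenhahn_curve A"
  then obtain \<theta> r where \<theta>: "\<theta> \<in> {-pi<..pi}"
    and ev: "\<forall>\<^sub>F t in nhds \<theta>. r differentiable (at t) \<and> (\<exists>h\<in>H. r t = fst h t)"
    and r: "Re (cis \<theta> * z) = r \<theta>" "(r has_real_derivative - Im (cis \<theta> * z)) (at \<theta>)"
    unfolding kippenhahn_curve_def roots vertical_line_rotated_iff Re_cis_mult_minus_has_derivative_iff
    by blast
  have ev': "\<forall>\<^sub>F t in nhds \<theta>. \<exists>h\<in>H. r t = fst h t" using ev by (rule eventually_mono) blast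
  from differentiable_selection[OF assms(1) H r(2) ev'] obtain h where
    "h \<in> H" "r \<theta> = fst h \<theta>" "- Im (cis \<theta> * z) = snd h \<theta>" by blast
  then show "z \<in> {z. \<exists>\<theta>\<in>{-pi<..pi}. \<exists>h\<in>H. Re (cis \<theta> * z) = fst h \<theta> \<and> - Im (cis \<theta> * z) = snd h \<theta>}"
    using \<theta> r(1) by fastforce
next
  fix z assume "z \<in> {z. \<exists>\<theta>\<in>{-pi<..pi}. \<exists>h\<in>H. Re (cis \<theta> * z) = fst h \<theta> \<and> - Im (cis \<theta> * z) = snd h \<theta>}"
  then obtain \<theta> h where \<theta>: "\<theta> \<in> {-pi<..pi}" and h: "h \<in> H"
    and z: "Re (cis \<theta> * z) = fst h \<theta>" "- Im (cis \<theta> * z) = snd h \<theta>" by blast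
  have "\<forall>\<^sub>F t in nhds \<theta>. fst h differentiable (at t) \<and> kippenhahn_poly A (of_real (fst h t)) t = 0"
    using H[OF h] h roots by (intro always_eventually allI) (auto simp: real_differentiable_def)
  moreover have "(fst h has_real_derivative - Im (cis \<theta> * z)) (at \<theta>)" using H[OF h, of \<theta>] z(2) by simp
  ultimately show "z \<in> kippenhahn_curve A"
    unfolding kippenhahn_curve_def vertical_line_rotated_iff Re_cis_mult_minus_has_derivative_iff
    using \<theta> z(1) by blast
qed

lemma matching_poly_of_real:
  "matching_poly n (\<lambda>i. of_real (b i)) (of_real \<mu>) = (of_real (matching_poly n b \<mu>) :: complex)"
  by (simp add: matching_poly_def matching_sum_of_real)

text \<open>A negative root \<mu> would give the continuant the non-real root \<i> sqrt (-
  \<mu>).\<close>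

lemma matching_poly_root_nonneg:
  fixes b :: "nat \<Rightarrow> real"
  assumes "\<And>i. i \<in> {1..<n} \<Longrightarrow> 0 \<le> b i" "matching_poly n b \<mu> = 0"
  shows "0 \<le> \<mu>"
proof (rule ccontr)
  assume "\<not> 0 \<le> \<mu>"
  define z where "z = \<i> * complex_of_real (sqrt (- \<mu>))"
  have "z\<^sup>2 = - of_real ((sqrt (- \<mu>))\<^sup>2)" by (simp add: z_def power_mult_distrib)
  also have "\<dots> = of_real \<mu>" using \<open>\<not> 0 \<le> \<mu>\<close> by simp
  finally have "poly (tri_poly n (\<lambda>i. complex_of_real (b i))) z = 0"
    using assms(2) by (simp add: poly_tri_poly matching_poly_of_real)
  then have "z \<in> \<real>" using tri_poly_root_real assms(1) by blast
  then show False using \<open>\<not> 0 \<le> \<mu>\<close> by (simp add: z_def complex_is_Real_iff)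
qed

text \<open>The vertex sqrt (D + Y^2) is the only positive real point of its ellipse, and \<i> sqrt
  D lies on it unless it is degenerate; testing these points determines C and X. This ensures that
  different nodes give different ellipses, so that their number is right.\<close>

lemma central_ellipse_determines_focus:
  assumes "0 \<le> C" "0 < X" "0 \<le> D" "0 < Y"
    and eq: "central_ellipse (of_real X) (sqrt (C + X\<^sup>2)) = central_ellipse (of_real Y) (sqrt (D + Y\<^sup>2))"
  shows "X = Y"
proof -
  have real: "complex_of_real (sqrt (D + Y\<^sup>2)) \<in> central_ellipse (of_real X) (sqrt (C + X\<^sup>2)) \<longleftrightarrow> D + Y\<^sup>2 = C + X\<^sup>2"
    if "0 \<le> C" "0 < X" "0 \<le> D" "0 < Y" for C X D Y :: real
  proof (cases "C = 0")
    case True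
    have "complex_of_real (sqrt (D + Y\<^sup>2)) = - of_real X \<longleftrightarrow> sqrt (D + Y\<^sup>2) = - X"
      by (metis of_real_eq_iff of_real_minus)
    moreover have "sqrt (D + Y\<^sup>2) \<noteq> - X" using that by (smt (verit) real_sqrt_ge_zero zero_le_power2)
    moreover have "sqrt (D + Y\<^sup>2) = X \<longleftrightarrow> D + Y\<^sup>2 = X\<^sup>2"
      using that by (metis add_nonneg_nonneg less_imp_le real_sqrt_pow2 real_sqrt_unique zero_le_power2)
    ultimately show ?thesis using True that central_ellipse_degenerate[of X] by simp
  next
    case False
    then show ?thesis using that by (subst mem_central_ellipse_of_real) auto
  qed
  have imag: "\<i> * complex_of_real (sqrt D) \<in> central_ellipse (of_real X) (sqrt (C + X\<^sup>2)) \<longleftrightarrow> C \<noteq> 0 \<and> D = C"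
    if "0 \<le> C" "0 < X" "0 \<le> D" for C X D :: real
  proof (cases "C = 0")
    case True
    then show ?thesis using that central_ellipse_degenerate[of X] by (auto simp: complex_eq_iff)
  next
    case False
    moreover have "0 < C + X\<^sup>2" using that by (simp add: add_nonneg_pos)
    ultimately show ?thesis using that by (subst mem_central_ellipse_of_real) auto
  qed
  have "D + Y\<^sup>2 = C + X\<^sup>2" using real[of C X D Y] real[of D Y D Y] assms by simp
  moreover have "C = D"
    using imag[of C X C] imag[of D Y C] imag[of C X D] imag[of D Y D] assms by auto
  ultimately have "X\<^sup>2 = Y\<^sup>2" by simp
  then show ?thesis using assms by (simp add: power2_eq_iff_nonneg)
qed

lemma concentric_ellipses_if_factorization:
  assumes A: "A \<in> reciprocal_matrices n"
    and fact: "\<And>\<rho> \<mu>. matching_poly n (\<lambda>i. xi A i + \<rho>) \<mu> =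
      (\<Prod>k\<in>{1..n div 2}. \<mu> - (C k + \<rho> * (X_node n k)\<^sup>2))"
  shows "consists_of_concentric_ellipses A"
proof -
  let ?K = "{1..n div 2}"
  have dim: "dim_row A = n" using A by (auto simp: reciprocal_matrices_def)
  have C: "0 \<le> C k" if "k \<in> ?K" for k
  proof (rule matching_poly_root_nonneg)
    \<comment> \<open>At \<rho> = 0, that is \<theta> = pi / 2, the numbers \<open>C k\<close> are
      themselves the roots.\<close>
    show "matching_poly n (\<lambda>i. xi A i + 0) (C k) = 0"
      unfolding fact using that by (intro prod_zero) auto
  qed (simp add: xi_def)
  have X: "0 < X_node n k" if "k \<in> ?K" for k using that by (rule X_node_pos)
  \<comment> \<open>Branches are paired with their derivatives; for odd \<open>n\<close> the zero
    branch produces the origin.\<close>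
  define H where "H = (\<lambda>(k, \<sigma>). (\<lambda>t. \<sigma> * branch (C k) (X_node n k) t, \<lambda>t. \<sigma> * branch_deriv (C k) (X_node n k) t)) `
      (?K \<times> {1, - 1}) \<union> (if odd n then {(\<lambda>_. 0, \<lambda>_. 0)} else {})"
  have finH: "finite H" by (simp add: H_def)
  have derH: "(fst h has_real_derivative snd h \<theta>) (at \<theta>)" if "h \<in> H" for h \<theta>
    using that C branch_has_derivative by (auto simp: H_def split: if_splits intro!: DERIV_cmult DERIV_minus)
  have rootsH: "kippenhahn_poly A (of_real x) t = 0 \<longleftrightarrow> (\<exists>h\<in>H. x = fst h t)" for x t
  proof -
    have "kippenhahn_poly A (of_real x) t = 0 \<longleftrightarrow>
      odd n \<and> x = 0 \<or> (\<exists>k\<in>?K. x\<^sup>2 = C k + (cos t)\<^sup>2 * (X_node n k)\<^sup>2)"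
      unfolding kippenhahn_poly_real_root[OF A] poly_tri_poly fact
      by (auto simp: odd_iff_mod_2_eq_one)
    also have "\<dots> \<longleftrightarrow> odd n \<and> x = 0 \<or> (\<exists>k\<in>?K. x\<^sup>2 = (branch (C k) (X_node n k) t)\<^sup>2)"
      using C by (simp add: branch_square mult.commute)
    also have "\<dots> \<longleftrightarrow> (\<exists>h\<in>H. x = fst h t)"
      by (auto simp: H_def power2_eq_iff)
    finally show ?thesis .
  qed
  define E where "E = (\<lambda>k. central_ellipse (of_real (X_node n k)) (sqrt (C k + (X_node n k)\<^sup>2)))"
  have "kippenhahn_curve A = \<Union> (E ` ?K) \<union> (if odd n then {0} else {})"
  proof (rule Set.set_eqI)
    fix z
    have "z \<in> kippenhahn_curve A \<longleftrightarrow>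
      (\<exists>k\<in>?K. \<exists>\<theta>\<in>{-pi<..pi}. \<exists>\<sigma>\<in>{1, - 1}. Re (cis \<theta> * z) = \<sigma> * branch (C k) (X_node n k) \<theta> \<and>
         - Im (cis \<theta> * z) = \<sigma> * branch_deriv (C k) (X_node n k) \<theta>) \<or>
      odd n \<and> (\<exists>\<theta>\<in>{-pi<..pi}. Re (cis \<theta> * z) = 0 \<and> - Im (cis \<theta> * z) = 0)"
    proof -
      have "(\<exists>h\<in>H. Q (fst h) (snd h)) \<longleftrightarrow>
          (\<exists>k\<in>?K. \<exists>\<sigma>\<in>{1, - 1}. Q (\<lambda>t. \<sigma> * branch (C k) (X_node n k) t) (\<lambda>t. \<sigma> * branch_deriv (C k) (X_node n k) t))
          \<or> odd n \<and> Q (\<lambda>_. 0) (\<lambda>_. 0)" for Q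
        by (simp add: H_def bex_Un)
      note H_cases = this[of "\<lambda>f g. Re (cis \<theta> * z) = f \<theta> \<and> - Im (cis \<theta> * z) = g \<theta>" for \<theta>]
      show ?thesis
        by (simp only: kippenhahn_curve_branches[OF finH derH rootsH] mem_Collect_eq H_cases) blast
    qed
    also have "(\<exists>\<theta>\<in>{-pi<..pi}. Re (cis \<theta> * z) = 0 \<and> - Im (cis \<theta> * z) = 0) \<longleftrightarrow> z = 0"
    proof
      assume "\<exists>\<theta>\<in>{-pi<..pi}. Re (cis \<theta> * z) = 0 \<and> - Im (cis \<theta> * z) = 0"
      then obtain \<theta> where "Re (cis \<theta> * z) = 0" "- Im (cis \<theta> * z) = 0" by blast
      then have "cis \<theta> * z = 0" by (simp only: complex_eq_iff zero_complex.sel neg_equal_0_iff_equal)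
      then show "z = 0" by simp
    next
      assume "z = 0"
      then have "Re (cis 0 * z) = 0 \<and> - Im (cis 0 * z) = 0" by simp
      moreover have "0 \<in> {-pi<..pi}" by simp
      ultimately show "\<exists>\<theta>\<in>{-pi<..pi}. Re (cis \<theta> * z) = 0 \<and> - Im (cis \<theta> * z) = 0" by blast
    qed
    finally show "z \<in> kippenhahn_curve A \<longleftrightarrow> z \<in> \<Union> (E ` ?K) \<union> (if odd n then {0} else {})"
      using mem_central_ellipse_iff_envelope[OF C less_imp_le[OF X]] by (auto simp: E_def)
  qed
  moreover have "inj_on E ?K"
  proof (rule inj_onI)
    fix k l assume kl: "k \<in> ?K" "l \<in> ?K" "E k = E l"
    then have "X_node n k = X_node n l"
      using central_ellipse_determines_focus[OF C X C X] by (simp add: E_def)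
    then show "k = l" using inj_onD[OF inj_on_X_node] kl by blast
  qed
  then have "card (E ` ?K) = n div 2" by (simp add: card_image)
  moreover have "is_central_ellipse (E k)" if "k \<in> ?K" for k
    unfolding is_central_ellipse_def E_def
  proof (intro exI conjI)
    show "0 < sqrt (C k + (X_node n k)\<^sup>2)" using C[OF that] X[OF that] by (simp add: add_nonneg_pos)
    show "cmod (of_real (X_node n k)) \<le> sqrt (C k + (X_node n k)\<^sup>2)"
      using C[OF that] by (simp add: real_le_rsqrt)
  qed simp
  ultimately show ?thesis unfolding consists_of_concentric_ellipses_def dim
    by (intro exI[of _ "E ` ?K"]) auto
qed

section \<open>Branches of roots with envelope on ellipses\<close>


text \<open>The outer variable is x and the coefficients are polynomials in \<rho>, so that
  \<open>pderiv F\<close> and \<open>map_poly pderiv F\<close> are the two partial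
  derivatives.\<close>

definition poly2 :: "'a::comm_ring_1 poly poly \<Rightarrow> 'a \<Rightarrow> 'a \<Rightarrow> 'a" where
  "poly2 F x \<rho> = poly (poly F [:x:]) \<rho>"

lemma poly2_simps [simp]:
  "poly2 0 x \<rho> = 0" "poly2 1 x \<rho> = 1" "poly2 (pCons a F) x \<rho> = poly a \<rho> + x * poly2 F x \<rho>"
  "poly2 (F + G) x \<rho> = poly2 F x \<rho> + poly2 G x \<rho>" "poly2 (F - G) x \<rho> = poly2 F x \<rho> - poly2 G x \<rho>"
  "poly2 (- F) x \<rho> = - poly2 F x \<rho>" "poly2 (smult a F) x \<rho> = poly a \<rho> * poly2 F x \<rho>"
  by (simp_all add: poly2_def)

lemma poly2_has_derivative:
  fixes F :: "real poly poly"
  assumes "(x has_real_derivative x') (at s)" "(\<rho> has_real_derivative \<rho>') (at s)"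
  shows "((\<lambda>s. poly2 F (x s) (\<rho> s)) has_real_derivative
    poly2 (pderiv F) (x s) (\<rho> s) * x' + poly2 (map_poly pderiv F) (x s) (\<rho> s) * \<rho>') (at s)"
proof (induction F)
  case 0
  then show ?case by simp
next
  case (pCons a F)
  have "((\<lambda>s. poly a (\<rho> s)) has_real_derivative poly (pderiv a) (\<rho> s) * \<rho>') (at s)"
    using DERIV_chain2[OF poly_DERIV assms(2)] .
  from DERIV_add[OF this DERIV_mult[OF assms(1) pCons.IH]]
  show ?case by (simp add: pderiv_pCons Polynomial.map_poly_pCons[where f = pderiv, OF pderiv_0] algebra_simps)
qed

lemma isCont_poly2:
  fixes F :: "real poly poly"
  shows "isCont (\<lambda>p. poly2 F (fst p) (snd p)) p"
proof (induction F)
  case (pCons a F)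
  have "isCont (\<lambda>p. poly a (snd p)) p" for p :: "real \<times> real"
    by (intro continuous_intros)
  then show ?case using pCons.IH by (auto intro!: continuous_intros)
qed simp

lemma mvt_between:
  fixes f f' :: "real \<Rightarrow> real"
  assumes "\<And>x. (f has_real_derivative f' x) (at x)"
  shows "\<exists>\<zeta>. min x y \<le> \<zeta> \<and> \<zeta> \<le> max x y \<and> f x - f y = (x - y) * f' \<zeta>"
proof (cases x y rule: linorder_cases)
  case less
  then obtain z where "x < z" "z < y" "f y - f x = (y - x) * f' z" using MVT2 assms by blast
  then show ?thesis by (intro exI[of _ z]) (auto simp: algebra_simps)
next
  case greater
  then obtain z where "y < z" "z < x" "f x - f y = (x - y) * f' z" using MVT2 assms by blast
  then show ?thesis by (intro exI[of _ z]) auto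
qed auto

text \<open>The implicit function theorem in the plane. On a box where the x-derivative exceeds c >
  0 the intermediate value theorem gives a root, and the slope bound c makes it unique and
  continuous in \<rho>. The derivative is given by its formula so that it can be differentiated once
  more.\<close>

lemma implicit_branch_aux:
  fixes F :: "real poly poly"
  assumes F0: "poly2 F x0 \<rho>0 = 0" and pos: "0 < poly2 (pderiv F) x0 \<rho>0"
  shows "\<exists>r \<epsilon>. 0 < \<epsilon> \<and> r \<rho>0 = x0 \<and> (\<forall>\<rho>. \<bar>\<rho> - \<rho>0\<bar> < \<epsilon> \<longrightarrow> poly2 F (r \<rho>) \<rho> = 0 \<and> poly2 (pderiv F) (r \<rho>) \<rho> \<noteq> 0 \<and>
    (r has_real_derivative - poly2 (map_poly pderiv F) (r \<rho>) \<rho> / poly2 (pderiv F) (r \<rho>) \<rho>) (at \<rho>))"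
proof -
  define c where "c = poly2 (pderiv F) x0 \<rho>0 / 2"
  have c: "0 < c" using pos by (simp add: c_def)
  have "((\<lambda>p. poly2 (pderiv F) (fst p) (snd p)) \<longlongrightarrow> poly2 (pderiv F) (fst (x0, \<rho>0)) (snd (x0, \<rho>0))) (nhds (x0, \<rho>0))"
    using isCont_poly2[where F = "pderiv F" and p = "(x0, \<rho>0)"]
    unfolding isCont_def by (subst (asm) tendsto_at_iff_tendsto_nhds)
  then have "\<forall>\<^sub>F p in nhds x0 \<times>\<^sub>F nhds \<rho>0. c < poly2 (pderiv F) (fst p) (snd p)"
    unfolding nhds_prod by (rule order_tendstoD) (use pos in \<open>simp add: c_def\<close>)
  then obtain U V where "eventually U (nhds x0)" "eventually V (nhds \<rho>0)"
    and UV: "\<And>x \<rho>. U x \<Longrightarrow> V \<rho> \<Longrightarrow> c < poly2 (pderiv F) x \<rho>"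
    unfolding eventually_prod_filter by auto
  then obtain d1 d2 where d: "0 < d1" "0 < d2" "\<And>x. \<bar>x - x0\<bar> < d1 \<Longrightarrow> U x" "\<And>\<rho>. \<bar>\<rho> - \<rho>0\<bar> < d2 \<Longrightarrow> V \<rho>"
    by (auto simp: eventually_nhds_metric dist_real_def)
  define \<delta> where "\<delta> = min d1 d2 / 2"
  have \<delta>: "0 < \<delta>" using d by (simp add: \<delta>_def)
  have box: "c < poly2 (pderiv F) x \<rho>" if "\<bar>x - x0\<bar> \<le> \<delta>" "\<bar>\<rho> - \<rho>0\<bar> \<le> \<delta>" for x \<rho>
    using that d by (intro UV) (auto simp: \<delta>_def)
  have dx: "((\<lambda>x. poly2 F x \<rho>) has_real_derivative poly2 (pderiv F) x \<rho>) (at x)" for x \<rho>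
    using poly2_has_derivative[of "\<lambda>x. x" 1 x "\<lambda>_. \<rho>" 0 F] by simp
  have mvt: "\<exists>\<zeta>. \<bar>\<zeta> - y\<bar> \<le> \<bar>x - y\<bar> \<and> \<bar>\<zeta> - x0\<bar> \<le> \<delta> \<and> poly2 F x \<rho> - poly2 F y \<rho> = (x - y) * poly2 (pderiv F) \<zeta> \<rho>"
    if "\<bar>x - x0\<bar> \<le> \<delta>" "\<bar>y - x0\<bar> \<le> \<delta>" for x y \<rho>
  proof -
    obtain \<zeta> where "min x y \<le> \<zeta>" "\<zeta> \<le> max x y" "poly2 F x \<rho> - poly2 F y \<rho> = (x - y) * poly2 (pderiv F) \<zeta> \<rho>"
      using mvt_between[OF dx] by blast
    then show ?thesis using that by (intro exI[of _ \<zeta>]) auto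
  qed
  have bound: "c * \<bar>x - y\<bar> \<le> \<bar>poly2 F x \<rho> - poly2 F y \<rho>\<bar>"
    if xy: "\<bar>x - x0\<bar> \<le> \<delta>" "\<bar>y - x0\<bar> \<le> \<delta>" "\<bar>\<rho> - \<rho>0\<bar> \<le> \<delta>" for x y \<rho>
  proof -
    obtain \<zeta> where \<zeta>: "\<bar>\<zeta> - x0\<bar> \<le> \<delta>" "poly2 F x \<rho> - poly2 F y \<rho> = (x - y) * poly2 (pderiv F) \<zeta> \<rho>"
      using mvt[OF xy(1,2)] by blast
    have "c < poly2 (pderiv F) \<zeta> \<rho>" using box \<zeta> xy by blast
    then have "c * \<bar>x - y\<bar> \<le> poly2 (pderiv F) \<zeta> \<rho> * \<bar>x - y\<bar>" by (intro mult_right_mono) auto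
    also have "\<dots> = \<bar>poly2 F x \<rho> - poly2 F y \<rho>\<bar>"
      using \<open>c < _\<close> c unfolding \<zeta>(2) by (simp add: abs_mult)
    finally show ?thesis .
  qed
  have ends: "0 < poly2 F (x0 + \<delta>) \<rho>0" "poly2 F (x0 - \<delta>) \<rho>0 < 0"
  proof -
    obtain \<zeta> where \<zeta>: "\<bar>\<zeta> - x0\<bar> \<le> \<delta>" "poly2 F (x0 + \<delta>) \<rho>0 - poly2 F x0 \<rho>0 = (x0 + \<delta> - x0) * poly2 (pderiv F) \<zeta> \<rho>0"
      using mvt[of "x0 + \<delta>" x0 \<rho>0] \<delta> by auto
    have "0 < poly2 (pderiv F) \<zeta> \<rho>0" using box[of \<zeta> \<rho>0] \<zeta>(1) \<delta> c by simp
    then show "0 < poly2 F (x0 + \<delta>) \<rho>0" using \<zeta>(2) \<delta> F0 by simp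
    obtain \<zeta> where \<zeta>: "\<bar>\<zeta> - x0\<bar> \<le> \<delta>" "poly2 F (x0 - \<delta>) \<rho>0 - poly2 F x0 \<rho>0 = (x0 - \<delta> - x0) * poly2 (pderiv F) \<zeta> \<rho>0"
      using mvt[of "x0 - \<delta>" x0 \<rho>0] \<delta> by auto
    have "0 < poly2 (pderiv F) \<zeta> \<rho>0" using box[of \<zeta> \<rho>0] \<zeta>(1) \<delta> c by simp
    then show "poly2 F (x0 - \<delta>) \<rho>0 < 0" using \<zeta>(2) \<delta> F0 by (simp add: mult_less_0_iff)
  qed
  have d\<rho>: "((\<lambda>\<rho>. poly2 F x \<rho>) has_real_derivative poly2 (map_poly pderiv F) x \<rho>) (at \<rho>)" for x \<rho>
    using poly2_has_derivative[of "\<lambda>_. x" 0 \<rho> "\<lambda>\<rho>. \<rho>" 1 F] by simp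
  have cont\<rho>: "(\<lambda>\<rho>. poly2 F x \<rho>) \<midarrow>\<rho>1\<rightarrow> poly2 F x \<rho>1" for x \<rho>1
    using DERIV_isCont[OF d\<rho>] by (simp add: isCont_def)
  have "\<forall>\<^sub>F \<rho> in at \<rho>0. 0 < poly2 F (x0 + \<delta>) \<rho> \<and> poly2 F (x0 - \<delta>) \<rho> < 0"
    using order_tendstoD(1)[OF cont\<rho> ends(1)] order_tendstoD(2)[OF cont\<rho> ends(2)] by eventually_elim simp
  then obtain e where e: "0 < e" "\<And>\<rho>. \<rho> \<noteq> \<rho>0 \<Longrightarrow> \<bar>\<rho> - \<rho>0\<bar> < e \<Longrightarrow> 0 < poly2 F (x0 + \<delta>) \<rho> \<and> poly2 F (x0 - \<delta>) \<rho> < 0"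
    by (auto simp: eventually_at dist_real_def)
  define \<epsilon> where "\<epsilon> = min e \<delta>"
  have \<epsilon>: "0 < \<epsilon>" using e \<delta> by (simp add: \<epsilon>_def)
  have "\<exists>x. \<bar>x - x0\<bar> \<le> \<delta> \<and> poly2 F x \<rho> = 0" if "\<bar>\<rho> - \<rho>0\<bar> < \<epsilon>" for \<rho>
  proof -
    have "0 \<le> poly2 F (x0 + \<delta>) \<rho>" "poly2 F (x0 - \<delta>) \<rho> \<le> 0"
      using e(2)[of \<rho>] ends that by (cases "\<rho> = \<rho>0"; simp add: \<epsilon>_def)+
    then obtain x where "x0 - \<delta> \<le> x" "x \<le> x0 + \<delta>" "poly2 F x \<rho> = 0"
      using \<delta> DERIV_isCont[OF dx] IVT[of "\<lambda>x. poly2 F x \<rho>" "x0 - \<delta>" 0 "x0 + \<delta>"] by auto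
    then show ?thesis by (intro exI[of _ x]) (simp add: abs_le_iff)
  qed
  then obtain r where r: "\<And>\<rho>. \<bar>\<rho> - \<rho>0\<bar> < \<epsilon> \<Longrightarrow> \<bar>r \<rho> - x0\<bar> \<le> \<delta> \<and> poly2 F (r \<rho>) \<rho> = 0" by metis
  have "c * \<bar>r \<rho>0 - x0\<bar> \<le> 0"
    using bound[of "r \<rho>0" x0 \<rho>0] r[of \<rho>0] \<delta> \<epsilon> F0 by simp
  then have r0: "r \<rho>0 = x0" using c by (simp add: mult_le_0_iff)
  have "(r has_real_derivative - poly2 (map_poly pderiv F) (r \<rho>) \<rho> / poly2 (pderiv F) (r \<rho>) \<rho>) (at \<rho>)
      \<and> poly2 (pderiv F) (r \<rho>) \<rho> \<noteq> 0" if \<rho>: "\<bar>\<rho> - \<rho>0\<bar> < \<epsilon>" for \<rho>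
  proof -
    have "\<bar>\<rho> - \<rho>0\<bar> \<le> \<delta>" using \<rho> by (simp add: \<epsilon>_def)
    then have nz: "poly2 (pderiv F) (r \<rho>) \<rho> \<noteq> 0" using box[of "r \<rho>" \<rho>] r[OF \<rho>] c by linarith
    have "isCont (\<lambda>s. \<bar>s - \<rho>0\<bar>) \<rho>" by (intro continuous_intros)
    then have near: "\<forall>\<^sub>F s in at \<rho>. \<bar>s - \<rho>0\<bar> < \<epsilon>"
      using \<rho> by (intro order_tendstoD) (auto simp: isCont_def)
    \<comment> \<open>The range of s is a premise inside the quantifier, so that the mean value
      point can be chosen as a total function of s.\<close>
    have "\<exists>\<zeta>. \<bar>s - \<rho>0\<bar> < \<epsilon> \<longrightarrow> \<bar>\<zeta> - r \<rho>\<bar> \<le> \<bar>r s - r \<rho>\<bar> \<and> - poly2 F (r \<rho>) s = (r s - r \<rho>) * poly2 (pderiv F) \<zeta> s \<and> c < poly2 (pderiv F) \<zeta> s" for s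
    proof (cases "\<bar>s - \<rho>0\<bar> < \<epsilon>")
      case True
      then obtain \<zeta> where \<zeta>: "\<bar>\<zeta> - r \<rho>\<bar> \<le> \<bar>r s - r \<rho>\<bar>" "\<bar>\<zeta> - x0\<bar> \<le> \<delta>"
          "poly2 F (r s) s - poly2 F (r \<rho>) s = (r s - r \<rho>) * poly2 (pderiv F) \<zeta> s"
        using mvt[of "r s" "r \<rho>" s] r[of s] r[OF \<rho>] by blast
      moreover have "c < poly2 (pderiv F) \<zeta> s" using box[of \<zeta> s] \<zeta>(2) True by (simp add: \<epsilon>_def)
      ultimately show ?thesis using r[OF True] by (intro exI[of _ \<zeta>]) auto
    qed simp
    then obtain \<zeta> where \<zeta>: "\<And>s. \<bar>s - \<rho>0\<bar> < \<epsilon> \<Longrightarrow> \<bar>\<zeta> s - r \<rho>\<bar> \<le> \<bar>r s - r \<rho>\<bar> \<and>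
        - poly2 F (r \<rho>) s = (r s - r \<rho>) * poly2 (pderiv F) (\<zeta> s) s \<and> c < poly2 (pderiv F) (\<zeta> s) s"
      by metis
    have "(\<lambda>s. \<bar>poly2 F (r \<rho>) s\<bar> / c) \<midarrow>\<rho>\<rightarrow> \<bar>poly2 F (r \<rho>) \<rho>\<bar> / c"
      by (intro tendsto_intros cont\<rho>) (use c in auto)
    then have lim0: "(\<lambda>s. \<bar>poly2 F (r \<rho>) s\<bar> / c) \<midarrow>\<rho>\<rightarrow> 0" using r[OF \<rho>] by simp
    \<comment> \<open>The mean value point is no farther from \<open>r \<rho>\<close> than
      \<open>r s\<close> is, and the slope bound controls that distance by a quantity tending to
      0.\<close>
    have "\<forall>\<^sub>F s in at \<rho>. norm (\<zeta> s - r \<rho>) \<le> norm (\<bar>poly2 F (r \<rho>) s\<bar> / c) * 1"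
      using near
    proof eventually_elim
      case (elim s)
      then have "c * \<bar>r s - r \<rho>\<bar> \<le> \<bar>poly2 F (r s) s - poly2 F (r \<rho>) s\<bar>"
        using bound[of "r s" "r \<rho>" s] r[of s] r[OF \<rho>] by (simp add: \<epsilon>_def)
      then have "\<bar>r s - r \<rho>\<bar> \<le> \<bar>poly2 F (r \<rho>) s\<bar> / c" using r[OF elim] c by (simp add: field_simps)
      moreover have "0 \<le> \<bar>poly2 F (r \<rho>) s\<bar> / c" using c by simp
      ultimately show ?case using \<zeta>[OF elim] by (simp only: real_norm_def mult_1_right) linarith
    qed
    with lim0 have "(\<lambda>s. \<zeta> s - r \<rho>) \<midarrow>\<rho>\<rightarrow> 0" by (rule tendsto_0_le)
    then have "\<zeta> \<midarrow>\<rho>\<rightarrow> r \<rho>" by (simp add: LIM_zero_iff)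
    then have "(\<lambda>s. (\<zeta> s, s)) \<midarrow>\<rho>\<rightarrow> (r \<rho>, \<rho>)" by (intro tendsto_Pair) auto
    from isCont_tendsto_compose[OF isCont_poly2[where F = "pderiv F" and p = "(r \<rho>, \<rho>)"] this]
    have limD: "(\<lambda>s. poly2 (pderiv F) (\<zeta> s) s) \<midarrow>\<rho>\<rightarrow> poly2 (pderiv F) (r \<rho>) \<rho>" by simp
    have "(\<lambda>s. (poly2 F (r \<rho>) s - poly2 F (r \<rho>) \<rho>) / (s - \<rho>)) \<midarrow>\<rho>\<rightarrow> poly2 (map_poly pderiv F) (r \<rho>) \<rho>"
      using d\<rho>[of "r \<rho>" \<rho>] by (simp add: has_field_derivative_iff)
    from tendsto_divide[OF tendsto_minus[OF this] limD nz]
    have lim: "(\<lambda>s. - ((poly2 F (r \<rho>) s - poly2 F (r \<rho>) \<rho>) / (s - \<rho>)) / poly2 (pderiv F) (\<zeta> s) s) \<midarrow>\<rho>\<rightarrow>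
        - poly2 (map_poly pderiv F) (r \<rho>) \<rho> / poly2 (pderiv F) (r \<rho>) \<rho>" .
    have "\<forall>\<^sub>F s in at \<rho>. - ((poly2 F (r \<rho>) s - poly2 F (r \<rho>) \<rho>) / (s - \<rho>)) / poly2 (pderiv F) (\<zeta> s) s
        = (r s - r \<rho>) / (s - \<rho>)"
      using near
    proof eventually_elim
      case (elim s)
      have "poly2 (pderiv F) (\<zeta> s) s \<noteq> 0" using \<zeta>[OF elim] c by linarith
      moreover have "- (poly2 F (r \<rho>) s - poly2 F (r \<rho>) \<rho>) = (r s - r \<rho>) * poly2 (pderiv F) (\<zeta> s) s"
        using \<zeta>[OF elim] r[OF \<rho>] by simp
      ultimately show ?case by (simp add: minus_divide_left)
    qed
    from Lim_transform_eventually[OF lim this] show ?thesis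
      using nz by (simp add: has_field_derivative_iff)
  qed
  then show ?thesis using \<epsilon> r0 r by blast
qed

lemma implicit_branch:
  fixes F :: "real poly poly"
  assumes F0: "poly2 F x0 \<rho>0 = 0" and nz: "poly2 (pderiv F) x0 \<rho>0 \<noteq> 0"
  shows "\<exists>r \<epsilon>. 0 < \<epsilon> \<and> r \<rho>0 = x0 \<and> (\<forall>\<rho>. \<bar>\<rho> - \<rho>0\<bar> < \<epsilon> \<longrightarrow> poly2 F (r \<rho>) \<rho> = 0 \<and> poly2 (pderiv F) (r \<rho>) \<rho> \<noteq> 0 \<and>
    (r has_real_derivative - poly2 (map_poly pderiv F) (r \<rho>) \<rho> / poly2 (pderiv F) (r \<rho>) \<rho>) (at \<rho>))"
proof (cases "0 < poly2 (pderiv F) x0 \<rho>0")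
  case True
  then show ?thesis using implicit_branch_aux F0 by blast
next
  case False
  have m: "map_poly pderiv (- F) = - map_poly pderiv F"
    by (intro poly_eqI) (simp add: coeff_map_poly pderiv_minus)
  have "0 < poly2 (pderiv (- F)) x0 \<rho>0" using False nz by (simp add: pderiv_minus)
  then show ?thesis using implicit_branch_aux[of "- F" x0 \<rho>0] F0 by (simp add: pderiv_minus m)
qed

lemma poly2_tri_poly: "poly2 (tri_poly n (\<lambda>i. [:x i, 1:])) y \<rho> = poly (tri_poly n (\<lambda>i. x i + \<rho>)) y"
  by (induction n x rule: tri_poly.induct) (auto simp: algebra_simps)

lemma poly2_pderiv_tri_poly:
  fixes x :: "nat \<Rightarrow> real"
  shows "poly2 (pderiv (tri_poly n (\<lambda>i. [:x i, 1:]))) y \<rho> = poly (pderiv (tri_poly n (\<lambda>i. x i + \<rho>))) y"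
  by (induction n x rule: tri_poly.induct)
    (auto simp: pderiv_pCons pderiv_diff pderiv_smult poly2_tri_poly algebra_simps)

text \<open>A finite form of Baire's theorem: if z is outside a closed member at one point, it
  avoids this member on a neighbourhood, where one set fewer is left.\<close>

lemma covering_interval:
  fixes z :: "real \<Rightarrow> 'a::topological_space"
  assumes "finite \<F>" "\<And>F. F \<in> \<F> \<Longrightarrow> closed F" "s < t"
    "\<And>\<theta>. \<theta> \<in> {s<..<t} \<Longrightarrow> isCont z \<theta>" "\<And>\<theta>. \<theta> \<in> {s<..<t} \<Longrightarrow> z \<theta> \<in> \<Union>\<F>"
  shows "\<exists>F\<in>\<F>. \<exists>s' t'. s \<le> s' \<and> s' < t' \<and> t' \<le> t \<and> (\<forall>\<theta>\<in>{s'<..<t'}. z \<theta> \<in> F)"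
  using assms
proof (induction \<F> arbitrary: s t rule: finite_induct)
  case empty
  then show ?case using dense[of s t] by auto
next
  case (insert F \<F>)
  show ?case
  proof (cases "\<forall>\<theta>\<in>{s<..<t}. z \<theta> \<in> F")
    case True
    then show ?thesis using insert.prems by blast
  next
    case False
    then obtain \<theta>0 where \<theta>0: "\<theta>0 \<in> {s<..<t}" "z \<theta>0 \<notin> F" by blast
    have "(z \<longlongrightarrow> z \<theta>0) (at \<theta>0)" using insert.prems(3)[OF \<theta>0(1)] by (simp add: isCont_def)
    then have "\<forall>\<^sub>F \<theta> in at \<theta>0. z \<theta> \<in> - F"
      by (rule topological_tendstoD) (use insert.prems(1)[of F] \<theta>0 in auto)
    then obtain d where d: "0 < d" "\<And>\<theta>. \<theta> \<noteq> \<theta>0 \<Longrightarrow> \<bar>\<theta> - \<theta>0\<bar> < d \<Longrightarrow> z \<theta> \<notin> F"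
      by (auto simp: eventually_at dist_real_def)
    define s1 where "s1 = max s (\<theta>0 - d)"
    define t1 where "t1 = min t (\<theta>0 + d)"
    have "\<exists>G\<in>\<F>. \<exists>s' t'. s1 \<le> s' \<and> s' < t' \<and> t' \<le> t1 \<and> (\<forall>\<theta>\<in>{s'<..<t'}. z \<theta> \<in> G)"
    proof (rule insert.IH)
      show "s1 < t1" using \<theta>0 d(1) by (auto simp: s1_def t1_def)
      fix \<theta> assume \<theta>: "\<theta> \<in> {s1<..<t1}"
      then show "isCont z \<theta>" by (intro insert.prems) (auto simp: s1_def t1_def)
      have "z \<theta> \<notin> F" using \<theta> d(2)[of \<theta>] \<theta>0(2) by (cases "\<theta> = \<theta>0") (auto simp: s1_def t1_def abs_less_iff)
      moreover have "z \<theta> \<in> \<Union>(insert F \<F>)" using \<theta> by (intro insert.prems) (auto simp: s1_def t1_def)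
      ultimately show "z \<theta> \<in> \<Union>\<F>" by blast
    qed (use insert.prems in auto)
    then obtain G s' t' where "G \<in> \<F>" "s1 \<le> s'" "s' < t'" "t' \<le> t1" "\<forall>\<theta>\<in>{s'<..<t'}. z \<theta> \<in> G" by blast
    then show ?thesis by (intro bexI[of _ G] exI[of _ s'] exI[of _ t']) (auto simp: s1_def t1_def)
  qed
qed

section \<open>Branches whose points of contact lie on central ellipses\<close>

lemma closed_central_ellipse: "closed (central_ellipse f a)"
proof (cases "a = cmod f")
  case True
  then show ?thesis by (simp add: central_ellipse_def)
next
  case False
  have "closed {z. cmod (z - f) + cmod (z + f) = 2 * a}"
    by (intro closed_Collect_eq continuous_intros)
  then show ?thesis using False by (simp add: central_ellipse_def)
qed

lemma Re_cis_mult_squared: "(Re (cis \<theta> * z))\<^sup>2 = (cmod z)\<^sup>2 / 2 + Re (z\<^sup>2 * cis (2 * \<theta>)) / 2"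
  and Im_cis_mult_squared: "(Im (cis \<theta> * z))\<^sup>2 = (cmod z)\<^sup>2 / 2 - Re (z\<^sup>2 * cis (2 * \<theta>)) / 2"
proof -
  let ?w = "cis \<theta> * z"
  have "Re (?w\<^sup>2) = (Re ?w)\<^sup>2 - (Im ?w)\<^sup>2" by (simp only: Re_power2)
  moreover have "?w\<^sup>2 = z\<^sup>2 * cis (2 * \<theta>)" by (simp add: power_mult_distrib Complex.DeMoivre)
  ultimately have "Re (z\<^sup>2 * cis (2 * \<theta>)) = (Re ?w)\<^sup>2 - (Im ?w)\<^sup>2" by metis
  moreover have "(cmod z)\<^sup>2 = (Re ?w)\<^sup>2 + (Im ?w)\<^sup>2"
    by (simp only: cmod_power2[symmetric] norm_mult norm_cis mult_1)
  ultimately show "(Re ?w)\<^sup>2 = (cmod z)\<^sup>2 / 2 + Re (z\<^sup>2 * cis (2 * \<theta>)) / 2"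
    "(Im ?w)\<^sup>2 = (cmod z)\<^sup>2 / 2 - Re (z\<^sup>2 * cis (2 * \<theta>)) / 2" by linarith+
qed

text \<open>The point cis (- \<theta>) (r - \<i> r'), the only one that meets both envelope
  conditions at \<theta>.\<close>

definition envelope_point :: "(real \<Rightarrow> real) \<Rightarrow> (real \<Rightarrow> real) \<Rightarrow> real \<Rightarrow> complex" where
  "envelope_point r r' \<theta> = Complex (r \<theta> * cos \<theta> - r' \<theta> * sin \<theta>) (- r \<theta> * sin \<theta> - r' \<theta> * cos \<theta>)"

lemma cis_mult_envelope_point:
  "Re (cis \<theta> * envelope_point r r' \<theta>) = r \<theta>" "- Im (cis \<theta> * envelope_point r r' \<theta>) = r' \<theta>"
proof -
  have "Re (cis \<theta> * envelope_point r r' \<theta>) = r \<theta> * ((sin \<theta>)\<^sup>2 + (cos \<theta>)\<^sup>2)"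
    "- Im (cis \<theta> * envelope_point r r' \<theta>) = r' \<theta> * ((sin \<theta>)\<^sup>2 + (cos \<theta>)\<^sup>2)"
    by (simp_all add: envelope_point_def power2_eq_square algebra_simps
        del: sin_cos_squared_add sin_cos_squared_add2 sin_cos_squared_add3)
  then show "Re (cis \<theta> * envelope_point r r' \<theta>) = r \<theta>" "- Im (cis \<theta> * envelope_point r r' \<theta>) = r' \<theta>"
    by simp_all
qed

text \<open>One form for both possible outcomes: a point z0 gives c = |z0|^2 / 2 and \<phi> = z0^2,
  an ellipse with focus f and major half-axis a gives c = a^2 - |f|^2 / 2 and \<phi> = f^2.\<close>

definition squared_trig_on :: "(real \<Rightarrow> real) \<Rightarrow> real \<Rightarrow> real \<Rightarrow> bool" where
  "squared_trig_on r s t \<longleftrightarrow>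
     (\<exists>c \<phi>. \<forall>\<theta>\<in>{s<..<t}. (r \<theta>)\<^sup>2 = c + Re (\<phi> * cis (2 * \<theta>)) / 2)"

lemma squared_trig_on_subinterval:
  "squared_trig_on r s t \<Longrightarrow> s \<le> s' \<Longrightarrow> t' \<le> t \<Longrightarrow> squared_trig_on r s' t'"
  unfolding squared_trig_on_def by (meson greaterThanLessThan_iff le_less_trans less_le_trans)

lemma squared_trig_on_constant:
  assumes "\<And>\<theta>. \<theta> \<in> {s<..<t} \<Longrightarrow> envelope_point r r' \<theta> = z0"
  shows "squared_trig_on r s t"
  unfolding squared_trig_on_def
proof (intro exI ballI)
  fix \<theta> assume "\<theta> \<in> {s<..<t}"
  then have "r \<theta> = Re (cis \<theta> * z0)" using assms cis_mult_envelope_point(1)[of \<theta> r r'] by simp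
  then show "(r \<theta>)\<^sup>2 = (cmod z0)\<^sup>2 / 2 + Re (z0\<^sup>2 * cis (2 * \<theta>)) / 2" by (simp only: Re_cis_mult_squared)
qed

text \<open>The quadratic equation of the ellipse is a first integral of \<open>r\<close>. Its derivative is a multiple
  of \<open>r + r''\<close>, so that \<open>r\<close> is the support function of the ellipse or of a single point.\<close>

lemma squared_trig_on_ellipse:
  assumes fa: "cmod f < a" and st: "s < t"
    and r: "\<And>\<theta>. \<theta> \<in> {s<..<t} \<Longrightarrow> (r has_real_derivative r' \<theta>) (at \<theta>)"
    and r': "\<And>\<theta>. \<theta> \<in> {s<..<t} \<Longrightarrow> (r' has_real_derivative r'' \<theta>) (at \<theta>)"
    and E: "\<And>\<theta>. \<theta> \<in> {s<..<t} \<Longrightarrow> envelope_point r r' \<theta> \<in> central_ellipse f a"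
  shows "\<exists>s' t'. s \<le> s' \<and> s' < t' \<and> t' \<le> t \<and> squared_trig_on r s' t'"
proof -
  define u where "u = (\<lambda>\<theta>. Re (cis \<theta> * f))"
  define v where "v = (\<lambda>\<theta>. Im (cis \<theta> * f))"
  define D where "D = a\<^sup>2 * (a\<^sup>2 - (cmod f)\<^sup>2)"
  \<comment> \<open>\<open>G\<close> comes from the ellipse equation at the point of contact, so it
    equals \<open>D\<close> on the interval; \<open>K\<close> is the factor in G' = 2 K (r +
    r'').\<close>
  define G where "G = (\<lambda>\<theta>. a\<^sup>2 * ((r \<theta>)\<^sup>2 + (r' \<theta>)\<^sup>2) - (u \<theta> * r \<theta> - v \<theta> * r' \<theta>)\<^sup>2)"
  define K where "K = (\<lambda>\<theta>. a\<^sup>2 * r' \<theta> + v \<theta> * (u \<theta> * r \<theta> - v \<theta> * r' \<theta>))"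
  have a: "0 < a" using fa by (meson le_less_trans norm_ge_zero)
  have "(cmod f)\<^sup>2 < a\<^sup>2" using fa a by (intro power_strict_mono) auto
  then have D: "0 < D" using a by (simp add: D_def)
  have uv: "(u \<theta>)\<^sup>2 + (v \<theta>)\<^sup>2 = (cmod f)\<^sup>2" for \<theta>
    unfolding u_def v_def cmod_power2[symmetric] by (simp add: norm_mult)
  have du: "(u has_real_derivative - v \<theta>) (at \<theta>)" and dv: "(v has_real_derivative u \<theta>) (at \<theta>)" for \<theta>
    unfolding u_def v_def by (auto intro!: derivative_eq_intros)
  have G: "G \<theta> = D" if "\<theta> \<in> {s<..<t}" for \<theta>
  proof -
    let ?z = "envelope_point r r' \<theta>"
    have w: "cis \<theta> * ?z = Complex (r \<theta>) (- r' \<theta>)"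
      using cis_mult_envelope_point[of \<theta> r r'] by (intro complex_eqI; simp only: complex.sel; linarith)
    have z2: "(cmod ?z)\<^sup>2 = (r \<theta>)\<^sup>2 + (r' \<theta>)\<^sup>2"
      using arg_cong[OF w, of "\<lambda>w. (cmod w)\<^sup>2"] by (simp add: norm_mult cmod_power2)
    have "?z * cnj f = (cis \<theta> * ?z) * cnj (cis \<theta> * f)"
      by (simp add: cis_cnj cis_mult mult_ac)
    then have "Re (?z * cnj f) = Re (Complex (r \<theta>) (- r' \<theta>) * cnj (cis \<theta> * f))" unfolding w by (rule arg_cong)
    moreover have "Re (Complex p (- q) * cnj W) = Re W * p - Im W * q" for p q W by simp
    ultimately have "Re (?z * cnj f) = u \<theta> * r \<theta> - v \<theta> * r' \<theta>" by (simp only: u_def v_def)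
    moreover have "cmod (?z - f) + cmod (?z + f) = 2 * a"
      using E[OF that] fa by (simp add: central_ellipse_def)
    ultimately show ?thesis
      using central_ellipse_equation[OF fa, of ?z] z2 by (simp add: G_def D_def)
  qed
  \<comment> \<open>Where G = D this reads K^2 = D (a^2 - v^2 - r^2), and a^2 - v^2 is the squared
    support function of the ellipse.\<close>
  have KG: "(K \<theta>)\<^sup>2 + D * (r \<theta>)\<^sup>2 = (a\<^sup>2 - (v \<theta>)\<^sup>2) * G \<theta>" for \<theta>
    unfolding K_def G_def D_def uv[of \<theta>, symmetric] by (simp add: power2_eq_square algebra_simps)
  have key: "K \<theta> * (r \<theta> + r'' \<theta>) = 0" if \<theta>: "\<theta> \<in> {s<..<t}" for \<theta>
  proof -
    have "(G has_real_derivative 2 * (K \<theta> * (r \<theta> + r'' \<theta>))) (at \<theta>)"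
      unfolding G_def K_def
      by (rule derivative_eq_intros r[OF \<theta>] r'[OF \<theta>] du dv refl)+ (simp add: power2_eq_square algebra_simps)
    moreover have "(G has_real_derivative 0) (at \<theta>)"
    proof (rule has_field_derivative_transform_within_open)
      show "((\<lambda>_. D) has_real_derivative 0) (at \<theta>)" by simp
      show "open {s<..<t}" by simp
    qed (use \<theta> G in auto)
    ultimately show ?thesis using DERIV_unique by fastforce
  qed
  have support: "a\<^sup>2 - (v \<theta>)\<^sup>2 = (a\<^sup>2 - (cmod f)\<^sup>2 / 2) + Re (f\<^sup>2 * cis (2 * \<theta>)) / 2" for \<theta>
    unfolding v_def Im_cis_mult_squared by simp
  show ?thesis
  proof (cases "\<forall>\<theta>\<in>{s<..<t}. (r \<theta>)\<^sup>2 = a\<^sup>2 - (v \<theta>)\<^sup>2")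
    case True
    then have "squared_trig_on r s t" unfolding squared_trig_on_def support by blast
    then show ?thesis using st by blast
  next
    case False
    then obtain \<theta>0 where \<theta>0: "\<theta>0 \<in> {s<..<t}" "(r \<theta>0)\<^sup>2 - (a\<^sup>2 - (v \<theta>0)\<^sup>2) \<noteq> 0" by auto
    have "isCont (\<lambda>\<theta>. (r \<theta>)\<^sup>2 - (a\<^sup>2 - (v \<theta>)\<^sup>2)) \<theta>0"
      using DERIV_isCont[OF r[OF \<theta>0(1)]] DERIV_isCont[OF dv] by (intro continuous_intros)
    then have "\<forall>\<^sub>F \<theta> in at \<theta>0. (r \<theta>)\<^sup>2 - (a\<^sup>2 - (v \<theta>)\<^sup>2) \<noteq> 0"
      using \<theta>0(2) by (intro tendsto_imp_eventually_ne) (auto simp: isCont_def)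
    then obtain d where d: "0 < d" "\<And>\<theta>. \<theta> \<noteq> \<theta>0 \<Longrightarrow> \<bar>\<theta> - \<theta>0\<bar> < d \<Longrightarrow> (r \<theta>)\<^sup>2 - (a\<^sup>2 - (v \<theta>)\<^sup>2) \<noteq> 0"
      by (auto simp: eventually_at dist_real_def)
    define s' where "s' = max s (\<theta>0 - d)"
    define t' where "t' = min t (\<theta>0 + d)"
    have st': "s \<le> s'" "s' < t'" "t' \<le> t" using \<theta>0 d(1) by (auto simp: s'_def t'_def)
    have sub: "\<theta> \<in> {s<..<t}" if "\<theta> \<in> {s'<..<t'}" for \<theta> using that st' by auto
    \<comment> \<open>Off the support function \<open>K\<close> does not vanish, hence r'' = - r,
      and then the point of contact does not move.\<close>
    have rr: "r'' \<theta> = - r \<theta>" if \<theta>: "\<theta> \<in> {s'<..<t'}" for \<theta>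
    proof -
      have "(r \<theta>)\<^sup>2 - (a\<^sup>2 - (v \<theta>)\<^sup>2) \<noteq> 0"
        using \<theta> d(2)[of \<theta>] \<theta>0(2) by (cases "\<theta> = \<theta>0") (auto simp: s'_def t'_def abs_less_iff)
      moreover have "(K \<theta>)\<^sup>2 = D * (a\<^sup>2 - (v \<theta>)\<^sup>2 - (r \<theta>)\<^sup>2)"
        using KG[of \<theta>] G[OF sub[OF \<theta>]] by (simp add: algebra_simps)
      ultimately have "(K \<theta>)\<^sup>2 \<noteq> 0" using D by auto
      then show ?thesis using key[OF sub[OF \<theta>]] by simp
    qed
    have dRe: "((\<lambda>\<theta>. r \<theta> * cos \<theta> - r' \<theta> * sin \<theta>) has_real_derivative 0) (at \<theta>)"
      and dIm: "((\<lambda>\<theta>. - r \<theta> * sin \<theta> - r' \<theta> * cos \<theta>) has_real_derivative 0) (at \<theta>)" if \<theta>: "\<theta> \<in> {s'<..<t'}" for \<theta>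
    proof -
      show "((\<lambda>\<theta>. r \<theta> * cos \<theta> - r' \<theta> * sin \<theta>) has_real_derivative 0) (at \<theta>)"
        by (rule derivative_eq_intros r[OF sub[OF \<theta>]] r'[OF sub[OF \<theta>]] refl)+ (simp add: rr[OF \<theta>])
      show "((\<lambda>\<theta>. - r \<theta> * sin \<theta> - r' \<theta> * cos \<theta>) has_real_derivative 0) (at \<theta>)"
        by (rule derivative_eq_intros r[OF sub[OF \<theta>]] r'[OF sub[OF \<theta>]] refl)+ (simp add: rr[OF \<theta>])
    qed
    define m where "m = (s' + t') / 2"
    have m: "m \<in> {s'<..<t'}" using st' by (simp add: m_def)
    have "envelope_point r r' \<theta> = envelope_point r r' m" if \<theta>: "\<theta> \<in> {s'<..<t'}" for \<theta>
      unfolding envelope_point_def complex.inject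
      using DERIV_isconst3[OF st'(2) \<theta> m dRe] DERIV_isconst3[OF st'(2) \<theta> m dIm] by blast
    then have "squared_trig_on r s' t'" by (rule squared_trig_on_constant)
    then show ?thesis using st' by blast
  qed
qed

lemma squared_trig_on_concentric_ellipses:
  assumes fin: "finite \<E>" and ell: "\<And>E. E \<in> \<E> \<Longrightarrow> is_central_ellipse E" and st: "s < t"
    and r: "\<And>\<theta>. \<theta> \<in> {s<..<t} \<Longrightarrow> (r has_real_derivative r' \<theta>) (at \<theta>)"
    and r': "\<And>\<theta>. \<theta> \<in> {s<..<t} \<Longrightarrow> (r' has_real_derivative r'' \<theta>) (at \<theta>)"
    and E: "\<And>\<theta>. \<theta> \<in> {s<..<t} \<Longrightarrow> envelope_point r r' \<theta> \<in> \<Union>\<E> \<union> {0}"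
  shows "\<exists>s' t'. s \<le> s' \<and> s' < t' \<and> t' \<le> t \<and> squared_trig_on r s' t'"
proof -
  have cont: "isCont (envelope_point r r') \<theta>" if "\<theta> \<in> {s<..<t}" for \<theta>
  proof -
    have "envelope_point r r' = (\<lambda>\<theta>. complex_of_real (r \<theta> * cos \<theta> - r' \<theta> * sin \<theta>) +
        \<i> * complex_of_real (- r \<theta> * sin \<theta> - r' \<theta> * cos \<theta>))"
      by (simp add: envelope_point_def fun_eq_iff complex_eq_iff)
    moreover have "isCont r \<theta>" "isCont r' \<theta>" using DERIV_isCont r[OF that] r'[OF that] by blast+
    ultimately show ?thesis by (auto intro!: continuous_intros)
  qed
  have "\<exists>F\<in>insert {0} \<E>. \<exists>s' t'. s \<le> s' \<and> s' < t' \<and> t' \<le> t \<and> (\<forall>\<theta>\<in>{s'<..<t'}. envelope_point r r' \<theta> \<in> F)"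
  proof (rule covering_interval)
    show "closed F" if "F \<in> insert {0} \<E>" for F
      using that ell closed_central_ellipse by (auto simp: is_central_ellipse_def)
    show "envelope_point r r' \<theta> \<in> \<Union>(insert {0} \<E>)" if "\<theta> \<in> {s<..<t}" for \<theta> using E[OF that] by auto
  qed (use fin st cont in auto)
  then obtain F s1 t1 where F: "F \<in> insert {0} \<E>" and st1: "s \<le> s1" "s1 < t1" "t1 \<le> t"
    and zF: "\<And>\<theta>. \<theta> \<in> {s1<..<t1} \<Longrightarrow> envelope_point r r' \<theta> \<in> F" by blast
  have sub: "\<theta> \<in> {s<..<t}" if "\<theta> \<in> {s1<..<t1}" for \<theta> using that st1 by auto
  consider "F = {0}" | f where "F = {f, - f}" | f a where "F = central_ellipse f a" "cmod f < a"
  proof (cases "F = {0}")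
    case False
    then obtain f a where fa: "cmod f \<le> a" "F = central_ellipse f a"
      using F ell[of F] by (auto simp: is_central_ellipse_def)
    show ?thesis
    proof (cases "a = cmod f")
      case True
      then have "F = {f, - f}" using fa(2) by (simp add: central_ellipse_def)
      then show ?thesis by (rule that(2))
    next
      case False
      then show ?thesis using fa by (intro that(3)) auto
    qed
  qed
  then show ?thesis
  proof cases
    case 1
    then have "squared_trig_on r s1 t1" using zF by (intro squared_trig_on_constant[of _ _ _ r' 0]) auto
    then show ?thesis using st1 by blast
  next
    case 2
    \<comment> \<open>A degenerate ellipse is a pair of points; covering once more singles out one
      of them.\<close>
    have "\<exists>F\<in>{{f}, {- f}}. \<exists>s' t'. s1 \<le> s' \<and> s' < t' \<and> t' \<le> t1 \<and> (\<forall>\<theta>\<in>{s'<..<t'}. envelope_point r r' \<theta> \<in> F)"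
      by (rule covering_interval) (use st1 cont sub zF 2 in auto)
    then obtain z0 s2 t2 where st2: "s1 \<le> s2" "s2 < t2" "t2 \<le> t1"
      and z0: "\<And>\<theta>. \<theta> \<in> {s2<..<t2} \<Longrightarrow> envelope_point r r' \<theta> = z0" by auto
    have "squared_trig_on r s2 t2" using z0 by (rule squared_trig_on_constant)
    moreover have "s \<le> s2" "t2 \<le> t" using st1 st2 by auto
    ultimately show ?thesis using st2 by blast
  next
    case 3
    have "\<exists>s' t'. s1 \<le> s' \<and> s' < t' \<and> t' \<le> t1 \<and> squared_trig_on r s' t'"
      by (rule squared_trig_on_ellipse[OF 3(2) st1(2) r r'])
        (use sub zF 3(1) in blast)+
    then show ?thesis using st1 by (meson order_trans)
  qed
qed

text \<open>The interval is shrunk for one element after another; monotonicity preserves what has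
  been reached.\<close>

lemma common_subinterval:
  fixes Q :: "'i \<Rightarrow> real \<Rightarrow> real \<Rightarrow> bool"
  assumes "finite P" "s < t"
    and mono: "\<And>x s t s' t'. Q x s t \<Longrightarrow> s \<le> s' \<Longrightarrow> t' \<le> t \<Longrightarrow> Q x s' t'"
    and ex: "\<And>x s' t'. x \<in> P \<Longrightarrow> s \<le> s' \<Longrightarrow> s' < t' \<Longrightarrow> t' \<le> t \<Longrightarrow> \<exists>s'' t''. s' \<le> s'' \<and> s'' < t'' \<and> t'' \<le> t' \<and> Q x s'' t''"
  shows "\<exists>s' t'. s \<le> s' \<and> s' < t' \<and> t' \<le> t \<and> (\<forall>x\<in>P. Q x s' t')"
  using assms(1,2) ex
proof (induction P rule: finite_induct)
  case empty
  then show ?case by blast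
next
  case (insert x P)
  have "\<exists>s' t'. s \<le> s' \<and> s' < t' \<and> t' \<le> t \<and> (\<forall>x\<in>P. Q x s' t')"
    by (rule insert.IH[OF insert.prems(1)]) (use insert.prems(2) in blast)
  then obtain s1 t1 where st1: "s \<le> s1" "s1 < t1" "t1 \<le> t" "\<forall>x\<in>P. Q x s1 t1" by blast
  with insert.prems(2)[of x s1 t1] obtain s2 t2 where st2: "s1 \<le> s2" "s2 < t2" "t2 \<le> t1" "Q x s2 t2" by blast
  have "\<forall>y\<in>insert x P. Q y s2 t2" using st1 st2 mono by blast
  then show ?case using st1 st2 by (meson order_trans)
qed

section \<open>From ellipses to the identities\<close>


text \<open>The n distinct roots are symmetric about 0, so n is twice the number of positive ones,
  plus one if 0 is a root.\<close>

lemma card_positive_tri_poly_roots: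
  fixes b :: "nat \<Rightarrow> real"
  assumes "\<And>i. i \<in> {1..<n} \<Longrightarrow> 0 < b i"
  shows "finite {x. 0 < x \<and> poly (tri_poly n b) x = 0}" "card {x. 0 < x \<and> poly (tri_poly n b) x = 0} = n div 2"
proof -
  let ?p = "poly (tri_poly n b)"
  let ?P = "{x. 0 < x \<and> ?p x = 0}" and ?N = "{x. x < 0 \<and> ?p x = 0}" and ?Z = "{x. x = 0 \<and> ?p x = 0}"
  have ne: "tri_poly n b \<noteq> 0" using tri_poly_monic[of n b] by auto
  have fin: "finite {x. ?p x = 0}" by (rule poly_roots_finite[OF ne])
  then show finP: "finite ?P" by (rule rev_finite_subset) auto
  have finN: "finite ?N" using fin by (rule rev_finite_subset) auto
  have root_minus: "?p (- x) = 0 \<longleftrightarrow> ?p x = 0" for x by (simp add: poly_tri_poly_minus)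
  have "?N = uminus ` ?P"
  proof (intro equalityI subsetI)
    fix x assume "x \<in> ?N"
    then have "- x \<in> ?P" "x = - (- x)" by (simp_all add: root_minus)
    then show "x \<in> uminus ` ?P" by blast
  qed (auto simp: root_minus)
  then have cardN: "card ?N = card ?P" by (simp add: card_image)
  have Z: "?Z \<subseteq> {0}" by auto
  then have finZ: "finite ?Z" by (rule finite_subset) simp
  have cardZ: "card ?Z \<le> 1" using card_mono[OF _ Z] by simp
  have roots: "{x. ?p x = 0} = (?P \<union> ?N) \<union> ?Z" by auto
  have "card {x. ?p x = 0} = n" by (rule card_tri_poly_roots[OF assms])
  then have "card ((?P \<union> ?N) \<union> ?Z) = n" unfolding roots .
  moreover have "card ((?P \<union> ?N) \<union> ?Z) = card (?P \<union> ?N) + card ?Z"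
    using finP finN finZ by (intro card_Un_disjoint) auto
  moreover have "card (?P \<union> ?N) = card ?P + card ?N"
    using finP finN by (intro card_Un_disjoint) auto
  moreover have "p = n div 2" if "a = n" "a = u + z" "u = p + q" "q = p" "z \<le> 1" for a u z p q :: nat
    using that by linarith
  ultimately show "card ?P = n div 2" using cardN cardZ by blast
qed

text \<open>The branch is built over \<rho>, in which the equation is polynomial, and composed with
  \<rho> = (cos t)^2. At t = 0 all products \<open>x i + 1\<close> are positive, so the root is
  simple.\<close>

lemma tri_poly_branch:
  fixes x :: "nat \<Rightarrow> real"
  assumes x: "\<And>i. i \<in> {1..<n} \<Longrightarrow> 0 \<le> x i" and root: "poly (tri_poly n (\<lambda>i. x i + 1)) y = 0"
  shows "\<exists>r r' \<tau>. 0 < \<tau> \<and> r 0 = y \<and> (\<forall>t. \<bar>t\<bar> < \<tau> \<longrightarrow> poly (tri_poly n (\<lambda>i. x i + (cos t)\<^sup>2)) (r t) = 0 \<and>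
    (r has_real_derivative r' t) (at t) \<and> (\<exists>D. (r' has_real_derivative D) (at t)))"
proof -
  define F where "F = tri_poly n (\<lambda>i. [:x i, 1:])"
  have "poly2 F y 1 = 0" using root by (simp add: F_def poly2_tri_poly)
  moreover have "poly2 (pderiv F) y 1 \<noteq> 0"
    unfolding F_def poly2_pderiv_tri_poly
    by (rule tri_poly_simple_root[OF _ root]) (use x in \<open>auto intro: add_nonneg_pos\<close>)
  ultimately obtain q \<epsilon> where \<epsilon>: "0 < \<epsilon>" and q1: "q 1 = y"
    and q: "\<And>\<rho>. \<bar>\<rho> - 1\<bar> < \<epsilon> \<Longrightarrow> poly2 F (q \<rho>) \<rho> = 0 \<and> poly2 (pderiv F) (q \<rho>) \<rho> \<noteq> 0 \<and>
      (q has_real_derivative - poly2 (map_poly pderiv F) (q \<rho>) \<rho> / poly2 (pderiv F) (q \<rho>) \<rho>) (at \<rho>)"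
    using implicit_branch by blast
  define q' where "q' = (\<lambda>\<rho>. - poly2 (map_poly pderiv F) (q \<rho>) \<rho> / poly2 (pderiv F) (q \<rho>) \<rho>)"
  have dq: "(q has_real_derivative q' \<rho>) (at \<rho>)" if "\<bar>\<rho> - 1\<bar> < \<epsilon>" for \<rho> using q[OF that] by (simp add: q'_def)
  have dq': "\<exists>D. (q' has_real_derivative D) (at \<rho>)" if \<rho>: "\<bar>\<rho> - 1\<bar> < \<epsilon>" for \<rho>
  proof -
    have nz: "poly2 (pderiv F) (q \<rho>) \<rho> \<noteq> 0" using q[OF \<rho>] by blast
    note d = poly2_has_derivative[OF dq[OF \<rho>] DERIV_ident]
    from DERIV_divide[OF DERIV_minus[OF d[of "map_poly pderiv F"]] d[of "pderiv F"] nz]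
    show ?thesis unfolding q'_def by blast
  qed
  have "isCont (\<lambda>t :: real. \<bar>(cos t)\<^sup>2 - 1\<bar>) 0" by (intro continuous_intros)
  then have "(\<lambda>t :: real. \<bar>(cos t)\<^sup>2 - 1\<bar>) \<midarrow>0\<rightarrow> 0" by (simp add: isCont_def)
  then have "\<forall>\<^sub>F t :: real in at 0. \<bar>(cos t)\<^sup>2 - 1\<bar> < \<epsilon>" using \<epsilon> by (rule order_tendstoD)
  then obtain \<tau> where \<tau>: "0 < \<tau>" "\<And>t. t \<noteq> 0 \<Longrightarrow> \<bar>t\<bar> < \<tau> \<Longrightarrow> \<bar>(cos t)\<^sup>2 - 1\<bar> < \<epsilon>"
    by (auto simp: eventually_at dist_real_def)
  have near: "\<bar>(cos t)\<^sup>2 - 1\<bar> < \<epsilon>" if "\<bar>t\<bar> < \<tau>" for t using \<tau>(2)[of t] that \<epsilon> by (cases "t = 0") auto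
  define r where "r = (\<lambda>t. q ((cos t)\<^sup>2))"
  define r' where "r' = (\<lambda>t. q' ((cos t)\<^sup>2) * (- 2 * cos t * sin t))"
  have dc: "((\<lambda>t. (cos t)\<^sup>2) has_real_derivative - 2 * cos t * sin t) (at t)" for t :: real
    by (auto intro!: derivative_eq_intros)
  have ds: "((\<lambda>t. - 2 * cos t * sin t) has_real_derivative 2 * (sin t)\<^sup>2 - 2 * (cos t)\<^sup>2) (at t)" for t :: real
    by (auto intro!: derivative_eq_intros simp: power2_eq_square)
  have "poly (tri_poly n (\<lambda>i. x i + (cos t)\<^sup>2)) (r t) = 0" "(r has_real_derivative r' t) (at t)"
    "\<exists>D. (r' has_real_derivative D) (at t)" if t: "\<bar>t\<bar> < \<tau>" for t
  proof -
    show "poly (tri_poly n (\<lambda>i. x i + (cos t)\<^sup>2)) (r t) = 0"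
      using q[OF near[OF t]] by (simp add: r_def F_def poly2_tri_poly)
    show "(r has_real_derivative r' t) (at t)"
      unfolding r_def r'_def by (rule DERIV_chain2[OF dq[OF near[OF t]] dc])
    obtain D where "(q' has_real_derivative D) (at ((cos t)\<^sup>2))" using dq'[OF near[OF t]] by blast
    from DERIV_mult[OF DERIV_chain2[OF this dc] ds]
    show "\<exists>D. (r' has_real_derivative D) (at t)" unfolding r'_def by blast
  qed
  moreover have "r 0 = y" by (simp add: r_def q1)
  ultimately show ?thesis using \<tau>(1) by blast
qed

section \<open>Comparison of leading coefficients in cis (2 \<theta>)\<close>

lemma poly_eq_on_infinite:
  fixes p q :: "'a::idom poly"
  assumes "infinite S" "\<And>x. x \<in> S \<Longrightarrow> poly p x = poly q x"
  shows "p = q"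
proof (rule ccontr)
  assume "p \<noteq> q"
  then have "finite {x. poly (p - q) x = 0}" by (intro poly_roots_finite) simp
  moreover have "S \<subseteq> {x. poly (p - q) x = 0}" using assms(2) by auto
  ultimately show False using assms(1) finite_subset by blast
qed

lemma esym_scale: "esym K (\<lambda>i. v * a i) j = v ^ j * esym K a j"
  by (simp add: esym_def sum_distrib_left prod.distrib)

lemma esym_of_real:
  "esym K (\<lambda>i. of_real (a i)) j = (of_real (esym K a j) :: 'a::{real_algebra_1,comm_ring_1})"
  by (simp add: esym_def)

lemma poly_matching_poly: "poly (matching_poly n b p) x = matching_poly n (\<lambda>i. poly (b i) x) (poly p x)"
  by (simp add: matching_poly_def poly_sum poly_matching_sum)

text \<open>With \<open>v = cis (- 2 t)\<close>, both \<open>v (cos t)\<^sup>2\<close> and the trigonometric expression on the right,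
  multiplied by \<open>v\<close>, are quadratic polynomials in \<open>v\<close>; the claim is their comparison at \<open>v = 0\<close>.\<close>

lemma leading_coefficients_matching:
  fixes x :: "nat \<Rightarrow> real" and c :: "'i \<Rightarrow> real" and \<phi> :: "'i \<Rightarrow> complex"
  assumes st: "0 \<le> s" "s < t" "t \<le> pi / 2"
    and eq: "\<And>\<theta>. \<theta> \<in> {s<..<t} \<Longrightarrow>
      matching_sum n (\<lambda>i. x i + (cos \<theta>)\<^sup>2) j = esym P (\<lambda>k. c k + Re (\<phi> k * cis (2 * \<theta>)) / 2) j"
  shows "matching_sum n (\<lambda>_. 1) j = esym P \<phi> j"
proof -
  \<comment> \<open>Since 4 (cos \<theta>)^2 = 2 + v + 1 / v, multiplying by v produces the
    coefficients 1/4, x + 1/2, 1/4; \<open>q\<close> arises in the same way from the real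
    part.\<close>
  define p where "p = matching_sum n (\<lambda>i. [:1 / 4, complex_of_real (x i) + 1 / 2, 1 / 4:]) j"
  define q where "q = esym P (\<lambda>k. [:\<phi> k / 4, complex_of_real (c k), cnj (\<phi> k) / 4:]) j"
  have agree: "poly p (cis (- (2 * \<theta>))) = poly q (cis (- (2 * \<theta>)))" if \<theta>: "\<theta> \<in> {s<..<t}" for \<theta>
  proof -
    let ?v = "cis (- (2 * \<theta>))" and ?w = "cis (2 * \<theta>)"
    have vw: "?v * ?w = 1" by (simp add: cis_mult)
    have w: "cnj ?w = ?v" by (simp add: cis_cnj)
    have cos2: "complex_of_real ((cos \<theta>)\<^sup>2) = (2 + ?w + ?v) / 4"
      by (simp add: complex_eq_iff cos_double_cos)
    have "1 / 4 + ?v * (complex_of_real (x i) + 1 / 2 + ?v * (1 / 4)) = ?v * complex_of_real (x i + (cos \<theta>)\<^sup>2)" for i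
    proof -
      have "?v * complex_of_real (x i + (cos \<theta>)\<^sup>2) = ?v * complex_of_real (x i) + (2 * ?v + ?v * ?w + ?v * ?v) / 4"
        unfolding of_real_add cos2 by (simp add: algebra_simps add_divide_distrib)
      then show ?thesis unfolding vw by (simp add: algebra_simps add_divide_distrib)
    qed
    then have "poly p ?v = ?v ^ j * of_real (matching_sum n (\<lambda>i. x i + (cos \<theta>)\<^sup>2) j)"
      unfolding p_def poly_matching_sum matching_sum_of_real[symmetric] matching_sum_scale[symmetric] by simp
    moreover have "\<phi> k / 4 + ?v * (complex_of_real (c k) + ?v * (cnj (\<phi> k) / 4)) =
        ?v * complex_of_real (c k + Re (\<phi> k * ?w) / 2)" for k
    proof -
      have "complex_of_real (Re (\<phi> k * ?w)) = (\<phi> k * ?w + cnj (\<phi> k) * ?v) / 2"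
        using complex_add_cnj[of "\<phi> k * ?w"] by (simp add: w)
      then have "?v * complex_of_real (c k + Re (\<phi> k * ?w) / 2) =
          ?v * complex_of_real (c k) + (\<phi> k * (?v * ?w) + cnj (\<phi> k) * ?v * ?v) / 4"
        by (simp only: of_real_add of_real_divide of_real_numeral) (simp add: algebra_simps add_divide_distrib)
      then show ?thesis unfolding vw by (simp only: mult_1_right) (simp only: algebra_simps add_divide_distrib times_divide_eq_right)
    qed
    then have "poly q ?v = ?v ^ j * of_real (esym P (\<lambda>k. c k + Re (\<phi> k * ?w) / 2) j)"
      unfolding q_def poly_esym esym_of_real[symmetric] esym_scale[symmetric] by simp
    ultimately show ?thesis using eq[OF \<theta>] by simp
  qed
  have "inj_on (\<lambda>\<theta>. cis (- (2 * \<theta>))) {s<..<t}"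
  proof (rule inj_onI)
    fix \<theta> \<eta> assume \<theta>: "\<theta> \<in> {s<..<t}" and \<eta>: "\<eta> \<in> {s<..<t}" and "cis (- (2 * \<theta>)) = cis (- (2 * \<eta>))"
    then have cos: "cos (2 * \<theta>) = cos (2 * \<eta>)" by (simp add: complex_eq_iff)
    have "2 * \<theta> = 2 * \<eta>" by (rule cos_inj_pi[OF _ _ _ _ cos]) (use \<theta> \<eta> st in auto)
    then show "\<theta> = \<eta>" by simp
  qed
  then have "infinite ((\<lambda>\<theta>. cis (- (2 * \<theta>))) ` {s<..<t})"
    using st(2) by (simp add: finite_image_iff infinite_Ioo)
  then have "p = q" by (rule poly_eq_on_infinite) (use agree in blast)
  then have "poly p 0 = poly q 0" by simp
  \<comment> \<open>At v = 0 all \<open>x i\<close> and \<open>c k\<close> disappear.\<close>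
  then have "(1 / 4) ^ j * matching_sum n (\<lambda>_. 1) j = (1 / 4) ^ j * esym P \<phi> j"
    by (simp add: p_def q_def poly_matching_sum poly_esym flip: matching_sum_scale esym_scale)
  then show ?thesis by simp
qed

lemma factorization_if_concentric_ellipses:
  assumes A: "A \<in> reciprocal_matrices n"
    and fin: "finite \<E>" and ell: "\<And>E. E \<in> \<E> \<Longrightarrow> is_central_ellipse E"
    and curve: "kippenhahn_curve A \<subseteq> \<Union>\<E> \<union> {0}"
  shows "\<exists>C. \<forall>\<rho> \<mu>. matching_poly n (\<lambda>i. xi A i + \<rho>) \<mu> =
      (\<Prod>k\<in>{1..n div 2}. \<mu> - (C k + \<rho> * (X_node n k)\<^sup>2))"
proof -
  let ?K = "{1..n div 2}"
  define b where "b = (\<lambda>t i. xi A i + (cos t)\<^sup>2)"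
  \<comment> \<open>The positive roots at \<theta> = 0 serve as names of the branches.\<close>
  define P where "P = {y. 0 < y \<and> poly (tri_poly n (\<lambda>i. xi A i + 1)) y = 0}"
  have xi: "0 \<le> xi A i" for i by (simp add: xi_def)
  then have xi1: "0 < xi A i + 1" for i by (simp add: add_nonneg_pos)
  have P: "finite P" "card P = n div 2"
    unfolding P_def using card_positive_tri_poly_roots[of n "\<lambda>i. xi A i + 1"] xi1 by auto
  define Br where "Br = (\<lambda>y r r' \<tau>. 0 < \<tau> \<and> r 0 = y \<and> (\<forall>t. \<bar>t\<bar> < \<tau> \<longrightarrow> poly (tri_poly n (b t)) (r t) = 0 \<and>
    (r has_real_derivative r' t) (at t) \<and> (\<exists>D. (r' has_real_derivative D) (at t))))"
  have "\<forall>y\<in>P. \<exists>r r' \<tau>. Br y r r' \<tau>"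
  proof
    fix y assume "y \<in> P"
    then have "poly (tri_poly n (\<lambda>i. xi A i + 1)) y = 0" by (simp add: P_def)
    then show "\<exists>r r' \<tau>. Br y r r' \<tau>" unfolding Br_def b_def by (intro tri_poly_branch xi)
  qed
  then obtain r r' \<tau> where "\<forall>y\<in>P. Br y (r y) (r' y) (\<tau> y)" by metis
  then have \<tau>: "\<And>y. y \<in> P \<Longrightarrow> 0 < \<tau> y" and r0: "\<And>y. y \<in> P \<Longrightarrow> r y 0 = y"
    and root: "\<And>y t. y \<in> P \<Longrightarrow> \<bar>t\<bar> < \<tau> y \<Longrightarrow> poly (tri_poly n (b t)) (r y t) = 0"
    and r: "\<And>y t. y \<in> P \<Longrightarrow> \<bar>t\<bar> < \<tau> y \<Longrightarrow> (r y has_real_derivative r' y t) (at t)"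
    and r'': "\<And>y t. y \<in> P \<Longrightarrow> \<bar>t\<bar> < \<tau> y \<Longrightarrow> \<exists>D. (r' y has_real_derivative D) (at t)"
    unfolding Br_def by blast+
  have lim: "(r y \<longlongrightarrow> y) (at 0)" if "y \<in> P" for y
    using DERIV_isCont[OF r[OF that, of 0]] \<tau>[OF that] r0[OF that] by (simp add: isCont_def)
  \<comment> \<open>Near 0 the branches stay positive and distinct, so their squares are
    \<open>n div 2\<close> distinct roots in \<mu>.\<close>
  have "\<forall>\<^sub>F t in at 0. \<forall>y\<in>P. \<bar>t\<bar> < \<tau> y \<and> 0 < r y t \<and> (\<forall>y'\<in>P. y \<noteq> y' \<longrightarrow> r y t \<noteq> r y' t)"
  proof (intro eventually_ball_finite P(1) ballI eventually_conj)
    fix y assume y: "y \<in> P"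
    show "\<forall>\<^sub>F t in at 0. \<bar>t\<bar> < \<tau> y"
      using \<tau>[OF y] by (auto simp: eventually_at dist_real_def)
    show "\<forall>\<^sub>F t in at 0. 0 < r y t" using lim[OF y] y by (intro order_tendstoD) (auto simp: P_def)
    fix y' assume y': "y' \<in> P"
    show "\<forall>\<^sub>F t in at 0. y \<noteq> y' \<longrightarrow> r y t \<noteq> r y' t"
    proof (cases "y = y'")
      case False
      have "\<forall>\<^sub>F t in at 0. r y t - r y' t \<noteq> 0"
        using tendsto_diff[OF lim[OF y] lim[OF y']] False by (intro tendsto_imp_eventually_ne) auto
      then show ?thesis by (rule eventually_mono) simp
    qed simp
  qed
  then obtain \<delta> where \<delta>: "0 < \<delta>" "\<And>t. t \<noteq> 0 \<Longrightarrow> \<bar>t\<bar> < \<delta> \<Longrightarrow>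
      \<forall>y\<in>P. \<bar>t\<bar> < \<tau> y \<and> 0 < r y t \<and> (\<forall>y'\<in>P. y \<noteq> y' \<longrightarrow> r y t \<noteq> r y' t)"
    by (auto simp: eventually_at dist_real_def)
  \<comment> \<open>The bound pi / 2 keeps 2 \<theta> in [0, pi], where cos is injective, so that a
    subinterval yields infinitely many values of \<rho> and of cis (- 2 \<theta>).\<close>
  define T where "T = min \<delta> (pi / 2)"
  have T: "0 < T" "T \<le> pi / 2" using \<delta>(1) by (simp_all add: T_def)
  have near: "\<forall>y\<in>P. \<bar>t\<bar> < \<tau> y \<and> 0 < r y t \<and> (\<forall>y'\<in>P. y \<noteq> y' \<longrightarrow> r y t \<noteq> r y' t)" if "t \<in> {0<..<T}" for t
    using that by (intro \<delta>(2)) (auto simp: T_def)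
  have in_curve: "envelope_point (r y) (r' y) t \<in> \<Union>\<E> \<union> {0}" if y: "y \<in> P" and t: "t \<in> {0<..<T}" for y t
  proof -
    have "\<forall>\<^sub>F u in nhds t. u \<in> {0<..<T}" using t by (intro eventually_nhds_in_open) auto
    then have "\<forall>\<^sub>F u in nhds t. r y differentiable (at u) \<and> kippenhahn_poly A (of_real (r y u)) u = 0"
    proof (rule eventually_mono)
      fix u assume "u \<in> {0<..<T}"
      then have "\<bar>u\<bar> < \<tau> y" using near y by blast
      then show "r y differentiable (at u) \<and> kippenhahn_poly A (of_real (r y u)) u = 0"
        using r[OF y] root[OF y] unfolding kippenhahn_poly_real_root[OF A] b_def
        by (auto simp: real_differentiable_def)
    qed
    moreover have "(r y has_real_derivative r' y t) (at t)" using r[OF y] near[OF t] y by blast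
    moreover have "t \<in> {-pi<..pi}" using t T(2) by auto
    ultimately have "envelope_point (r y) (r' y) t \<in> kippenhahn_curve A"
      unfolding kippenhahn_curve_def vertical_line_rotated_iff Re_cis_mult_minus_has_derivative_iff
        mem_Collect_eq
      by (intro bexI[of _ t] exI[of _ "r y"]) (simp_all only: cis_mult_envelope_point simp_thms)
    then show ?thesis using curve by blast
  qed
  have "\<exists>s' t'. 0 \<le> s' \<and> s' < t' \<and> t' \<le> T \<and> (\<forall>y\<in>P. squared_trig_on (r y) s' t')"
  proof (rule common_subinterval[OF P(1) T(1)])
    show "squared_trig_on (r x) s' t'" if "squared_trig_on (r x) s t" "s \<le> s'" "t' \<le> t" for x s t s' t'
      using that by (rule squared_trig_on_subinterval)
    fix y s t assume y: "y \<in> P" and st: "0 \<le> s" "s < t" "t \<le> T"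
    have sub: "u \<in> {0<..<T}" if "u \<in> {s<..<t}" for u using that st by auto
    then have "\<forall>u\<in>{s<..<t}. \<exists>D. (r' y has_real_derivative D) (at u)"
      using r''[OF y] near y by blast
    then obtain r2 where r2: "\<And>u. u \<in> {s<..<t} \<Longrightarrow> (r' y has_real_derivative r2 u) (at u)" by metis
    have r1: "(r y has_real_derivative r' y u) (at u)" if "u \<in> {s<..<t}" for u
      using r[OF y] near[OF sub[OF that]] y by blast
    show "\<exists>s'' t''. s \<le> s'' \<and> s'' < t'' \<and> t'' \<le> t \<and> squared_trig_on (r y) s'' t''"
      by (rule squared_trig_on_concentric_ellipses[OF fin ell st(2) r1 r2 in_curve[OF y sub]])
  qed
  then obtain s t where st: "0 \<le> s" "s < t" "t \<le> T" and "\<forall>y\<in>P. squared_trig_on (r y) s t" by blast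
  then have "\<forall>y\<in>P. \<exists>c \<phi>. \<forall>\<theta>\<in>{s<..<t}. (r y \<theta>)\<^sup>2 = c + Re (\<phi> * cis (2 * \<theta>)) / 2"
    by (simp only: squared_trig_on_def)
  then obtain c \<phi> where c\<phi>: "\<And>y \<theta>. y \<in> P \<Longrightarrow> \<theta> \<in> {s<..<t} \<Longrightarrow> (r y \<theta>)\<^sup>2 = c y + Re (\<phi> y * cis (2 * \<theta>)) / 2"
    by metis
  have st': "0 \<le> s" "s < t" "t \<le> pi / 2" using st T by auto
  have fact: "matching_poly n (b \<theta>) \<mu> = (\<Prod>y\<in>P. \<mu> - (c y + Re (\<phi> y * cis (2 * \<theta>)) / 2))" if \<theta>: "\<theta> \<in> {s<..<t}" for \<theta> \<mu>
  proof (rule matching_poly_eq_prod[OF P])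
    have \<theta>': "\<theta> \<in> {0<..<T}" using \<theta> st by auto
    note near = near[OF \<theta>']
    show "inj_on (\<lambda>y. c y + Re (\<phi> y * cis (2 * \<theta>)) / 2) P"
    proof (rule inj_onI)
      fix y y' assume y: "y \<in> P" "y' \<in> P" and "c y + Re (\<phi> y * cis (2 * \<theta>)) / 2 = c y' + Re (\<phi> y' * cis (2 * \<theta>)) / 2"
      then have "(r y \<theta>)\<^sup>2 = (r y' \<theta>)\<^sup>2" using c\<phi>[OF _ \<theta>] by metis
      moreover have "0 \<le> r y \<theta>" "0 \<le> r y' \<theta>" using near y by (auto intro: less_imp_le)
      ultimately have "r y \<theta> = r y' \<theta>" by (rule power2_eq_imp_eq)
      then show "y = y'" using near y by blast
    qed
    fix y assume y: "y \<in> P"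
    then have "poly (tri_poly n (b \<theta>)) (r y \<theta>) = 0" "r y \<theta> \<noteq> 0" using root near by auto
    then have "matching_poly n (b \<theta>) ((r y \<theta>)\<^sup>2) = 0" by (simp add: poly_tri_poly)
    then show "matching_poly n (b \<theta>) (c y + Re (\<phi> y * cis (2 * \<theta>)) / 2) = 0"
      unfolding c\<phi>[OF y \<theta>] .
  qed
  have lead: "matching_sum n (\<lambda>_. 1) j = esym P \<phi> j" if j: "j \<le> n div 2" for j
  proof (rule leading_coefficients_matching[OF st'])
    fix \<theta> assume "\<theta> \<in> {s<..<t}"
    from fact[OF this] show "matching_sum n (\<lambda>i. xi A i + (cos \<theta>)\<^sup>2) j = esym P (\<lambda>k. c k + Re (\<phi> k * cis (2 * \<theta>)) / 2) j"
      using matching_poly_eq_prod_iff[OF P, of "b \<theta>"] j unfolding b_def by blast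
  qed
  define X2 where "X2 = (\<lambda>k. complex_of_real ((X_node n k)\<^sup>2))"
  have "(\<Prod>y\<in>P. \<mu> - \<phi> y) = (\<Prod>k\<in>?K. \<mu> - X2 k)" for \<mu>
  proof -
    have "matching_poly n (\<lambda>_. 1) \<mu> = (\<Prod>y\<in>P. \<mu> - \<phi> y)"
      using matching_poly_eq_prod_iff[OF P, of "\<lambda>_. 1::complex" \<phi>] lead by blast
    moreover have "matching_sum n (\<lambda>_. 1) j = esym ?K X2 j" if "j \<le> n div 2" for j
      using arg_cong[OF matching_sum_1_eq_esym[OF that], of complex_of_real]
      unfolding X2_def matching_sum_of_real[symmetric] esym_of_real[symmetric] by simp
    then have "matching_poly n (\<lambda>_. 1) \<mu> = (\<Prod>k\<in>?K. \<mu> - X2 k)"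
      using matching_poly_eq_prod_iff[of ?K n "\<lambda>_. 1::complex" X2] by simp
    ultimately show ?thesis by simp
  qed
  then have zero_iff: "(\<exists>y\<in>P. \<mu> = \<phi> y) \<longleftrightarrow> (\<exists>k\<in>?K. \<mu> = X2 k)" for \<mu>
    using P(1) prod_zero_iff[of P "\<lambda>y. \<mu> - \<phi> y"] prod_zero_iff[of ?K "\<lambda>k. \<mu> - X2 k"] by auto
  \<comment> \<open>The products determine only the sets of zeros; but the values
    \<open>X2 k\<close> are distinct and as many as the elements of \<open>P\<close>, so \<phi> is
    injective and the sets yield a bijection.\<close>
  have image: "\<phi> ` P = X2 ` ?K" using zero_iff by blast
  have injX: "inj_on X2 ?K"
    using inj_on_X_node_sq[of n] unfolding X2_def inj_on_def of_real_eq_iff .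
  have "card (\<phi> ` P) = card P" unfolding image using P injX by (simp add: card_image)
  then have inj\<phi>: "inj_on \<phi> P" using P(1) by (intro eq_card_imp_inj_on)
  define \<sigma> where "\<sigma> = (\<lambda>k. the_inv_into P \<phi> (X2 k))"
  have \<sigma>: "\<sigma> k \<in> P" "\<phi> (\<sigma> k) = X2 k" if "k \<in> ?K" for k
  proof -
    have "X2 k \<in> \<phi> ` P" using that image by blast
    then show "\<sigma> k \<in> P" "\<phi> (\<sigma> k) = X2 k"
      unfolding \<sigma>_def using inj\<phi> by (auto intro: the_inv_into_into f_the_inv_into_f)
  qed
  have inj\<sigma>: "inj_on \<sigma> ?K" using \<sigma> injX unfolding inj_on_def by metis
  moreover have "\<sigma> ` ?K = P"
    using \<sigma> P card_image[OF inj\<sigma>] by (intro card_subset_eq) auto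
  ultimately have bij: "bij_betw \<sigma> ?K P" by (simp add: bij_betw_def)
  \<comment> \<open>The shift comes from X^2 cos (2 \<theta>) / 2 = X^2 (cos \<theta>)^2 - X^2 /
    2.\<close>
  define C where "C = (\<lambda>k. c (\<sigma> k) - (X_node n k)\<^sup>2 / 2)"
  have fact': "matching_poly n (\<lambda>i. xi A i + (cos \<theta>)\<^sup>2) \<mu> = (\<Prod>k\<in>?K. \<mu> - (C k + (cos \<theta>)\<^sup>2 * (X_node n k)\<^sup>2))"
    if \<theta>: "\<theta> \<in> {s<..<t}" for \<theta> \<mu>
  proof -
    have "matching_poly n (\<lambda>i. xi A i + (cos \<theta>)\<^sup>2) \<mu> =
        (\<Prod>k\<in>?K. \<mu> - (c (\<sigma> k) + Re (\<phi> (\<sigma> k) * cis (2 * \<theta>)) / 2))"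
      using trans[OF fact[OF \<theta>, of \<mu>]
          prod.reindex_bij_betw[OF bij, of "\<lambda>y. \<mu> - (c y + Re (\<phi> y * cis (2 * \<theta>)) / 2)", symmetric]]
      unfolding b_def .
    also have "\<dots> = (\<Prod>k\<in>?K. \<mu> - (C k + (cos \<theta>)\<^sup>2 * (X_node n k)\<^sup>2))"
    proof (intro prod.cong refl arg_cong2[where f = "(-)"])
      fix k assume "k \<in> ?K"
      then have "Re (\<phi> (\<sigma> k) * cis (2 * \<theta>)) = (X_node n k)\<^sup>2 * cos (2 * \<theta>)"
        by (simp add: \<sigma>(2) X2_def flip: of_real_power)
      then show "c (\<sigma> k) + Re (\<phi> (\<sigma> k) * cis (2 * \<theta>)) / 2 = C k + (cos \<theta>)\<^sup>2 * (X_node n k)\<^sup>2"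
        unfolding C_def cos_double_cos by (simp add: field_simps)
    qed
    finally show ?thesis .
  qed
  have "inj_on (\<lambda>\<theta>. (cos \<theta>)\<^sup>2) {s<..<t}"
  proof (rule inj_onI)
    fix \<theta> \<eta> :: real assume \<theta>: "\<theta> \<in> {s<..<t}" and \<eta>: "\<eta> \<in> {s<..<t}" and "(cos \<theta>)\<^sup>2 = (cos \<eta>)\<^sup>2"
    then have cos: "cos (2 * \<theta>) = cos (2 * \<eta>)" by (simp only: cos_double_cos)
    have "2 * \<theta> = 2 * \<eta>" by (rule cos_inj_pi[OF _ _ _ _ cos]) (use \<theta> \<eta> st' in auto)
    then show "\<theta> = \<eta>" by simp
  qed
  then have inf: "infinite ((\<lambda>\<theta>. (cos \<theta>)\<^sup>2) ` {s<..<t})"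
    using st(2) by (simp add: finite_image_iff infinite_Ioo)
  have "matching_poly n (\<lambda>i. xi A i + \<rho>) \<mu> = (\<Prod>k\<in>?K. \<mu> - (C k + \<rho> * (X_node n k)\<^sup>2))" for \<rho> \<mu>
  proof -
    \<comment> \<open>For fixed \<mu> both sides are polynomials in \<rho> that agree at infinitely
      many values of (cos \<theta>)^2.\<close>
    have "matching_poly n (\<lambda>i. [:xi A i, 1:]) [:\<mu>:] = (\<Prod>k\<in>?K. [:\<mu>:] - [:C k, (X_node n k)\<^sup>2:])"
      using inf by (rule poly_eq_on_infinite) (auto simp: poly_matching_poly poly_prod fact' diff_diff_eq)
    from arg_cong[OF this, of "\<lambda>p. poly p \<rho>"] show ?thesis by (simp add: poly_matching_poly poly_prod diff_diff_eq)
  qed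
  then show ?thesis by blast
qed

section \<open>Factorization, identities and the system of equations\<close>

lemma identities_iff_factorization:
  "(\<forall>j\<in>{1..n div 2}. identity_lhs n C j = identity_rhs n x j) \<longleftrightarrow>
   (\<forall>\<rho> \<mu>. matching_poly n (\<lambda>i. x i + \<rho>) \<mu> = (\<Prod>k\<in>{1..n div 2}. \<mu> - (C k + \<rho> * (X_node n k)\<^sup>2)))"
proof -
  \<comment> \<open>The case j = 0 reads 1 = 1; adding it completes the list of coefficients in
    \<mu>.\<close>
  have 0: "matching_sum n (\<lambda>i. x i + \<rho>) 0 = esym {1..n div 2} (\<lambda>k. C k + \<rho> * (X_node n k)\<^sup>2) 0" for \<rho>
  proof -
    have "{S. S \<subseteq> {1..n div 2} \<and> card S = 0} = {{}}" by (auto dest: finite_subset)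
    then show ?thesis by (simp add: esym_def)
  qed
  have "identity_lhs n C j = identity_rhs n x j \<longleftrightarrow>
      (\<forall>\<rho>. matching_sum n (\<lambda>i. x i + \<rho>) j = esym {1..n div 2} (\<lambda>k. C k + \<rho> * (X_node n k)\<^sup>2) j)" for j
  proof -
    have "identity_lhs n C j = identity_rhs n x j \<longleftrightarrow> (\<forall>\<rho>. poly (identity_lhs n C j) \<rho> = poly (identity_rhs n x j) \<rho>)"
      by (simp add: fun_eq_iff flip: poly_eq_poly_eq_iff)
    moreover have "poly (identity_lhs n C j) \<rho> = poly (identity_rhs n x j) \<rho> \<longleftrightarrow>
        matching_sum n (\<lambda>i. x i + \<rho>) j = esym {1..n div 2} (\<lambda>k. C k + \<rho> * (X_node n k)\<^sup>2) j" for \<rho>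
      unfolding poly_identity_rhs identity_lhs_eq poly_esym by auto
    ultimately show ?thesis by blast
  qed
  moreover have "(\<forall>j\<in>{1..m}. \<forall>\<rho>. Q \<rho> j) \<longleftrightarrow> (\<forall>\<rho>. \<forall>j\<le>m. Q \<rho> j)" if Q0: "\<And>\<rho>. Q \<rho> 0"
    for Q :: "real \<Rightarrow> nat \<Rightarrow> bool" and m
  proof (intro iffI allI impI ballI)
    fix \<rho> j assume "\<forall>j\<in>{1..m}. \<forall>\<rho>. Q \<rho> j" "j \<le> m"
    then show "Q \<rho> j" using Q0 by (cases "j = 0") auto
  qed auto
  ultimately have "(\<forall>j\<in>{1..n div 2}. identity_lhs n C j = identity_rhs n x j) \<longleftrightarrow>
     (\<forall>\<rho>. \<forall>j\<le>n div 2. matching_sum n (\<lambda>i. x i + \<rho>) j = esym {1..n div 2} (\<lambda>k. C k + \<rho> * (X_node n k)\<^sup>2) j)"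
    using 0 by presburger
  also have "\<dots> \<longleftrightarrow> (\<forall>\<rho> \<mu>. matching_poly n (\<lambda>i. x i + \<rho>) \<mu> =
      (\<Prod>k\<in>{1..n div 2}. \<mu> - (C k + \<rho> * (X_node n k)\<^sup>2)))"
    by (subst matching_poly_eq_prod_iff) simp_all
  finally show ?thesis .
qed

lemma concentric_ellipses_iff_identities:
  assumes "A \<in> reciprocal_matrices n"
  shows "consists_of_concentric_ellipses A \<longleftrightarrow>
    (\<exists>C. \<forall>j\<in>{1..n div 2}. identity_lhs n C j = identity_rhs n (xi A) j)"
proof
  assume "consists_of_concentric_ellipses A"
  then obtain \<E> where "finite \<E>" "\<forall>E\<in>\<E>. is_central_ellipse E" "kippenhahn_curve A \<subseteq> \<Union>\<E> \<union> {0}"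
    unfolding consists_of_concentric_ellipses_def by (auto split: if_splits)
  then show "\<exists>C. \<forall>j\<in>{1..n div 2}. identity_lhs n C j = identity_rhs n (xi A) j"
    using factorization_if_concentric_ellipses[OF assms, of \<E>] unfolding identities_iff_factorization by blast
next
  assume "\<exists>C. \<forall>j\<in>{1..n div 2}. identity_lhs n C j = identity_rhs n (xi A) j"
  then show "consists_of_concentric_ellipses A"
    unfolding identities_iff_factorization using concentric_ellipses_if_factorization[OF assms] by blast
qed

text \<open>The coefficients of \<rho>^j agree by the Chebyshev factorization, and all higher ones
  are 0. Only the powers below \<rho>^j impose conditions.\<close>

lemma coeff_identities_top:
  assumes "j \<le> n div 2" "j \<le> d"
  shows "coeff (identity_lhs n C j) d = coeff (identity_rhs n x j) d"
proof -
  have sets: "{T. T \<subseteq> S \<and> card T + d = j} = (if d = j then {{}} else {})" if "finite S" for S :: "nat set"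
    using that assms(2) by (auto dest: finite_subset)
  have "coeff (identity_lhs n C j) d = (\<Sum>S | S \<subseteq> {1..n div 2} \<and> card S = j.
      if d = j then \<Prod>i\<in>S. (X_node n i)\<^sup>2 else 0)"
    unfolding identity_lhs_eq coeff_esym_linear[OF finite_atLeastAtMost]
  proof (intro sum.cong refl)
    fix S assume "S \<in> {S. S \<subseteq> {1..n div 2} \<and> card S = j}"
    then have fin: "finite S" by (auto intro: finite_subset)
    show "(\<Sum>T | T \<subseteq> S \<and> card T + d = j. (\<Prod>i\<in>T. C i) * (\<Prod>i\<in>S - T. (X_node n i)\<^sup>2)) =
        (if d = j then \<Prod>i\<in>S. (X_node n i)\<^sup>2 else 0)"
      unfolding sets[OF fin] by simp
  qed
  also have "\<dots> = (if d = j then matching_sum n (\<lambda>_. 1) j else 0)"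
    by (simp add: matching_sum_1_eq_esym[OF assms(1)] esym_def)
  also have "\<dots> = coeff (identity_rhs n x j) d"
    unfolding coeff_identity_rhs by (simp add: sets sparse_setsD(3) matching_sum_def)
  finally show ?thesis .
qed

text \<open>The coefficients of \<rho>^(j-1) force C to be the given linear functions of x, which
  removes the existential quantifier; the lower coefficients are then exactly the equations of the
  system.\<close>

lemma identities_iff_system:
  assumes L: "\<forall>x C. linear_equations n C x \<longleftrightarrow> (\<forall>k\<in>{1..n div 2}. C k = linear_functions n L x k)"
  shows "(\<exists>C. \<forall>j\<in>{1..n div 2}. identity_lhs n C j = identity_rhs n x j) \<longleftrightarrow>
    (\<forall>e\<in>system_index n. system_poly n L e x = 0)"
proof
  assume "\<exists>C. \<forall>j\<in>{1..n div 2}. identity_lhs n C j = identity_rhs n x j"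
  then obtain C where C: "\<forall>j\<in>{1..n div 2}. identity_lhs n C j = identity_rhs n x j" by blast
  then have "linear_equations n C x" by (simp add: linear_equations_def)
  then have "\<forall>k\<in>{1..n div 2}. C k = linear_functions n L x k" using L by blast
  \<comment> \<open>The linear equations determine C only on \<open>{1..n div 2}\<close>, and
    \<open>identity_lhs\<close> looks at no other value.\<close>
  then have "identity_lhs n (linear_functions n L x) j = identity_lhs n C j" for j
    unfolding identity_lhs_def by (intro sum.cong prod.cong refl) (auto dest!: subsetD)
  then show "\<forall>e\<in>system_index n. system_poly n L e x = 0"
    using C by (auto simp: system_index_def system_poly_def)
next
  assume sys: "\<forall>e\<in>system_index n. system_poly n L e x = 0"
  define C where "C = linear_functions n L x"
  have lin: "linear_equations n C x" using L by (simp add: C_def)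
  have "identity_lhs n C j = identity_rhs n x j" if j: "j \<in> {1..n div 2}" for j
  proof (rule poly_eqI)
    fix d
    consider "j \<le> d" | "d = j - 1" | "d + 2 \<le> j" by linarith
    then show "coeff (identity_lhs n C j) d = coeff (identity_rhs n x j) d"
    proof cases
      case 1
      then show ?thesis using j by (intro coeff_identities_top) auto
    next
      case 2
      then show ?thesis using lin j by (simp add: linear_equations_def)
    next
      case 3
      then have "(j, d) \<in> system_index n" using j by (auto simp: system_index_def)
      then show ?thesis using sys by (fastforce simp: system_poly_def C_def)
    qed
  qed
  then show "\<exists>C. \<forall>j\<in>{1..n div 2}. identity_lhs n C j = identity_rhs n x j" by blast
qed

theorem theorem4:
  fixes n :: nat and A :: "complex mat"
  assumes "n \<ge> 1" and "A \<in> reciprocal_matrices n"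
  shows "(\<exists>M. is_coefficient_matrix n M \<and> invertible_mat M) \<and>
    (\<exists>L. (\<forall>x C. linear_equations n C x \<longleftrightarrow> (\<forall>k\<in>{1..n div 2}. C k = linear_functions n L x k)) \<and>
       card (system_index n) = (n div 2) * (n div 2 - 1) div 2 \<and>
       (\<forall>e\<in>system_index n. \<exists>d. homogeneous_of_degree {1..<n} d (system_poly n L e)) \<and>
       (\<forall>k\<in>{1..n div 2 - 1}.
          card {e \<in> system_index n. homogeneous_of_degree {1..<n} (n div 2 - k + 1) (system_poly n L e)} = k) \<and>
       (consists_of_concentric_ellipses A \<longleftrightarrow>
          (\<forall>e\<in>system_index n. system_poly n L e (xi A) = 0)))"
proof (intro conjI)
  obtain M where M: "is_coefficient_matrix n M" "det M \<noteq> 0" using coefficient_matrix_det_nonzero by blast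
  then have carrier: "M \<in> carrier_mat (n div 2) (n div 2)" by (simp add: is_coefficient_matrix_def)
  then obtain B where "B \<in> carrier_mat (n div 2) (n div 2)" "B * M = 1\<^sub>m (n div 2)" "M * B = 1\<^sub>m (n div 2)"
    using det_non_zero_imp_unit[OF carrier M(2)] by (auto simp: Units_def ring_mat_def)
  then have "invertible_mat M" using carrier by (auto simp: invertible_mat_def inverts_mat_def)
  then show "\<exists>M. is_coefficient_matrix n M \<and> invertible_mat M" using M(1) by blast
next
  obtain L where L: "\<forall>x C. linear_equations n C x \<longleftrightarrow> (\<forall>k\<in>{1..n div 2}. C k = linear_functions n L x k)"
    using linear_equations_solvable by blast
  \<comment> \<open>Each equation is nonzero and so has exactly one degree, which turns the count by
    degree into a count of index pairs.\<close>
  have "{e \<in> system_index n. homogeneous_of_degree {1..<n} d (system_poly n L e)} =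
      {e \<in> system_index n. fst e - snd e = d}" for d
    using homogeneous_system_poly[OF L] by auto
  then show "\<exists>L. (\<forall>x C. linear_equations n C x \<longleftrightarrow> (\<forall>k\<in>{1..n div 2}. C k = linear_functions n L x k)) \<and>
       card (system_index n) = (n div 2) * (n div 2 - 1) div 2 \<and>
       (\<forall>e\<in>system_index n. \<exists>d. homogeneous_of_degree {1..<n} d (system_poly n L e)) \<and>
       (\<forall>k\<in>{1..n div 2 - 1}.
          card {e \<in> system_index n. homogeneous_of_degree {1..<n} (n div 2 - k + 1) (system_poly n L e)} = k) \<and>
       (consists_of_concentric_ellipses A \<longleftrightarrow>
          (\<forall>e\<in>system_index n. system_poly n L e (xi A) = 0))"
    using L card_system_index[of n] homogeneous_system_poly[OF L] card_system_index_degree[of _ n]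
      concentric_ellipses_iff_identities[OF assms(2)] identities_iff_system[OF L, of "xi A"]
    by (intro exI[of _ L]) auto
qed

end
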